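(* Let $X_*,Y_*$ be two regularly filtered CW-complexes and $\varepsilon\ge0$. If $X_*$ and $Y_*$ are $\varepsilon$-acyclic equivalent, then $d_I(\mathrm{PH}_*(X_* ),\mathrm{PH}_*(Y_* ))\le\varepsilon$.
   Context: CW-complexes are finite and regular, with the cell structure part of the data; homology is cellular homology with coefficients in a fixed field. A regular morphism $f:X\to Y$ is a cellular map such that $\overline{f(a)}$ is a subcomplex of $Y$ for each cell $a$ of $X$. A regularly filtered CW-complex is a functor $X:r\mapsto X_r$ from $(\mathbb R,\le)$ to finite regular CW-complexes and regular morphisms, with structure maps $X(r\le s)$. $X[\varepsilon]_r=X_{r+\varepsilon}$, and $\Sigma^\varepsilon X:X\to X[\varepsilon]$ is the shift. $\mathrm{PH}_n(X)$ is the persistence module $r\mapsto H_n(X_r)$ and $d_I$ is the interleaving distance of persistence modules. A carrier $F:\Phi\rightrightarrows\Gamma$ assigns to each cell $\sigma$ of $\Phi$ a subcomplex $F(\sigma)$ of $\Gamma$ with $F(\tau)\subseteq F(\sigma)$ whenever $\tau$ is a face of $\sigma$; it is acyclic if each $F(\sigma)$ is nonempty and acyclic (homology of a point). A chain map $w:C_*(\Phi)\to C_*(\Gamma)$ is carried by $F$ if for each cell $\sigma$ all cells occurring in $w(\sigma)$ lie in $F(\sigma)$. $F\subseteq G$ means $F(\sigma)\subseteq G(\sigma)$ for all $\sigma$; $(H\circ F)(\sigma)=\bigcup_{\tau\in F(\sigma)}H(\tau)$; for a regular morphism $f$, $F(f(\sigma))=\bigcup_{\tau\in\overline{f(\sigma)}}F(\tau)$.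 An $\varepsilon$-acyclic carrier $F^\varepsilon:X\rightrightarrows Y$ between regularly filtered CW-complexes is a family of acyclic carriers $F^\varepsilon_a:X_a\rightrightarrows Y_{a+\varepsilon}$, $a\in\mathbb R$, such that for all $a\le b$ and all cells $c$ of $X_a$: $Y(a+\varepsilon\le b+\varepsilon)(F^\varepsilon_a(c))\subseteq F^\varepsilon_b(X(a\le b)(c))$, and $F_b^\varepsilon(X(a\le b)(c))$ is acyclic. A shift carrier $I^\varepsilon_X:X\rightrightarrows X$ is an $\varepsilon$-acyclic carrier that carries the chain map induced by $\Sigma^\varepsilon X$. $X$ and $Y$ are $\varepsilon$-acyclic equivalent if there are $\varepsilon$-acyclic carriers $F^\varepsilon:X\rightrightarrows Y$, $G^\varepsilon:Y\rightrightarrows X$ and shift carriers $I_X^{2\varepsilon}$, $I_Y^{2\varepsilon}$ with $G^\varepsilon\circ F^\varepsilon\subseteq I_X^{2\varepsilon}$ and $F^\varepsilon\circ G^\varepsilon\subseteq I_Y^{2\varepsilon}$. *)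

theory Defs
  imports "HOL-Homology.Homology" "HOL-Algebra.Module" "HOL-Algebra.AbelCoset"
    "HOL-Library.Extended_Real"
begin

section \<open>Finite regular CW-complexes\<close>

text \<open>
  A complex is a topological space together with its set of open cells and the dimensions of
  these cells.
\<close>

record 'a cw =
  cw_space :: "'a topology"
  cells :: "'a set set"
  cell_dim :: "'a set \<Rightarrow> nat"

definition cells_of_dim :: "'a cw \<Rightarrow> nat \<Rightarrow> 'a set set" where
  "cells_of_dim X n = {e \<in> cells X. cell_dim X e = n}"

text \<open>The index is an integer, so that the skeleton of index \<open>- 1\<close> is available and empty.\<close>

definition skeleton :: "'a cw \<Rightarrow> int \<Rightarrow> 'a set" where
  "skeleton X p = \<Union> {e \<in> cells X. int (cell_dim X e) \<le> p}"

definition disc :: "nat \<Rightarrow> (nat \<Rightarrow> real) topology" where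
  "disc n = subtopology (Euclidean_space n) {x. (\<Sum>i<n. x i ^ 2) \<le> 1}"

definition disc_interior :: "nat \<Rightarrow> (nat \<Rightarrow> real) set" where
  "disc_interior n = {x \<in> topspace (disc n). (\<Sum>i<n. x i ^ 2) < 1}"

definition disc_boundary :: "nat \<Rightarrow> (nat \<Rightarrow> real) set" where
  "disc_boundary n = {x \<in> topspace (disc n). (\<Sum>i<n. x i ^ 2) = 1}"

text \<open>
  Regularity means that the characteristic maps can be chosen to be embeddings of the closed
  discs. Closure-finiteness and the weak topology are automatic for finitely many cells.
\<close>

definition finite_regular_cw :: "'a cw \<Rightarrow> bool" where
  "finite_regular_cw X \<longleftrightarrow>
     Hausdorff_space (cw_space X) \<and>
     finite (cells X) \<and>
     pairwise disjnt (cells X) \<and>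
     \<Union> (cells X) = topspace (cw_space X) \<and>
     (\<forall>e \<in> cells X. \<exists>\<phi>.
        embedding_map (disc (cell_dim X e)) (cw_space X) \<phi> \<and>
        \<phi> ` disc_interior (cell_dim X e) = e \<and>
        \<phi> ` disc_boundary (cell_dim X e) \<subseteq> skeleton X (int (cell_dim X e) - 1))"

definition closed_cell :: "'a cw \<Rightarrow> 'a set \<Rightarrow> 'a set" where
  "closed_cell X e = cw_space X closure_of e"

text \<open>Subcomplexes are represented by their underlying sets.\<close>

definition subcomplex :: "'a cw \<Rightarrow> 'a set \<Rightarrow> bool" where
  "subcomplex X A \<longleftrightarrow> closedin (cw_space X) A \<and> (\<exists>E \<subseteq> cells X. A = \<Union> E)"

definition cells_in :: "'a cw \<Rightarrow> 'a set \<Rightarrow> 'a set set" where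
  "cells_in X A = {e \<in> cells X. e \<subseteq> A}"

definition sub_cw :: "'a cw \<Rightarrow> 'a set \<Rightarrow> 'a cw" where
  "sub_cw X A = \<lparr>cw_space = subtopology (cw_space X) A, cells = cells_in X A, cell_dim = cell_dim X\<rparr>"

definition cellular_map :: "'a cw \<Rightarrow> 'b cw \<Rightarrow> ('a \<Rightarrow> 'b) \<Rightarrow> bool" where
  "cellular_map X Y f \<longleftrightarrow>
     continuous_map (cw_space X) (cw_space Y) f \<and> (\<forall>p. f ` skeleton X p \<subseteq> skeleton Y p)"

definition regular_morphism :: "'a cw \<Rightarrow> 'b cw \<Rightarrow> ('a \<Rightarrow> 'b) \<Rightarrow> bool" where
  "regular_morphism X Y f \<longleftrightarrow>
     cellular_map X Y f \<and> (\<forall>e \<in> cells X. subcomplex Y (cw_space Y closure_of (f ` e)))"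


section \<open>Cellular chains\<close>

text \<open>
  The integral cellular chain group in degree \<open>n\<close> is the singular relative homology group
  of the pair of the skeleta of index \<open>n\<close> and \<open>n - 1\<close>. It is written multiplicatively,
  as in the library.
\<close>

abbreviation skel :: "'a cw \<Rightarrow> int \<Rightarrow> 'a topology" where
  "skel X p \<equiv> subtopology (cw_space X) (skeleton X p)"

definition cell_group :: "'a cw \<Rightarrow> nat \<Rightarrow> 'a chain set monoid" where
  "cell_group X n = relative_homology_group (int n) (skel X (int n)) (skeleton X (int n - 1))"

text \<open>
  An orientation of a cell is a generator of the infinite cyclic relative homology group of the
  closed cell modulo its boundary; one orientation is chosen for every cell. Up to
  isomorphism nothing below depends on this choice.
\<close>

definition orientation :: "'a cw \<Rightarrow> 'a set \<Rightarrow> 'a chain set" where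
  "orientation X e =
     (let G = relative_homology_group (int (cell_dim X e))
                (subtopology (cw_space X) (closed_cell X e)) (closed_cell X e - e)
      in SOME g. g \<in> carrier G \<and> carrier (subgroup_generated G {g}) = carrier G)"

definition cell_class :: "'a cw \<Rightarrow> 'a set \<Rightarrow> 'a chain set" where
  "cell_class X e =
     (let n = int (cell_dim X e)
      in hom_induced n
           (subtopology (cw_space X) (closed_cell X e)) (closed_cell X e - e)
           (skel X n) (skeleton X (n - 1)) id (orientation X e))"

text \<open>
  The group \<open>cell_group X n\<close> is free abelian with the classes of the \<open>n\<close>-cells as a basis;
  the following are the integer coordinates with respect to this basis.
\<close>

definition cell_coords :: "'a cw \<Rightarrow> nat \<Rightarrow> 'a chain set \<Rightarrow> 'a set \<Rightarrow> int" where
  "cell_coords X n z =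
     (THE c. (\<forall>e. e \<notin> cells_of_dim X n \<longrightarrow> c e = 0) \<and>
        z = finprod (cell_group X n) (\<lambda>e. cell_class X e [^]\<^bsub>cell_group X n\<^esub> c e)
              (cells_of_dim X n))"

text \<open>
  The coefficient of the \<open>n\<close>-cell \<open>e'\<close> in the boundary of the \<open>(n + 1)\<close>-cell \<open>e\<close>, where the
  boundary operator is the connecting homomorphism of the triple of the skeleta of index
  \<open>n + 1\<close>, \<open>n\<close> and \<open>n - 1\<close>.
\<close>

definition incidence :: "'a cw \<Rightarrow> nat \<Rightarrow> 'a set \<Rightarrow> 'a set \<Rightarrow> int" where
  "incidence X n e e' =
     cell_coords X n
       (hom_relboundary (int n + 1) (skel X (int n + 1)) (skeleton X (int n))
          (skeleton X (int n - 1)) (cell_class X e)) e'"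

definition map_coeff :: "'a cw \<Rightarrow> 'b cw \<Rightarrow> ('a \<Rightarrow> 'b) \<Rightarrow> nat \<Rightarrow> 'a set \<Rightarrow> 'b set \<Rightarrow> int" where
  "map_coeff X Y f n e e' =
     cell_coords Y n
       (hom_induced (int n) (skel X (int n)) (skeleton X (int n - 1))
          (skel Y (int n)) (skeleton Y (int n - 1)) f (cell_class X e)) e'"

text \<open>
  Vector spaces over the field \<open>'k\<close> are modules over the ring \<open>coeff_field\<close>, which is
  itself represented as a module of rank one. In the other modules below, the multiplicative
  fields of the underlying ring record are irrelevant.
\<close>

definition coeff_field :: "('k::field, 'k) module" where
  "coeff_field = \<lparr>carrier = UNIV, mult = (*), one = 1, zero = 0, add = (+), smult = (*)\<rparr>"

definition linear_hom :: "('k::field, 'v) module \<Rightarrow> ('k, 'w) module \<Rightarrow> ('v \<Rightarrow> 'w) \<Rightarrow> bool" where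
  "linear_hom M N f \<longleftrightarrow>
     f \<in> hom (add_monoid M) (add_monoid N) \<and>
     (\<forall>a. \<forall>x \<in> carrier M. f (a \<odot>\<^bsub>M\<^esub> x) = a \<odot>\<^bsub>N\<^esub> f x)"

text \<open>The tensor product of \<open>cell_group X n\<close> with \<open>'k\<close>, in the basis of \<open>n\<close>-cells.\<close>

definition cell_chains :: "'a cw \<Rightarrow> nat \<Rightarrow> ('k::field, 'a set \<Rightarrow> 'k) module" where
  "cell_chains X n =
     \<lparr>carrier = {c. \<forall>e. e \<notin> cells_of_dim X n \<longrightarrow> c e = 0},
      mult = undefined, one = undefined,
      zero = (\<lambda>e. 0), add = (\<lambda>c d e. c e + d e),
      smult = (\<lambda>a c e. a * c e)\<rparr>"

definition cell_boundary :: "'a cw \<Rightarrow> nat \<Rightarrow> ('a set \<Rightarrow> 'k::field) \<Rightarrow> 'a set \<Rightarrow> 'k" where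
  "cell_boundary X n c = (\<lambda>e'. \<Sum>e \<in> cells_of_dim X (Suc n). c e * of_int (incidence X n e e'))"

definition induced_chain_map ::
  "'a cw \<Rightarrow> 'b cw \<Rightarrow> ('a \<Rightarrow> 'b) \<Rightarrow> nat \<Rightarrow> ('a set \<Rightarrow> 'k::field) \<Rightarrow> 'b set \<Rightarrow> 'k" where
  "induced_chain_map X Y f n c =
     (\<lambda>e'. \<Sum>e \<in> cells_of_dim X n. c e * of_int (map_coeff X Y f n e e'))"


section \<open>Cellular homology\<close>

fun cell_cycles :: "'a cw \<Rightarrow> nat \<Rightarrow> ('a set \<Rightarrow> 'k::field) set" where
  "cell_cycles X 0 = carrier (cell_chains X 0)"
| "cell_cycles X (Suc n) = {c \<in> carrier (cell_chains X (Suc n)). cell_boundary X n c = (\<lambda>e. 0)}"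

definition cell_boundaries :: "'a cw \<Rightarrow> nat \<Rightarrow> ('a set \<Rightarrow> 'k::field) set" where
  "cell_boundaries X n = cell_boundary X n ` carrier (cell_chains X (Suc n))"

definition cell_homology :: "'a cw \<Rightarrow> nat \<Rightarrow> ('k::field, ('a set \<Rightarrow> 'k) set) module" where
  "cell_homology X n =
     (let C = cell_chains X n; B = cell_boundaries X n
      in \<lparr>carrier = {B +>\<^bsub>C\<^esub> z | z. z \<in> cell_cycles X n},
          mult = undefined, one = undefined,
          zero = B, add = set_add C,
          smult = (\<lambda>a S. \<Union>z \<in> S. B +>\<^bsub>C\<^esub> (a \<odot>\<^bsub>C\<^esub> z))\<rparr>)"

definition homology_map ::
  "'a cw \<Rightarrow> 'b cw \<Rightarrow> ('a \<Rightarrow> 'b) \<Rightarrow> nat \<Rightarrow> ('a set \<Rightarrow> 'k::field) set \<Rightarrow> ('b set \<Rightarrow> 'k) set" where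
  "homology_map X Y f n S =
     (\<Union>z \<in> S. cell_boundaries Y n +>\<^bsub>cell_chains Y n\<^esub> induced_chain_map X Y f n z)"

text \<open>The coefficient field enters through its type.\<close>

definition acyclic_sub :: "'k::field itself \<Rightarrow> 'a cw \<Rightarrow> 'a set \<Rightarrow> bool" where
  "acyclic_sub K X A \<longleftrightarrow>
     (\<exists>h. linear_hom coeff_field (cell_homology (sub_cw X A) 0) (h :: 'k \<Rightarrow> ('a set \<Rightarrow> 'k) set) \<and>
        bij_betw h UNIV (carrier (cell_homology (sub_cw X A) 0))) \<and>
     (\<forall>n > 0. carrier (cell_homology (sub_cw X A) n :: ('k, ('a set \<Rightarrow> 'k) set) module)
        = {\<zero>\<^bsub>cell_homology (sub_cw X A) n\<^esub>})"


section \<open>Persistence modules and the interleaving distance\<close>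

record ('k, 'v) pmod =
  pm_at :: "real \<Rightarrow> ('k, 'v) module"
  pm_map :: "real \<Rightarrow> real \<Rightarrow> 'v \<Rightarrow> 'v"

definition persistence_module :: "('k::field, 'v) pmod \<Rightarrow> bool" where
  "persistence_module M \<longleftrightarrow>
     (\<forall>r. module coeff_field (pm_at M r)) \<and>
     (\<forall>r s. r \<le> s \<longrightarrow> linear_hom (pm_at M r) (pm_at M s) (pm_map M r s)) \<and>
     (\<forall>r. \<forall>x \<in> carrier (pm_at M r). pm_map M r r x = x) \<and>
     (\<forall>r s t. r \<le> s \<longrightarrow> s \<le> t \<longrightarrow>
        (\<forall>x \<in> carrier (pm_at M r). pm_map M s t (pm_map M r s x) = pm_map M r t x))"

definition shift_morphism ::
  "real \<Rightarrow> ('k::field, 'v) pmod \<Rightarrow> ('k, 'w) pmod \<Rightarrow> (real \<Rightarrow> 'v \<Rightarrow> 'w) \<Rightarrow> bool" where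
  "shift_morphism \<delta> M N \<phi> \<longleftrightarrow>
     (\<forall>r. linear_hom (pm_at M r) (pm_at N (r + \<delta>)) (\<phi> r)) \<and>
     (\<forall>r s. r \<le> s \<longrightarrow>
        (\<forall>x \<in> carrier (pm_at M r). \<phi> s (pm_map M r s x) = pm_map N (r + \<delta>) (s + \<delta>) (\<phi> r x)))"

definition interleaved :: "real \<Rightarrow> ('k::field, 'v) pmod \<Rightarrow> ('k, 'w) pmod \<Rightarrow> bool" where
  "interleaved \<delta> M N \<longleftrightarrow>
     persistence_module M \<and> persistence_module N \<and>
     (\<exists>\<phi> \<psi>. shift_morphism \<delta> M N \<phi> \<and> shift_morphism \<delta> N M \<psi> \<and>
        (\<forall>r. \<forall>x \<in> carrier (pm_at M r). \<psi> (r + \<delta>) (\<phi> r x) = pm_map M r (r + 2 * \<delta>) x) \<and>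
        (\<forall>r. \<forall>y \<in> carrier (pm_at N r). \<phi> (r + \<delta>) (\<psi> r y) = pm_map N r (r + 2 * \<delta>) y))"

definition interleaving_distance :: "('k::field, 'v) pmod \<Rightarrow> ('k, 'w) pmod \<Rightarrow> ereal" where
  "interleaving_distance M N = Inf {ereal \<delta> | \<delta>. 0 \<le> \<delta> \<and> interleaved \<delta> M N}"


section \<open>Regularly filtered complexes\<close>

text \<open>
  All stages live on one type of points. This is no restriction: any family of spaces can be
  realised on one sufficiently large type.
\<close>

record 'a filtered_cw =
  stage :: "real \<Rightarrow> 'a cw"
  smap :: "real \<Rightarrow> real \<Rightarrow> 'a \<Rightarrow> 'a"

definition regularly_filtered :: "'a filtered_cw \<Rightarrow> bool" where
  "regularly_filtered X \<longleftrightarrow>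
     (\<forall>r. finite_regular_cw (stage X r)) \<and>
     (\<forall>r s. r \<le> s \<longrightarrow> regular_morphism (stage X r) (stage X s) (smap X r s)) \<and>
     (\<forall>r. \<forall>x \<in> topspace (cw_space (stage X r)). smap X r r x = x) \<and>
     (\<forall>r s t. r \<le> s \<longrightarrow> s \<le> t \<longrightarrow>
        (\<forall>x \<in> topspace (cw_space (stage X r)). smap X s t (smap X r s x) = smap X r t x))"

definition PH :: "nat \<Rightarrow> 'a filtered_cw \<Rightarrow> ('k::field, ('a set \<Rightarrow> 'k) set) pmod" where
  "PH n X =
     \<lparr>pm_at = (\<lambda>r. cell_homology (stage X r) n),
      pm_map = (\<lambda>r s. homology_map (stage X r) (stage X s) (smap X r s) n)\<rparr>"


section \<open>Acyclic carriers\<close>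

type_synonym ('a, 'b) carr = "'a set \<Rightarrow> 'b set"

definition is_carrier :: "'a cw \<Rightarrow> 'b cw \<Rightarrow> ('a, 'b) carr \<Rightarrow> bool" where
  "is_carrier X Y F \<longleftrightarrow>
     (\<forall>\<sigma> \<in> cells X. subcomplex Y (F \<sigma>)) \<and>
     (\<forall>\<sigma> \<in> cells X. \<forall>\<tau> \<in> cells_in X (closed_cell X \<sigma>). F \<tau> \<subseteq> F \<sigma>)"

definition acyclic_carrier ::
  "'k::field itself \<Rightarrow> 'a cw \<Rightarrow> 'b cw \<Rightarrow> ('a, 'b) carr \<Rightarrow> bool" where
  "acyclic_carrier K X Y F \<longleftrightarrow>
     is_carrier X Y F \<and> (\<forall>\<sigma> \<in> cells X. F \<sigma> \<noteq> {} \<and> acyclic_sub K Y (F \<sigma>))"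

definition carried_by ::
  "'a cw \<Rightarrow> 'b cw \<Rightarrow> (nat \<Rightarrow> ('a set \<Rightarrow> 'k::field) \<Rightarrow> 'b set \<Rightarrow> 'k) \<Rightarrow> ('a, 'b) carr \<Rightarrow> bool" where
  "carried_by X Y w F \<longleftrightarrow>
     (\<forall>n. \<forall>\<sigma> \<in> cells_of_dim X n. \<forall>\<tau> \<in> cells_of_dim Y n.
        w n (\<lambda>e. if e = \<sigma> then 1 else 0) \<tau> \<noteq> 0 \<longrightarrow> \<tau> \<subseteq> F \<sigma>)"

text \<open>
  The union of the values of \<open>F\<close> over the cells in a subcomplex \<open>A\<close>. With \<open>A\<close> a value of
  another carrier this is the composition of carriers.
\<close>

definition carr_on :: "'a cw \<Rightarrow> ('a, 'b) carr \<Rightarrow> 'a set \<Rightarrow> 'b set" where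
  "carr_on X F A = (\<Union>\<tau> \<in> cells_in X A. F \<tau>)"

definition carr_along :: "'a cw \<Rightarrow> ('a, 'b) carr \<Rightarrow> ('c \<Rightarrow> 'a) \<Rightarrow> ('c, 'b) carr" where
  "carr_along X F f \<sigma> = carr_on X F (cw_space X closure_of (f ` \<sigma>))"

definition eps_acyclic_carrier ::
  "'k::field itself \<Rightarrow> real \<Rightarrow> 'a filtered_cw \<Rightarrow> 'b filtered_cw \<Rightarrow> (real \<Rightarrow> ('a, 'b) carr) \<Rightarrow> bool" where
  "eps_acyclic_carrier K \<epsilon> X Y F \<longleftrightarrow>
     (\<forall>a. acyclic_carrier K (stage X a) (stage Y (a + \<epsilon>)) (F a)) \<and>
     (\<forall>a b. a \<le> b \<longrightarrow> (\<forall>c \<in> cells (stage X a).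
        smap Y (a + \<epsilon>) (b + \<epsilon>) ` F a c \<subseteq> carr_along (stage X b) (F b) (smap X a b) c \<and>
        acyclic_sub K (stage Y (b + \<epsilon>)) (carr_along (stage X b) (F b) (smap X a b) c)))"

definition shift_carrier ::
  "'k::field itself \<Rightarrow> real \<Rightarrow> 'a filtered_cw \<Rightarrow> (real \<Rightarrow> ('a, 'a) carr) \<Rightarrow> bool" where
  "shift_carrier K \<epsilon> X I \<longleftrightarrow>
     eps_acyclic_carrier K \<epsilon> X X I \<and>
     (\<forall>a. carried_by (stage X a) (stage X (a + \<epsilon>))
        (induced_chain_map (stage X a) (stage X (a + \<epsilon>)) (smap X a (a + \<epsilon>)) ::
           nat \<Rightarrow> ('a set \<Rightarrow> 'k) \<Rightarrow> 'a set \<Rightarrow> 'k)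
        (I a))"

definition acyclic_equivalent ::
  "'k::field itself \<Rightarrow> real \<Rightarrow> 'a filtered_cw \<Rightarrow> 'b filtered_cw \<Rightarrow> bool" where
  "acyclic_equivalent K \<epsilon> X Y \<longleftrightarrow>
     (\<exists>F G I J.
        eps_acyclic_carrier K \<epsilon> X Y F \<and> eps_acyclic_carrier K \<epsilon> Y X G \<and>
        shift_carrier K (2 * \<epsilon>) X I \<and> shift_carrier K (2 * \<epsilon>) Y J \<and>
        (\<forall>a. \<forall>\<sigma> \<in> cells (stage X a). carr_on (stage Y (a + \<epsilon>)) (G (a + \<epsilon>)) (F a \<sigma>) \<subseteq> I a \<sigma>) \<and>
        (\<forall>a. \<forall>\<sigma> \<in> cells (stage Y a). carr_on (stage X (a + \<epsilon>)) (F (a + \<epsilon>)) (G a \<sigma>) \<subseteq> J a \<sigma>))"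

end

theory Submission
  imports Defs
begin

text \<open>
  A cellular map acts on cellular chains by an integer matrix. This matrix and the incidence matrix
  are local: a class carried by a compact set that misses a point of a cell has coefficient \<open>0\<close> at
  that cell. Hence closed cells need not be known to be subcomplexes. The signs of the vertices define
  an augmentation that all cellular maps preserve, and therefore the acyclic carrier theorem applies:
  every acyclic carrier carries an augmentation-preserving chain map, which is unique up to homotopy.
  The carriers \<open>F\<close> and \<open>G\<close> thus give chain maps at every stage. They commute with the structure maps
  in homology because both composites are carried by the acyclic carrier
  \<open>c \<mapsto> F\<^sub>b(X(a \<le> b)(c))\<close>, and the inclusions of \<open>G \<circ> F\<close> and \<open>F \<circ> G\<close> in the shift carriers
  identify the composites with the shifts.
\<close>

section \<open>Integral bases of abelian groups\<close>

text \<open>The coefficients \<open>incidence\<close> and \<open>map_coeff\<close> are definite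
  descriptions inside singular relative homology, so nothing can be computed with them before the
  classes of the cells are shown to form a basis. Locality has to produce whole cells: a face is a
  cell contained in the closed cell, and a carrier is monotone along faces only. Signs appear
  because orientations are arbitrary choices: two vertices may carry opposite generators, so the
  plain sum of coefficients is not an augmentation, whereas comparison with one fixed one-point
  space is. The augmentation cannot be avoided: acyclicity prescribes the homology in degree 0 only
  up to an abstract isomorphism with the field, and this must be converted into a criterion for a
  0-chain to bound. Finally, the chain maps are chosen independently at each parameter, so no square
  commutes on chains. The acyclicity of \<open>F\<^sub>b(X(a \<le> b)(c))\<close>, demanded in the
  definition of an \<epsilon>-acyclic carrier, is what makes the squares commute up to
  homotopy.\<close>

lemma hom_finprod:
  assumes "comm_group G" "comm_group H" "h \<in> hom G H" "f \<in> A \<rightarrow> carrier G"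
  shows "h (finprod G f A) = finprod H (\<lambda>x. h (f x)) A"
proof -
  interpret G: comm_group G by fact
  interpret H: comm_group H by fact
  interpret group_hom G H h
    using assms by (simp add: group_hom_def group_hom_axioms_def)
  show ?thesis
    using assms(4)
  proof (induction A rule: infinite_finite_induct)
    case (insert x F)
    then have "f \<in> F \<rightarrow> carrier G" "f x \<in> carrier G"
      by auto
    with insert show ?case
      by (simp add: Pi_iff)
  qed auto
qed

definition int_comb :: "('g, 'm) monoid_scheme \<Rightarrow> ('i \<Rightarrow> 'g) \<Rightarrow> 'i set \<Rightarrow> ('i \<Rightarrow> int) \<Rightarrow> 'g" where
  "int_comb G b E c = finprod G (\<lambda>e. b e [^]\<^bsub>G\<^esub> c e) E"

lemma int_comb_closed:
  assumes "comm_group G" "b \<in> E \<rightarrow> carrier G"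
  shows "int_comb G b E c \<in> carrier G"
proof -
  interpret comm_group G by fact
  show ?thesis
    unfolding int_comb_def using assms(2) by (intro finprod_closed) auto
qed

lemma int_comb_cong:
  assumes "comm_group G" "b \<in> E \<rightarrow> carrier G"
    "\<And>e. e \<in> E \<Longrightarrow> b e = b' e" "\<And>e. e \<in> E \<Longrightarrow> c e = c' e"
  shows "int_comb G b E c = int_comb G b' E c'"
proof -
  interpret comm_group G by fact
  show ?thesis
    unfolding int_comb_def by (rule finprod_cong') (use assms in \<open>auto simp: Pi_iff\<close>)
qed

lemma int_comb_insert:
  assumes "comm_group G" "finite E" "e \<notin> E" "b \<in> insert e E \<rightarrow> carrier G"
  shows "int_comb G b (insert e E) c = b e [^]\<^bsub>G\<^esub> c e \<otimes>\<^bsub>G\<^esub> int_comb G b E c"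
proof -
  interpret comm_group G by fact
  show ?thesis
    unfolding int_comb_def by (rule finprod_insert) (use assms in auto)
qed

lemma int_comb_add:
  assumes "comm_group G" "b \<in> E \<rightarrow> carrier G"
  shows "int_comb G b E (\<lambda>e. c e + d e) = int_comb G b E c \<otimes>\<^bsub>G\<^esub> int_comb G b E d"
proof -
  interpret comm_group G by fact
  have "int_comb G b E (\<lambda>e. c e + d e)
    = finprod G (\<lambda>e. b e [^]\<^bsub>G\<^esub> c e \<otimes>\<^bsub>G\<^esub> b e [^]\<^bsub>G\<^esub> d e) E"
    unfolding int_comb_def using assms(2)
    by (intro finprod_cong') (auto simp: int_pow_mult Pi_iff)
  also have "\<dots> = int_comb G b E c \<otimes>\<^bsub>G\<^esub> int_comb G b E d"
    unfolding int_comb_def using assms(2) by (intro finprod_multf) auto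
  finally show ?thesis .
qed

lemma int_comb_hom:
  assumes "comm_group G" "comm_group H" "h \<in> hom G H" "b \<in> E \<rightarrow> carrier G"
  shows "h (int_comb G b E c) = int_comb H (\<lambda>e. h (b e)) E c"
proof -
  interpret G: comm_group G by fact
  interpret H: comm_group H by fact
  interpret group_hom G H h
    using assms by (simp add: group_hom_def group_hom_axioms_def)
  have "h (int_comb G b E c) = finprod H (\<lambda>e. h (b e [^]\<^bsub>G\<^esub> c e)) E"
    unfolding int_comb_def using assms by (intro hom_finprod) auto
  also have "\<dots> = int_comb H (\<lambda>e. h (b e)) E c"
    unfolding int_comb_def using assms(4)
    by (intro H.finprod_cong') (auto simp: Pi_iff hom_int_pow)
  finally show ?thesis .
qed

lemma int_comb_delta:
  assumes "comm_group G" "finite E" "b \<in> E \<rightarrow> carrier G" "e \<in> E"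
  shows "int_comb G b E (\<lambda>x. if x = e then k else 0) = b e [^]\<^bsub>G\<^esub> k"
proof -
  interpret comm_group G by fact
  have "int_comb G b E (\<lambda>x. if x = e then k else 0)
      = finprod G (\<lambda>x. if x = e then b x [^]\<^bsub>G\<^esub> k else \<one>\<^bsub>G\<^esub>) E"
    unfolding int_comb_def using assms(3) by (intro finprod_cong') (auto simp: Pi_iff)
  also have "\<dots> = b e [^]\<^bsub>G\<^esub> k"
    using assms by (subst finprod_singleton_swap) auto
  finally show ?thesis .
qed

lemma int_comb_single:
  assumes "comm_group G" "finite E" "b \<in> E \<rightarrow> carrier G" "e \<in> E"
    and "\<And>x. \<lbrakk>x \<in> E; x \<noteq> e\<rbrakk> \<Longrightarrow> b x = \<one>\<^bsub>G\<^esub>"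
  shows "int_comb G b E c = b e [^]\<^bsub>G\<^esub> c e"
proof -
  interpret comm_group G by fact
  have "int_comb G b E c = int_comb G b E (\<lambda>x. if x = e then c e else 0)"
    unfolding int_comb_def by (rule finprod_cong') (use assms in \<open>auto simp: Pi_iff\<close>)
  then show ?thesis
    using int_comb_delta[OF assms(1-4)] by simp
qed

lemma int_comb_integer_group:
  assumes "finite E"
  shows "int_comb integer_group b E c = (\<Sum>e\<in>E. c e * b e)"
proof -
  interpret comm_group integer_group by (rule abelian_integer_group)
  show ?thesis
    using assms
  proof (induction E rule: finite_induct)
    case empty
    then show ?case by (simp add: int_comb_def)
  next
    case (insert x F)
    then show ?case
      by (subst int_comb_insert) (auto simp: abelian_integer_group mult.commute)
  qed
qed

text \<open>Coefficient functions are total and forced to vanish off \<open>E\<close>, as in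
  \<open>cell_coords\<close>; otherwise their values off \<open>E\<close> would be arbitrary and
  uniqueness could fail.\<close>

definition free_basis :: "('g, 'm) monoid_scheme \<Rightarrow> ('i \<Rightarrow> 'g) \<Rightarrow> 'i set \<Rightarrow> bool" where
  "free_basis G b E \<longleftrightarrow> comm_group G \<and> finite E \<and> b \<in> E \<rightarrow> carrier G \<and>
     (\<forall>z \<in> carrier G. \<exists>!c. (\<forall>e. e \<notin> E \<longrightarrow> c e = 0) \<and> z = int_comb G b E c)"

lemma free_basisD:
  assumes "free_basis G b E"
  shows "comm_group G" "finite E" "b \<in> E \<rightarrow> carrier G"
    "z \<in> carrier G \<Longrightarrow> \<exists>!c. (\<forall>e. e \<notin> E \<longrightarrow> c e = 0) \<and> z = int_comb G b E c"
  using assms unfolding free_basis_def by blast+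

text \<open>Existence of the exponent says that \<open>g\<close> generates, uniqueness that it has
  infinite order. In this form the property passes along isomorphisms and lets exponents be
  compared.\<close>

definition infinite_generator :: "('g, 'm) monoid_scheme \<Rightarrow> 'g \<Rightarrow> bool" where
  "infinite_generator G g \<longleftrightarrow>
     g \<in> carrier G \<and> (\<forall>x \<in> carrier G. \<exists>!k::int. x = g [^]\<^bsub>G\<^esub> k)"

lemma infinite_generator_iso:
  assumes "infinite_generator G g" "h \<in> iso G H" "group G" "group H"
  shows "infinite_generator H (h g)"
proof -
  interpret group_hom G H h
    using assms by (simp add: group_hom_def group_hom_axioms_def iso_def)
  have bij: "bij_betw h (carrier G) (carrier H)" and g: "g \<in> carrier G"
    using assms by (auto simp: iso_def infinite_generator_def)
  have "\<exists>!k::int. x = h g [^]\<^bsub>H\<^esub> k" if "x \<in> carrier H" for x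
  proof -
    obtain y where y: "y \<in> carrier G" "x = h y"
      using bij \<open>x \<in> carrier H\<close> unfolding bij_betw_def by auto
    have "x = h g [^]\<^bsub>H\<^esub> k \<longleftrightarrow> y = g [^]\<^bsub>G\<^esub> k" for k :: int
      using y g bij_betw_imp_inj_on[OF bij]
      by (metis hom_int_pow inj_on_eq_iff G.int_pow_closed)
    then show ?thesis
      using assms(1) y by (auto simp: infinite_generator_def)
  qed
  then show ?thesis
    using g by (simp add: infinite_generator_def)
qed

text \<open>The isomorphism with the integers sends some power of \<open>g\<close> to 1, hence
  \<open>g\<close> itself to a nonzero number, and so the powers of \<open>g\<close> are
  distinct.\<close>

lemma infinite_generatorI:
  assumes "G \<cong> integer_group" "group G" "g \<in> carrier G"
    and gen: "carrier (subgroup_generated G {g}) = carrier G"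
  shows "infinite_generator G g"
proof -
  interpret group G by fact
  obtain f where f: "f \<in> iso G integer_group"
    using assms(1) by (auto simp: is_iso_def)
  interpret group_hom G integer_group f
    using f assms by (simp add: group_hom_def group_hom_axioms_def iso_def)
  have pow: "f (g [^]\<^bsub>G\<^esub> k) = f g * k" for k :: int
    using hom_int_pow[OF assms(3), of k] by simp
  have car: "carrier G = range (\<lambda>n::int. g [^]\<^bsub>G\<^esub> n)"
    by (rule trans[OF gen[symmetric] group.carrier_subgroup_generated_by_singleton[OF assms(2,3)]])
  have "f ` carrier G = UNIV"
    using f by (simp add: iso_def bij_betw_def)
  then obtain y where y: "y \<in> carrier G" "f y = 1"
    by (metis UNIV_I imageE)
  then obtain k where "y = g [^]\<^bsub>G\<^esub> (k::int)"
    using car by blast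
  then have "f g * k = 1"
    using pow[of k] y(2) by simp
  then have nz: "f g \<noteq> 0"
    by auto
  have inj: "k = l" if "g [^]\<^bsub>G\<^esub> k = g [^]\<^bsub>G\<^esub> l" for k l :: int
  proof -
    have "f g * k = f g * l"
      unfolding pow[symmetric] that ..
    then show ?thesis using nz by simp
  qed
  have "\<exists>!k::int. x = g [^]\<^bsub>G\<^esub> k" if x: "x \<in> carrier G" for x
  proof -
    obtain k :: int where "x = g [^]\<^bsub>G\<^esub> k"
      using x car by blast
    then show ?thesis
      using inj by blast
  qed
  then show ?thesis
    using assms(3) unfolding infinite_generator_def by blast
qed

lemma infinite_generator_exists:
  assumes "G \<cong> integer_group" "group G"
  obtains g where "g \<in> carrier G" "carrier (subgroup_generated G {g}) = carrier G"
proof -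
  have "cyclic_group G"
    using assms cyclic_integer_group isomorphic_group_cyclicity group_integer_group by blast
  then obtain g where "g \<in> carrier G" "subgroup_generated G {g} = G"
    using assms(2) by (auto simp: cyclic_group_def)
  then show ?thesis using that by metis
qed

lemma free_basis_trivial:
  assumes "comm_group G" "trivial_group G"
  shows "free_basis G b {}"
proof -
  interpret comm_group G by fact
  show ?thesis
    using assms by (auto simp: free_basis_def trivial_group_def int_comb_def)
qed

lemma free_basis_cong:
  assumes "free_basis G b E" "\<And>e. e \<in> E \<Longrightarrow> b e = b' e"
  shows "free_basis G b' E"
proof -
  have "int_comb G b E c = int_comb G b' E c" for c
    by (rule int_comb_cong) (use assms free_basisD(1,3)[OF assms(1)] in auto)
  moreover have "b' \<in> E \<rightarrow> carrier G"
    using free_basisD(3)[OF assms(1)] assms(2) by (auto simp: Pi_iff)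
  ultimately show ?thesis
    using assms(1) by (simp add: free_basis_def)
qed

text \<open>Here \<open>A \<rightarrow> G \<rightarrow> C\<close> is short exact and \<open>C\<close> is infinite cyclic.\<close>

lemma free_basis_extend:
  assumes A: "free_basis A a E" and G: "comm_group G" and C: "group C"
    and i: "i \<in> hom A G" "inj_on i (carrier A)" and j: "j \<in> hom G C"
    and ex: "kernel G C j = i ` carrier A"
    and g: "g \<in> carrier G" "infinite_generator C (j g)" and e: "e \<notin> E"
    and b: "b e = g" "\<And>x. x \<in> E \<Longrightarrow> b x = i (a x)"
  shows "free_basis G b (insert e E)"
proof -
  interpret G: comm_group G by fact
  interpret A: comm_group A using A by (simp add: free_basis_def)
  interpret j: group_hom G C j
    using j C by (simp add: group_hom_def group_hom_axioms_def G.is_group)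
  interpret i: group_hom A G i
    using i by (simp add: group_hom_def group_hom_axioms_def G.is_group A.is_group)
  have fin: "finite E" and a: "a \<in> E \<rightarrow> carrier A"
    using A by (auto simp: free_basis_def)
  have bcar: "b \<in> insert e E \<rightarrow> carrier G"
    using a b g i.hom_closed by (auto simp: Pi_iff)
  have comb: "int_comb G b (insert e E) c = g [^]\<^bsub>G\<^esub> c e \<otimes>\<^bsub>G\<^esub> i (int_comb A a E c)" for c
  proof -
    have "int_comb G b E c = int_comb G (\<lambda>x. i (a x)) E c"
      by (rule int_comb_cong) (use bcar b G.comm_group_axioms in auto)
    also have "\<dots> = i (int_comb A a E c)"
      using int_comb_hom[OF A.comm_group_axioms G i(1) a] by simp
    finally show ?thesis
      using int_comb_insert[OF G fin e bcar] b by simp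
  qed
  have jcomb: "j (int_comb G b (insert e E) c) = j g [^]\<^bsub>C\<^esub> c e" for c
  proof -
    have "i (int_comb A a E c) \<in> kernel G C j"
      using ex int_comb_closed[OF A.comm_group_axioms a] by auto
    then show ?thesis
      using comb g by (simp add: kernel_def j.hom_int_pow)
  qed
  have "\<exists>!c. (\<forall>x. x \<notin> insert e E \<longrightarrow> c x = 0) \<and> z = int_comb G b (insert e E) c"
    if z: "z \<in> carrier G" for z
  proof -
    \<comment> \<open>The coefficient at \<open>e\<close> can be read off in \<open>C\<close>. After
      division by this power of \<open>g\<close>, the element lies in the kernel and so comes from
      \<open>A\<close>.\<close>
    obtain k :: int where k: "j z = j g [^]\<^bsub>C\<^esub> k"
      using g(2) z by (meson infinite_generator_def j.hom_closed)
    have "inv\<^bsub>G\<^esub> (g [^]\<^bsub>G\<^esub> k) \<otimes>\<^bsub>G\<^esub> z \<in> kernel G C j"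
      using k g z by (simp add: kernel_def j.hom_int_pow)
    then obtain y where y: "y \<in> carrier A" "inv\<^bsub>G\<^esub> (g [^]\<^bsub>G\<^esub> k) \<otimes>\<^bsub>G\<^esub> z = i y"
      using ex by auto
    then have zy: "z = g [^]\<^bsub>G\<^esub> k \<otimes>\<^bsub>G\<^esub> i y"
      using z g by (metis G.int_pow_closed G.inv_closed G.inv_solve_left i.hom_closed)
    obtain c where c: "\<forall>x. x \<notin> E \<longrightarrow> c x = 0" "y = int_comb A a E c"
      using A y(1) by (auto simp: free_basis_def)
    show ?thesis
    proof (rule ex1I[of _ "c(e := k)"])
      have "int_comb A a E (c(e := k)) = int_comb A a E c"
        by (rule int_comb_cong) (use e a A.comm_group_axioms in auto)
      then show "(\<forall>x. x \<notin> insert e E \<longrightarrow> (c(e := k)) x = 0) \<and>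
          z = int_comb G b (insert e E) (c(e := k))"
        using c zy by (simp add: comb)
    next
      fix d assume d: "(\<forall>x. x \<notin> insert e E \<longrightarrow> d x = 0) \<and> z = int_comb G b (insert e E) d"
      have "j g [^]\<^bsub>C\<^esub> d e = j z"
        using jcomb d by simp
      then have de: "d e = k"
        using k g(2) z unfolding infinite_generator_def by (metis j.hom_closed)
      have "g [^]\<^bsub>G\<^esub> k \<otimes>\<^bsub>G\<^esub> i (int_comb A a E d) = g [^]\<^bsub>G\<^esub> k \<otimes>\<^bsub>G\<^esub> i y"
        using zy d comb[of d] de by simp
      then have "i (int_comb A a E d) = i y"
        using g y int_comb_closed[OF A.comm_group_axioms a]
        by (subst (asm) G.Units_l_cancel) auto
      then have "int_comb A a E d = y"
        using i(2) y int_comb_closed[OF A.comm_group_axioms a] by (meson inj_onD)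
      \<comment> \<open>Uniqueness in \<open>A\<close> concerns coefficient functions that vanish
        off \<open>E\<close>, so the value at \<open>e\<close> is reset first.\<close>
      moreover have "int_comb A a E (d(e := 0)) = int_comb A a E d"
        by (rule int_comb_cong) (use e a A.comm_group_axioms in auto)
      ultimately have "d(e := 0) = c"
        using A y(1) c d unfolding free_basis_def by (metis fun_upd_apply insert_iff)
      then show "d = c(e := k)"
        using de by auto
    qed
  qed
  then show ?thesis
    using fin bcar G by (simp add: free_basis_def)
qed

section \<open>Coordinates with respect to an integral basis\<close>

definition int_coords :: "('g, 'm) monoid_scheme \<Rightarrow> ('i \<Rightarrow> 'g) \<Rightarrow> 'i set \<Rightarrow> 'g \<Rightarrow> 'i \<Rightarrow> int" where
  "int_coords G b E z = (THE c. (\<forall>e. e \<notin> E \<longrightarrow> c e = 0) \<and> z = int_comb G b E c)"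

lemma int_coords:
  assumes "free_basis G b E" "z \<in> carrier G"
  shows "e \<notin> E \<Longrightarrow> int_coords G b E z e = 0" "z = int_comb G b E (int_coords G b E z)"
proof -
  have "\<exists>!c. (\<forall>e. e \<notin> E \<longrightarrow> c e = 0) \<and> z = int_comb G b E c"
    using assms by (simp add: free_basis_def)
  from theI'[OF this]
  show "e \<notin> E \<Longrightarrow> int_coords G b E z e = 0" "z = int_comb G b E (int_coords G b E z)"
    unfolding int_coords_def by auto
qed

lemma int_coords_unique:
  assumes "free_basis G b E" "\<And>e. e \<notin> E \<Longrightarrow> c e = 0" "z = int_comb G b E c"
  shows "int_coords G b E z = c"
proof -
  have "z \<in> carrier G"
    unfolding assms(3) using free_basisD(1,3)[OF assms(1)] by (rule int_comb_closed)
  from free_basisD(4)[OF assms(1) this] show ?thesis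
    unfolding int_coords_def by (rule the1_equality) (use assms(2,3) in blast)
qed

lemma int_coords_mult:
  assumes "free_basis G b E" "y \<in> carrier G" "z \<in> carrier G"
  shows "int_coords G b E (y \<otimes>\<^bsub>G\<^esub> z) = (\<lambda>e. int_coords G b E y e + int_coords G b E z e)"
proof (rule int_coords_unique[OF assms(1)])
  show "y \<otimes>\<^bsub>G\<^esub> z = int_comb G b E (\<lambda>e. int_coords G b E y e + int_coords G b E z e)"
    using int_coords(2)[OF assms(1,2), symmetric] int_coords(2)[OF assms(1,3), symmetric]
    by (subst int_comb_add) (simp_all add: free_basisD(1-3)[OF assms(1)])
qed (simp add: int_coords(1)[OF assms(1)] assms(2,3))

lemma int_coords_hom:
  assumes "free_basis G b E"
  shows "(\<lambda>z. int_coords G b E z e) \<in> hom G integer_group"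
  using assms by (auto simp: hom_def int_coords_mult)

lemma int_coords_basis:
  assumes "free_basis G b E" "x \<in> E"
  shows "int_coords G b E (b x) = (\<lambda>e. if e = x then 1 else 0)"
proof (rule int_coords_unique[OF assms(1)])
  interpret comm_group G using assms(1) by (rule free_basisD)
  have "b x \<in> carrier G" using free_basisD(3)[OF assms(1)] assms(2) by blast
  then have "b x [^]\<^bsub>G\<^esub> (1::int) = b x"
    by (rule int_pow_1)
  moreover have "int_comb G b E (\<lambda>e. if e = x then 1 else 0) = b x [^]\<^bsub>G\<^esub> (1::int)"
    using free_basisD(1-3)[OF assms(1)] assms(2) by (intro int_comb_delta) auto
  ultimately show "b x = int_comb G b E (\<lambda>e. if e = x then 1 else 0)" by simp
qed (use assms in auto)

lemma hom_integer_group_coords: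
  assumes "free_basis G b E" "\<theta> \<in> hom G integer_group" "z \<in> carrier G"
  shows "\<theta> z = (\<Sum>e\<in>E. int_coords G b E z e * \<theta> (b e))"
proof -
  have "\<theta> z = \<theta> (int_comb G b E (int_coords G b E z))"
    using int_coords(2)[OF assms(1,3)] by (rule arg_cong)
  also have "\<dots> = int_comb integer_group (\<lambda>e. \<theta> (b e)) E (int_coords G b E z)"
    using free_basisD(1-3)[OF assms(1)] assms(2)
    by (intro int_comb_hom) (auto simp: abelian_integer_group)
  finally show ?thesis
    using free_basisD(2)[OF assms(1)] by (simp add: int_comb_integer_group)
qed

text \<open>Each coordinate of \<open>h\<close> is itself a homomorphism to the integers and is
  determined by its values on the basis. This turns identities between homomorphisms into identities
  between matrices.\<close>

lemma int_coords_hom_image: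
  assumes "free_basis G b E" "free_basis H b' E'" "h \<in> hom G H" "z \<in> carrier G"
  shows "int_coords H b' E' (h z) e'
    = (\<Sum>e\<in>E. int_coords G b E z e * int_coords H b' E' (h (b e)) e')"
proof -
  have "(\<lambda>z. int_coords H b' E' (h z) e') \<in> hom G integer_group"
    using assms(3) by (simp add: hom_def Pi_iff int_coords_mult[OF assms(2)])
  from hom_integer_group_coords[OF assms(1) this assms(4)] show ?thesis .
qed

section \<open>Discs\<close>

text \<open>The norm \<open>L2_set\<close> replaces the sum of squares in \<open>disc\<close>
  because scaling and the triangle inequality are needed below.\<close>

definition disc_set :: "nat \<Rightarrow> (nat \<Rightarrow> real) set" where
  "disc_set n = {x. (\<forall>i\<ge>n. x i = 0) \<and> L2_set x {..<n} \<le> 1}"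

lemma L2_set_le_1: "L2_set x A \<le> 1 \<longleftrightarrow> (\<Sum>i\<in>A. x i ^ 2) \<le> 1"
  by (simp add: L2_set_def)

lemma L2_set_eq_1: "L2_set x A = 1 \<longleftrightarrow> (\<Sum>i\<in>A. x i ^ 2) = 1"
  by (simp add: L2_set_def)

lemma L2_set_less_1: "L2_set x A < 1 \<longleftrightarrow> (\<Sum>i\<in>A. x i ^ 2) < 1"
  by (simp add: L2_set_def)

lemma L2_set_scale: "0 \<le> r \<Longrightarrow> L2_set (\<lambda>i. r * x i) A = r * L2_set x A"
  using L2_set_right_distrib[of r x A] by simp

lemma L2_set_scale_abs: "L2_set (\<lambda>i. r * x i) A = \<bar>r\<bar> * L2_set x A"
  unfolding L2_set_def by (simp add: power_mult_distrib real_sqrt_mult flip: sum_distrib_left)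

lemma continuous_on_L2_set:
  fixes f :: "'a::topological_space \<Rightarrow> nat \<Rightarrow> real"
  assumes "\<And>i. continuous_on S (\<lambda>x. f x i)"
  shows "continuous_on S (\<lambda>x. L2_set (f x) A)"
  unfolding L2_set_def by (intro continuous_intros assms)

lemma continuous_on_snd_coordinate [continuous_intros]:
  "continuous_on S (\<lambda>z::'a::topological_space \<times> (nat \<Rightarrow> real). snd z i)"
  by (rule continuous_on_compose2[OF continuous_on_product_coordinates continuous_on_snd[OF continuous_on_id]])
    simp

lemma disc_eq: "disc n = top_of_set (disc_set n)"
  unfolding disc_def Euclidean_space_def disc_set_def L2_set_le_1
  by (simp add: euclidean_product_topology subtopology_subtopology Collect_conj_eq)

lemma topspace_disc [simp]: "topspace (disc n) = disc_set n"
  by (simp add: disc_eq)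

lemma disc_interior_eq: "disc_interior n = {x \<in> disc_set n. L2_set x {..<n} < 1}"
  by (simp add: disc_interior_def L2_set_less_1)

lemma disc_boundary_eq: "disc_boundary n = {x \<in> disc_set n. L2_set x {..<n} = 1}"
  by (simp add: disc_boundary_def L2_set_eq_1)

lemma disc_interior_Un_boundary: "disc_interior n \<union> disc_boundary n = disc_set n"
  by (auto simp: disc_interior_eq disc_boundary_eq disc_set_def)

lemma disc_interior_Int_boundary: "disc_interior n \<inter> disc_boundary n = {}"
  by (auto simp: disc_interior_eq disc_boundary_eq)

lemma zero_in_disc_interior: "(\<lambda>i. 0) \<in> disc_interior n"
  by (simp add: disc_interior_eq disc_set_def L2_set_def)

lemma disc_boundary_0: "disc_boundary 0 = {}"
  by (simp add: disc_boundary_eq)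

lemma disc_set_0: "disc_set 0 = {\<lambda>i. 0}"
  by (auto simp: disc_set_def)

lemma scale_in_disc_set:
  assumes "x \<in> disc_set n" "0 \<le> r" "r * L2_set x {..<n} \<le> 1"
  shows "(\<lambda>i. r * x i) \<in> disc_set n"
  using assms by (simp add: disc_set_def L2_set_scale)

text \<open>Points of the disc are infinite sequences, so compactness comes from Tychonoff: the disc
  is closed in a product of intervals and, from index \<open>n\<close> on, of singletons.\<close>

lemma compact_disc_set: "compact (disc_set n)"
proof -
  define K where "K = (\<lambda>i::nat. if i < n then {-1..1} else {0::real})"
  have "compactin (product_topology (\<lambda>i. euclidean) UNIV) (PiE UNIV K)"
    by (subst compactin_PiE) (simp add: K_def)
  then have "compact (PiE UNIV K)"
    by (simp add: euclidean_product_topology)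
  moreover have "closed (disc_set n)"
  proof -
    have "disc_set n = (\<Inter>i\<in>{n..}. {x. x i = 0}) \<inter> {x. L2_set x {..<n} \<le> 1}"
      by (auto simp: disc_set_def)
    moreover have "closed {x :: nat \<Rightarrow> real. x i = 0}" for i
      by (intro closed_Collect_eq continuous_intros continuous_on_product_coordinates)
    moreover have "closed {x :: nat \<Rightarrow> real. L2_set x {..<n} \<le> 1}"
      by (intro closed_Collect_le continuous_on_L2_set continuous_on_product_coordinates continuous_on_const)
    ultimately show ?thesis
      by (simp add: closed_INT closed_Int)
  qed
  moreover have "disc_set n \<subseteq> PiE UNIV K"
  proof
    fix x assume x: "x \<in> disc_set n"
    have "\<bar>x i\<bar> \<le> 1" if "i < n" for i
    proof -
      have "\<bar>x i\<bar> \<le> L2_set (\<lambda>i. \<bar>x i\<bar>) {..<n}"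
        by (rule member_le_L2_set) (use that in auto)
      also have "\<dots> \<le> 1"
        using x by (simp add: disc_set_def L2_set_def)
      finally show ?thesis .
    qed
    then have "-1 \<le> x i \<and> x i \<le> 1" if "i < n" for i
      using that by (simp add: abs_le_iff minus_le_iff)
    then show "x \<in> PiE UNIV K"
      using x by (auto simp: K_def disc_set_def)
  qed
  ultimately show ?thesis
    by (metis compact_Int_closed inf.absorb_iff2)
qed

lemma compact_space_disc: "compact_space (disc n)"
  by (simp add: disc_eq compact_space_subtopology compact_disc_set)

lemma Hausdorff_space_disc: "Hausdorff_space (disc n)"
  by (simp add: disc_eq Hausdorff_space_subtopology)

lemma continuous_map_disc_homotopy:
  assumes "continuous_on ({0..1} \<times> disc_set n) h"
    "\<And>t x. \<lbrakk>0 \<le> t; t \<le> 1; x \<in> disc_set n\<rbrakk> \<Longrightarrow> h (t, x) \<in> disc_set n"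
  shows "continuous_map (prod_topology (top_of_set {0..1}) (disc n)) (disc n) h"
  using assms by (auto simp: disc_eq)

lemma contractible_space_disc: "contractible_space (disc n)"
proof -
  let ?h = "\<lambda>z::real \<times> (nat \<Rightarrow> real). \<lambda>i. (1 - fst z) * snd z i"
  have "continuous_map (prod_topology (top_of_set {0..1}) (disc n)) (disc n) ?h"
  proof (rule continuous_map_disc_homotopy)
    show "continuous_on ({0..1} \<times> disc_set n) ?h"
      by (intro continuous_intros continuous_on_L2_set)
    fix t :: real and x assume t: "0 \<le> t" "t \<le> 1" and x: "x \<in> disc_set n"
    have "(1 - t) * L2_set x {..<n} \<le> 1 * 1"
      by (rule mult_mono) (use t x in \<open>auto simp: disc_set_def\<close>)
    then show "?h (t, x) \<in> disc_set n"
      using scale_in_disc_set[OF x, of "1 - t"] t by simp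
  qed
  then have "homotopic_with (\<lambda>x. True) (disc n) (disc n) id (\<lambda>x i. 0)"
    unfolding homotopic_with_def by (intro exI[of _ ?h]) auto
  then show ?thesis
    by (auto simp: contractible_space_def)
qed

lemma disc_boundary_nsphere: "subtopology (disc (Suc m)) (disc_boundary (Suc m)) = nsphere m"
proof -
  have "{x. (\<Sum>i<Suc m. x i ^ 2) \<le> 1} \<inter> disc_boundary (Suc m)
      = topspace (Euclidean_space (Suc m)) \<inter> {x :: nat \<Rightarrow> real. (\<Sum>i\<le>m. x i ^ 2) = 1}"
    by (auto simp: disc_boundary_def disc_def lessThan_Suc_atMost simp del: topspace_disc)
  then show ?thesis
    unfolding disc_def nsphere_def subtopology_subtopology
    by (metis subtopology_restrict)
qed

text \<open>The disc is contractible, so its homology modulo the boundary is the reduced homology of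
  the sphere, one degree lower. Dimension 0 is separate: there the boundary is empty and the disc is
  a point.\<close>

lemma disc_homology:
  shows "relative_homology_group (int n) (disc n) (disc_boundary n) \<cong> integer_group"
    and "p \<noteq> int n \<Longrightarrow> trivial_group (relative_homology_group p (disc n) (disc_boundary n))"
proof -
  have iso: "relative_homology_group p (disc (Suc m)) (disc_boundary (Suc m)) \<cong> reduced_homology_group (p - 1) (nsphere m)"
    for p m
  proof -
    have "topspace (disc (Suc m)) \<inter> disc_boundary (Suc m) \<noteq> {}"
      using nonempty_nsphere[of m] unfolding disc_boundary_nsphere[symmetric]
      by (metis topspace_subtopology null_topspace_iff_trivial)
    from isomorphic_group_relative_homology_of_contractible[OF contractible_space_disc this, of p]
    show ?thesis
      by (simp only: disc_boundary_nsphere)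
  qed
  show "relative_homology_group (int n) (disc n) (disc_boundary n) \<cong> integer_group"
  proof (cases n)
    case 0
    then show ?thesis
      using homology_coefficients[of "disc 0"] by (simp add: disc_boundary_0 disc_set_0)
  next
    case (Suc m)
    show ?thesis
      using iso_trans[OF iso[of "int n" m], of integer_group] reduced_homology_group_nsphere(1)[of m]
      by (simp add: Suc)
  qed
  assume p: "p \<noteq> int n"
  show "trivial_group (relative_homology_group p (disc n) (disc_boundary n))"
  proof (cases n)
    case 0
    then show ?thesis
      using homology_dimension_axiom[of "disc 0" _ p] p by (simp add: disc_boundary_0 disc_set_0)
  next
    case (Suc m)
    have "trivial_group (reduced_homology_group (p - 1) (nsphere m))"
      using p Suc by (intro reduced_homology_group_nsphere(2)) auto
    then show ?thesis
      using isomorphic_group_triviality[OF iso[of p m]] by (simp add: Suc)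
  qed
qed

text \<open>Radial stretching: a point of norm at least \<open>\<delta>\<close> moves linearly out
  to norm 1. The shell of such points stays invariant at all times, so this is also a homotopy of
  pairs.\<close>

lemma disc_push:
  fixes \<delta> :: real
  assumes "0 < \<delta>" "\<delta> \<le> 1"
  obtains h :: "real \<times> (nat \<Rightarrow> real) \<Rightarrow> nat \<Rightarrow> real" where
    "continuous_map (prod_topology (top_of_set {0..1}) (disc n)) (disc n) h"
    "\<And>x. h (0, x) = x"
    "\<And>t x. x \<in> disc_boundary n \<Longrightarrow> h (t, x) = x"
    "\<And>t x. \<lbrakk>0 \<le> t; t \<le> 1; x \<in> disc_set n; \<delta> \<le> L2_set x {..<n}\<rbrakk> \<Longrightarrow> \<delta> \<le> L2_set (h (t, x)) {..<n}"
    "\<And>x. \<lbrakk>x \<in> disc_set n; \<delta> \<le> L2_set x {..<n}\<rbrakk> \<Longrightarrow> h (1, x) \<in> disc_boundary n"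
proof -
  let ?N = "\<lambda>x. L2_set x {..<n}"
  \<comment> \<open>At time 1 the factor is the reciprocal of the norm outside radius
    \<open>\<delta>\<close> and the constant \<open>1 / \<delta>\<close> inside; the
    \<open>max\<close> keeps it continuous at the centre.\<close>
  define s :: "real \<Rightarrow> (nat \<Rightarrow> real) \<Rightarrow> real" where "s = (\<lambda>t x. (1 - t) + t / max (?N x) \<delta>)"
  define h where "h = (\<lambda>z i. s (fst z) (snd z) * snd z i)"
  have mx: "0 < max (?N x) \<delta>" for x
    using assms by simp
  have s0: "0 \<le> s t x" if "0 \<le> t" "t \<le> 1" for t x
    unfolding s_def using that mx[of x] by (intro add_nonneg_nonneg divide_nonneg_nonneg) auto
  have sN: "s t x * ?N x \<le> 1" if "0 \<le> t" "t \<le> 1" "x \<in> disc_set n" for t x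
  proof -
    have "(1 - t) * ?N x \<le> (1 - t) * 1"
      using that by (intro mult_left_mono) (auto simp: disc_set_def)
    moreover have "t * (?N x / max (?N x) \<delta>) \<le> t * 1"
      using that mx[of x] by (intro mult_left_mono) (auto simp: divide_le_eq_1)
    ultimately show ?thesis
      by (simp add: s_def algebra_simps)
  qed
  have sW: "s t x * ?N x = (1 - t) * ?N x + t" if "\<delta> \<le> ?N x" for t x
  proof -
    have "?N x \<noteq> 0" "max (?N x) \<delta> = ?N x" using that assms by auto
    then show ?thesis by (simp add: s_def algebra_simps)
  qed
  have Nh: "?N (h (t, x)) = s t x * ?N x" if "0 \<le> t" "t \<le> 1" for t x
    using s0[OF that] by (simp add: h_def L2_set_scale)
  have hD: "h (t, x) \<in> disc_set n" if "0 \<le> t" "t \<le> 1" "x \<in> disc_set n" for t x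
    using scale_in_disc_set[OF that(3) s0[OF that(1,2)] sN[OF that]] by (simp add: h_def)
  show ?thesis
  proof (rule that[of h])
    show "continuous_map (prod_topology (top_of_set {0..1}) (disc n)) (disc n) h"
    proof (rule continuous_map_disc_homotopy)
      show "continuous_on ({0..1} \<times> disc_set n) h"
        unfolding h_def s_def using mx by (intro continuous_intros continuous_on_L2_set) (metis less_irrefl)
    qed (use hD in auto)
    show "h (0, x) = x" for x
      by (simp add: h_def s_def)
    show "h (t, x) = x" if "x \<in> disc_boundary n" for t x
      using that assms by (simp add: h_def s_def disc_boundary_eq max_def)
    show "\<delta> \<le> ?N (h (t, x))" if "0 \<le> t" "t \<le> 1" "x \<in> disc_set n" "\<delta> \<le> ?N x" for t x
    proof -
      have "(1 - t) * \<delta> \<le> (1 - t) * ?N x" "t * \<delta> \<le> t * 1"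
        using that assms by (auto intro: mult_left_mono mult_left_le)
      then show ?thesis
        using Nh[OF that(1,2), of x] sW[OF that(4), of t] by (simp add: algebra_simps)
    qed
    show "h (1, x) \<in> disc_boundary n" if "x \<in> disc_set n" "\<delta> \<le> ?N x" for x
      using that hD[of 1 x] Nh[of 1 x] sW[of x 1] by (simp add: disc_boundary_eq)
  qed
qed

text \<open>The map \<open>x \<mapsto> x + (1 - \<bar>x\<bar>) q\<close> fixes the boundary and moves the centre to \<open>q\<close>.\<close>

lemma disc_recentre:
  assumes q: "q \<in> disc_interior n"
  obtains T where "homeomorphic_map (disc n) (disc n) T" "T (\<lambda>i. 0) = q"
    "T ` disc_interior n = disc_interior n" "T ` disc_boundary n = disc_boundary n"
proof -
  let ?N = "\<lambda>x. L2_set x {..<n}"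
  define T where "T = (\<lambda>x i. x i + (1 - ?N x) * q i)"
  have qN: "?N q < 1" and qD: "q \<in> disc_set n"
    using q by (auto simp: disc_interior_eq)
  have tri: "?N (\<lambda>i. x i + r * y i) \<le> ?N x + \<bar>r\<bar> * ?N y" for x y r
    using L2_set_triangle_ineq[of x "\<lambda>i. r * y i"] by (simp add: L2_set_scale_abs)
  have TN: "?N (T x) \<le> ?N x + (1 - ?N x) * ?N q" if "x \<in> disc_set n" for x
    using tri[of x "1 - ?N x" q] that by (simp add: T_def disc_set_def)
  have TD: "T x \<in> disc_set n" if "x \<in> disc_set n" for x
  proof -
    have "(1 - ?N x) * ?N q \<le> (1 - ?N x) * 1"
      using that qN by (intro mult_left_mono) (auto simp: disc_set_def)
    then show ?thesis
      using TN[OF that] that qD by (simp add: disc_set_def T_def)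
  qed
  have Tint: "T x \<in> disc_interior n" if "x \<in> disc_interior n" for x
  proof -
    have "(1 - ?N x) * ?N q < (1 - ?N x) * 1"
      using that qN by (intro mult_strict_left_mono) (auto simp: disc_interior_eq)
    moreover have "x \<in> disc_set n"
      using that by (simp add: disc_interior_eq)
    ultimately show ?thesis
      using TN[of x] TD[of x] by (simp add: disc_interior_eq)
  qed
  have Tbd: "T x = x" if "x \<in> disc_boundary n" for x
    using that by (simp add: T_def disc_boundary_eq)
  have inj: "inj_on T (disc_set n)"
  proof (rule inj_onI)
    fix x y assume xy: "x \<in> disc_set n" "y \<in> disc_set n" "T x = T y"
    \<comment> \<open>Points with the same image differ by the multiple of \<open>q\<close> given by
      the difference of their norms. Since \<open>q\<close> has norm less than 1, this difference of
      norms must vanish.\<close>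
    have diff: "x i - y i = (?N x - ?N y) * q i" for i
      using fun_cong[OF xy(3), of i] by (simp add: T_def algebra_simps)
    have "?N x - ?N y \<le> \<bar>?N x - ?N y\<bar> * ?N q" if "\<And>i. x i - y i = (?N x - ?N y) * q i" for x y
    proof -
      have "x = (\<lambda>i. y i + (?N x - ?N y) * q i)"
        using that by (auto simp: algebra_simps fun_eq_iff)
      then show ?thesis
        using tri[of y "?N x - ?N y" q] by (metis add.commute diff_le_eq)
    qed
    from this[of x y] this[of y x] diff
    have "?N x - ?N y \<le> \<bar>?N x - ?N y\<bar> * ?N q" "?N y - ?N x \<le> \<bar>?N x - ?N y\<bar> * ?N q"
      by (auto simp: algebra_simps abs_minus_commute)
    then have "\<bar>?N x - ?N y\<bar> * (1 - ?N q) \<le> 0"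
      by (simp add: algebra_simps abs_le_iff)
    then have "?N x = ?N y"
      using qN by (simp add: mult_le_0_iff)
    then show "x = y"
      using diff by (auto simp: fun_eq_iff)
  qed
  have surj: "T ` disc_set n = disc_set n"
  proof
    show "disc_set n \<subseteq> T ` disc_set n"
    proof
      fix y assume y: "y \<in> disc_set n"
      \<comment> \<open>A preimage of \<open>y\<close> of norm \<open>r\<close> has to be
        \<open>y - (1 - r) q\<close>; a zero of \<open>f\<close> is an \<open>r\<close> for which
        this point really has norm \<open>r\<close>.\<close>
      define f where "f = (\<lambda>r::real. ?N (\<lambda>i. y i - (1 - r) * q i) - r)"
      have "\<exists>r\<ge>0. r \<le> 1 \<and> f r = 0"
      proof (rule IVT2')
        show "f 1 \<le> 0" "0 \<le> f 0"
          using y by (auto simp: f_def disc_set_def)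
        show "continuous_on {0..1} f"
          unfolding f_def by (intro continuous_intros continuous_on_L2_set)
      qed simp
      then obtain r where r: "0 \<le> r" "r \<le> 1" "f r = 0" by blast
      let ?x = "\<lambda>i. y i - (1 - r) * q i"
      have "?N ?x = r"
        using r by (simp add: f_def)
      then have "?x \<in> disc_set n" "T ?x = y"
        using r y qD by (auto simp: disc_set_def T_def)
      then show "y \<in> T ` disc_set n"
        by (metis imageI)
    qed
  qed (use TD in auto)
  have "continuous_on (disc_set n) T"
    unfolding T_def
    by (intro continuous_intros continuous_on_L2_set continuous_on_product_coordinates[THEN continuous_on_subset]) auto
  then have "continuous_map (disc n) (disc n) T"
    using TD by (auto simp: disc_eq)
  then have hom: "homeomorphic_map (disc n) (disc n) T"
    using compact_space_disc Hausdorff_space_disc surj inj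
    by (intro continuous_imp_homeomorphic_map) auto
  have bd: "T ` disc_boundary n = disc_boundary n"
    using Tbd by force
  moreover have "T ` disc_interior n = disc_interior n"
  proof
    show "disc_interior n \<subseteq> T ` disc_interior n"
    proof
      fix y assume y: "y \<in> disc_interior n"
      then have "y \<in> T ` disc_set n"
        using surj disc_interior_Un_boundary by blast
      then obtain x where x: "x \<in> disc_set n" "y = T x"
        by blast
      moreover have "x \<notin> disc_boundary n"
        using x(2) y bd disc_interior_Int_boundary by blast
      ultimately show "y \<in> T ` disc_interior n"
        using disc_interior_Un_boundary by blast
    qed
  qed (use Tint in auto)
  moreover have "T (\<lambda>i. 0) = q"
    by (simp add: T_def L2_set_def)
  ultimately show ?thesis
    using hom that by blast
qed

section \<open>Attaching a cell\<close>

lemma iso_cancel_left: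
  assumes "f \<in> hom G H" "g \<in> iso H K" "(\<lambda>x. g (f x)) \<in> iso G K"
  shows "f \<in> iso G H"
proof -
  have g: "inj_on g (carrier H)" and gf: "bij_betw (\<lambda>x. g (f x)) (carrier G) (carrier K)"
    and f: "f ` carrier G \<subseteq> carrier H"
    using assms by (auto simp: iso_def bij_betw_def hom_def)
  have "inj_on f (carrier G)"
    using gf unfolding bij_betw_def inj_on_def by metis
  moreover have "carrier H \<subseteq> f ` carrier G"
  proof
    fix y assume y: "y \<in> carrier H"
    then have "g y \<in> carrier K"
      using assms(2) by (auto simp: iso_def hom_def)
    then obtain x where "x \<in> carrier G" "g (f x) = g y"
      using gf by (metis bij_betw_def imageE)
    then show "y \<in> f ` carrier G"
      using g f y by (metis image_eqI image_subset_iff inj_onD)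
  qed
  ultimately show ?thesis
    using assms(1) f by (auto simp: iso_def bij_betw_def)
qed

lemma iso_cancel_right:
  assumes "f \<in> iso G H" "g \<in> hom H K" "(\<lambda>x. g (f x)) \<in> iso G K"
  shows "g \<in> iso H K"
proof -
  have f: "f ` carrier G = carrier H" and gf: "bij_betw (\<lambda>x. g (f x)) (carrier G) (carrier K)"
    using assms by (auto simp: iso_def bij_betw_def)
  have "g ` carrier H = carrier K"
    using gf f by (metis bij_betw_def image_image)
  moreover have "inj_on g (carrier H)"
    unfolding f[symmetric] using gf by (auto simp: bij_betw_def inj_on_def)
  ultimately show ?thesis
    using assms(2) by (simp add: iso_def bij_betw_def)
qed

lemmas continuous_map_sub = continuous_map_in_subtopology continuous_map_from_subtopology

lemma hom_induced_id_compose: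
  assumes "continuous_map X Y id" "S \<subseteq> T" "continuous_map Y Z id" "T \<subseteq> U"
  shows "hom_induced p Y T Z U id (hom_induced p X S Y T id x) = hom_induced p X S Z U id x"
proof -
  have "id \<in> S \<rightarrow> T" "id \<in> T \<rightarrow> U"
    using assms by auto
  from hom_induced_compose'[OF assms(1) this(1) assms(3) this(2)] show ?thesis
    by simp
qed

abbreviation inclusion_iso :: "int \<Rightarrow> 'a topology \<Rightarrow> 'a set \<Rightarrow> 'a topology \<Rightarrow> 'a set \<Rightarrow> bool" where
  "inclusion_iso p X S Y T \<equiv>
     hom_induced p X S Y T id \<in> iso (relative_homology_group p X S) (relative_homology_group p Y T)"

text \<open>By regularity the whole closed disc embeds, so attaching needs no quotient space:
  \<open>X\<close> is covered by two closed subsets, \<open>A\<close> and the closed cell, which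
  meet in the boundary of the cell.\<close>

locale cell_attachment =
  fixes X :: "'a topology" and A :: "'a set" and n :: nat and \<phi> :: "(nat \<Rightarrow> real) \<Rightarrow> 'a"
  assumes Hausdorff: "Hausdorff_space X"
    and A_closed: "closedin X A"
    and embedding: "embedding_map (disc n) X \<phi>"
    and covers: "topspace X = A \<union> \<phi> ` disc_set n"
    and interior_disjoint: "\<phi> ` disc_interior n \<inter> A = {}"
    and boundary_subset: "\<phi> ` disc_boundary n \<subseteq> A"
begin

text \<open>Thickening \<open>A\<close> by this shell does not change the relative homology, yet for
  \<open>\<delta> < 1\<close> it puts \<open>A\<close> into the interior, as excision
  requires.\<close>

definition collar :: "real \<Rightarrow> 'a set" where
  "collar \<delta> = \<phi> ` {x \<in> disc_set n. \<delta> \<le> L2_set x {..<n}}"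

lemma continuous_phi: "continuous_map (disc n) X \<phi>"
  using embedding continuous_map_in_subtopology homeomorphic_imp_continuous_map
  unfolding embedding_map_def by blast

lemma phi_in_A_iff:
  assumes "x \<in> disc_set n"
  shows "\<phi> x \<in> A \<longleftrightarrow> x \<in> disc_boundary n"
  using assms interior_disjoint boundary_subset disc_interior_Un_boundary[of n] by blast

lemma closedin_phi_image:
  assumes "closedin (disc n) C"
  shows "closedin X (\<phi> ` C)"
proof -
  have "compactin (disc n) C"
    using assms compact_space_disc closedin_compact_space by blast
  then have "compactin X (\<phi> ` C)"
    using continuous_phi image_compactin by blast
  then show ?thesis
    using Hausdorff compactin_imp_closedin by blast
qed

lemma closedin_closed_cell: "closedin X (\<phi> ` disc_set n)"
  using closedin_phi_image[of "topspace (disc n)"] by (metis closedin_topspace topspace_disc)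

lemma A_subset: "A \<subseteq> topspace X"
  using A_closed closedin_subset by blast

lemma collar_subset: "collar \<delta> \<subseteq> topspace X"
  using covers by (auto simp: collar_def)

text \<open>\<open>disc_push\<close> transported to the cell and extended by the identity on
  \<open>A\<close>. The time 1 map \<open>g\<close> serves as homotopy inverse of the inclusion of
  the pair with \<open>A\<close> into the pair with the thickened \<open>A\<close>, which is why
  both pairs are preserved during the homotopy.\<close>

lemma collar_push:
  assumes "0 < \<delta>" "\<delta> \<le> 1"
  obtains g where "g \<in> A \<union> collar \<delta> \<rightarrow> A" "homotopic_with (\<lambda>h. h \<in> A \<rightarrow> A) X X id g"
    "homotopic_with (\<lambda>h. h \<in> A \<union> collar \<delta> \<rightarrow> A \<union> collar \<delta>) X X id g"
proof -
  obtain h :: "real \<times> (nat \<Rightarrow> real) \<Rightarrow> nat \<Rightarrow> real" where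
    h: "continuous_map (prod_topology (top_of_set {0..1}) (disc n)) (disc n) h"
      "\<And>x. h (0, x) = x"
      "\<And>t x. x \<in> disc_boundary n \<Longrightarrow> h (t, x) = x"
      "\<And>t x. \<lbrakk>0 \<le> t; t \<le> 1; x \<in> disc_set n; \<delta> \<le> L2_set x {..<n}\<rbrakk> \<Longrightarrow> \<delta> \<le> L2_set (h (t, x)) {..<n}"
      "\<And>x. \<lbrakk>x \<in> disc_set n; \<delta> \<le> L2_set x {..<n}\<rbrakk> \<Longrightarrow> h (1, x) \<in> disc_boundary n"
    using disc_push[OF assms, of n] by metis
  have hD: "h (t, x) \<in> disc_set n" if "0 \<le> t" "t \<le> 1" "x \<in> disc_set n" for t x
    using continuous_map_funspace[OF h(1)] that by auto
  have "homeomorphic_map (disc n) (subtopology X (\<phi> ` disc_set n)) \<phi>"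
    using embedding by (simp add: embedding_map_def)
  then obtain \<psi> where \<psi>: "homeomorphic_maps (disc n) (subtopology X (\<phi> ` disc_set n)) \<phi> \<psi>"
    using homeomorphic_map_maps by blast
  then have \<psi>\<phi>: "\<psi> (\<phi> x) = x" if "x \<in> disc_set n" for x
    using that by (simp add: homeomorphic_maps_def)
  have \<psi>cont: "continuous_map (subtopology X (\<phi> ` disc_set n)) (disc n) \<psi>"
    using \<psi> by (simp add: homeomorphic_maps_def)
  define k where "k = (\<lambda>z. if snd z \<in> A then snd z else \<phi> (h (fst z, \<psi> (snd z))))"
  let ?P = "prod_topology (top_of_set {0..1::real}) X"
  \<comment> \<open>The closed cover for the pasting lemma, indexed by truth values. The two
    formulas agree on the overlap because it is the boundary of the cell, which \<open>h\<close>
    fixes.\<close>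
  define C where "C = (\<lambda>b::bool. {0..1::real} \<times> (if b then A else \<phi> ` disc_set n))"
  define f where "f = (\<lambda>b::bool. if b then snd else (\<lambda>z. \<phi> (h (fst z, \<psi> (snd z)))))"
  have k\<phi>: "k (t, \<phi> x) = \<phi> (h (t, x))" if "x \<in> disc_set n" for t x
    using that phi_in_A_iff[OF that] \<psi>\<phi>[OF that] h(3)[of x t] by (auto simp: k_def)
  have k1: "continuous_map ?P X k"
  proof (rule pasting_lemma_closed[of UNIV ?P C X f])
    show "closedin ?P (C b)" for b
      unfolding C_def using A_closed closedin_closed_cell
      by (auto simp: closedin_prod_Times_iff)
    show "continuous_map (subtopology ?P (C b)) X (f b)" for b
    proof (cases b)
      case True
      then show ?thesis
        by (simp add: f_def continuous_map_snd continuous_map_from_subtopology)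
    next
      case False
      have eq: "subtopology ?P (C False)
          = prod_topology (top_of_set {0..1}) (subtopology X (\<phi> ` disc_set n))"
        by (simp add: C_def subtopology_Times subtopology_subtopology)
      have 1: "continuous_map (subtopology ?P (C False)) (prod_topology (top_of_set {0..1}) (disc n))
          (\<lambda>z. (fst z, \<psi> (snd z)))"
        unfolding eq
        by (intro continuous_map_pairedI continuous_map_fst
            continuous_map_compose[OF continuous_map_snd \<psi>cont, unfolded o_def])
      have "continuous_map (subtopology ?P (C False)) X (\<phi> \<circ> (h \<circ> (\<lambda>z. (fst z, \<psi> (snd z)))))"
        using 1 h(1) continuous_phi by (meson continuous_map_compose)
      then show ?thesis
        using False by (simp add: f_def o_def)
    qed
    show "f i x = f j x" if "x \<in> topspace ?P \<inter> C i \<inter> C j" for i j x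
    proof -
      have "snd x = \<phi> (h (fst x, \<psi> (snd x)))" if "snd x \<in> A" "snd x \<in> \<phi> ` disc_set n"
      proof -
        obtain y where y: "y \<in> disc_set n" "snd x = \<phi> y"
          using \<open>snd x \<in> \<phi> ` disc_set n\<close> by blast
        then have "y \<in> disc_boundary n"
          using phi_in_A_iff that by auto
        then show ?thesis
          using h(3) y \<psi>\<phi> by simp
      qed
      then show ?thesis
        using that by (auto simp: f_def C_def split: if_splits)
    qed
    show "\<exists>j. j \<in> UNIV \<and> x \<in> C j \<and> k x = f j x" if "x \<in> topspace ?P" for x
    proof (cases "snd x \<in> A")
      case True
      then show ?thesis
        using that by (intro exI[of _ True]) (auto simp: C_def f_def k_def)
    next
      case False
      then show ?thesis
        using that covers by (intro exI[of _ False]) (auto simp: C_def f_def k_def)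
    qed
  qed simp
  have k2: "k (0, y) = y" if "y \<in> topspace X" for y
  proof (cases "y \<in> A")
    case True
    then show ?thesis by (simp add: k_def)
  next
    case False
    then obtain x where "x \<in> disc_set n" "y = \<phi> x"
      using \<open>y \<in> topspace X\<close> covers by blast
    then show ?thesis
      using k\<phi>[of x 0] h(2) by simp
  qed
  have kA: "k (t, y) = y" if "y \<in> A" for t y
    using that by (simp add: k_def)
  have kW: "k (t, y) \<in> A \<union> collar \<delta>" if "0 \<le> t" "t \<le> 1" "y \<in> A \<union> collar \<delta>" for t y
    using that kA k\<phi> h(4) hD by (fastforce simp: collar_def)
  have hom: "homotopic_with (\<lambda>h. h \<in> B \<rightarrow> B) X X id (\<lambda>y. k (1, y))"
    if B: "B \<subseteq> topspace X" "\<And>t y. \<lbrakk>0 \<le> t; t \<le> 1; y \<in> B\<rbrakk> \<Longrightarrow> k (t, y) \<in> B" for B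
  proof (subst homotopic_with)
    show "(h \<in> B \<rightarrow> B) = (h' \<in> B \<rightarrow> B)" if "\<And>x. x \<in> topspace X \<Longrightarrow> h x = h' x" for h h'
      using that B(1) by (metis (no_types, lifting) Pi_cong subsetD)
    show "\<exists>h. continuous_map (prod_topology (top_of_set {0..1::real}) X) X h \<and>
        (\<forall>x\<in>topspace X. h (0, x) = id x) \<and> (\<forall>x\<in>topspace X. h (1, x) = k (1, x)) \<and>
        (\<forall>t\<in>{0..1}. (\<lambda>x. h (t, x)) \<in> B \<rightarrow> B)"
      using k1 k2 B(2) by (intro exI[of _ k]) auto
  qed
  show ?thesis
  proof (rule that[of "\<lambda>y. k (1, y)"])
    show "(\<lambda>y. k (1, y)) \<in> A \<union> collar \<delta> \<rightarrow> A"
      using kA k\<phi> h(5) boundary_subset by (fastforce simp: collar_def)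
    show "homotopic_with (\<lambda>h. h \<in> A \<rightarrow> A) X X id (\<lambda>y. k (1, y))"
      by (rule hom) (use A_subset kA in auto)
    show "homotopic_with (\<lambda>h. h \<in> A \<union> collar \<delta> \<rightarrow> A \<union> collar \<delta>) X X id (\<lambda>y. k (1, y))"
      by (rule hom) (use A_subset collar_subset kW in auto)
  qed
qed

text \<open>The map from \<open>collar_push\<close> is homotopic to the identity as a map of either
  pair, hence inverse to the inclusion up to homotopy.\<close>

lemma relative_homology_collar_iso:
  assumes "0 < \<delta>" "\<delta> \<le> 1"
  shows "inclusion_iso p X A X (A \<union> collar \<delta>)"
proof -
  obtain g where g: "g \<in> A \<union> collar \<delta> \<rightarrow> A" "homotopic_with (\<lambda>h. h \<in> A \<rightarrow> A) X X id g"
    "homotopic_with (\<lambda>h. h \<in> A \<union> collar \<delta> \<rightarrow> A \<union> collar \<delta>) X X id g"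
    by (rule collar_push[OF assms])
  show ?thesis
    by (rule homotopy_equivalence_relative_homology_group_isomorphism[where g = g])
      (use g homotopic_with_imp_continuous_maps[OF g(2)] in \<open>auto simp: homotopic_with_sym\<close>)
qed

lemma relative_homology_excision_iso:
  assumes "0 < \<delta>" "\<delta> < 1"
  shows "inclusion_iso p (subtopology X (\<phi> ` disc_interior n)) (collar \<delta> - A) X (A \<union> collar \<delta>)"
proof -
  have "closedin (disc n) {x \<in> disc_set n. L2_set x {..<n} \<le> \<delta>}"
  proof -
    have "closed {x :: nat \<Rightarrow> real. L2_set x {..<n} \<le> \<delta>}"
      by (intro closed_Collect_le continuous_on_L2_set continuous_on_product_coordinates continuous_on_const)
    then show ?thesis
      unfolding disc_eq by (auto simp: closedin_closed)
  qed
  then have clo: "closedin X (\<phi> ` {x \<in> disc_set n. L2_set x {..<n} \<le> \<delta>})"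
    by (rule closedin_phi_image)
  \<comment> \<open>The complement of the closed inner ball of radius \<open>\<delta>\<close> is
    open and lies between \<open>A\<close> and the thickened \<open>A\<close>; this is what places
    \<open>A\<close> in the interior.\<close>
  have sub: "topspace X - \<phi> ` {x \<in> disc_set n. L2_set x {..<n} \<le> \<delta>} \<subseteq> A \<union> collar \<delta>"
  proof
    fix y assume y: "y \<in> topspace X - \<phi> ` {x \<in> disc_set n. L2_set x {..<n} \<le> \<delta>}"
    then consider "y \<in> A" | x where "x \<in> disc_set n" "y = \<phi> x"
      using covers by blast
    then show "y \<in> A \<union> collar \<delta>"
    proof cases
      case 2
      then have "\<delta> \<le> L2_set x {..<n}"
        using y by (metis (mono_tags, lifting) DiffD2 image_eqI linorder_le_cases mem_Collect_eq)
      then show ?thesis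
        using 2 by (auto simp: collar_def)
    qed simp
  qed
  have "A \<inter> \<phi> ` {x \<in> disc_set n. L2_set x {..<n} \<le> \<delta>} = {}"
    using assms phi_in_A_iff by (auto simp: disc_boundary_eq)
  then have "A \<subseteq> topspace X - \<phi> ` {x \<in> disc_set n. L2_set x {..<n} \<le> \<delta>}"
    using A_subset by blast
  then have "A \<subseteq> X interior_of (A \<union> collar \<delta>)"
    using sub clo by (meson interior_of_maximal openin_diff openin_topspace order_trans)
  then have "X closure_of A \<subseteq> X interior_of (A \<union> collar \<delta>)"
    using A_closed by (simp add: closure_of_closedin)
  from homology_excision_axiom[OF this, of "topspace X" p]
  have "inclusion_iso p (subtopology X (topspace X - A)) (A \<union> collar \<delta> - A) X (A \<union> collar \<delta>)"
    using A_subset collar_subset by simp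
  moreover have "topspace X - A = \<phi> ` disc_interior n"
    using covers interior_disjoint boundary_subset disc_interior_Un_boundary[of n] by blast
  moreover have "A \<union> collar \<delta> - A = collar \<delta> - A"
    by blast
  ultimately show ?thesis
    by simp
qed

text \<open>A closed cell is itself a cell attached to its own boundary, so the collar and excision
  isomorphisms hold for it too and can be compared with those of \<open>X\<close>.\<close>

lemma cell_attachment_cell:
  "cell_attachment (subtopology X (\<phi> ` disc_set n)) (\<phi> ` disc_boundary n) n \<phi>"
proof
  show "Hausdorff_space (subtopology X (\<phi> ` disc_set n))"
    using Hausdorff Hausdorff_space_subtopology by blast
  have "closedin (disc n) (disc_boundary n)"
  proof -
    have "closed {x :: nat \<Rightarrow> real. L2_set x {..<n} = 1}"
      by (intro closed_Collect_eq continuous_on_L2_set continuous_on_product_coordinates continuous_on_const)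
    then show ?thesis
      unfolding disc_eq disc_boundary_eq by (auto simp: closedin_closed)
  qed
  then have "closedin X (\<phi> ` disc_boundary n)"
    by (rule closedin_phi_image)
  moreover have bd: "disc_boundary n \<subseteq> disc_set n"
    by (auto simp: disc_boundary_eq)
  ultimately show "closedin (subtopology X (\<phi> ` disc_set n)) (\<phi> ` disc_boundary n)"
    by (meson closedin_subset_topspace image_mono)
  show "embedding_map (disc n) (subtopology X (\<phi> ` disc_set n)) \<phi>"
    using embedding by (simp add: embedding_map_in_subtopology)
  show "topspace (subtopology X (\<phi> ` disc_set n)) = \<phi> ` disc_boundary n \<union> \<phi> ` disc_set n"
    using bd covers by auto
  show "\<phi> ` disc_interior n \<inter> \<phi> ` disc_boundary n = {}"
    using interior_disjoint boundary_subset by blast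
qed simp

text \<open>After excision both pairs become the open cell modulo the collar without the boundary,
  so the inclusion of the closed cell is compared with \<open>X\<close> through this common
  piece.\<close>

theorem relative_homology_cell_iso:
  "inclusion_iso p (subtopology X (\<phi> ` disc_set n)) (\<phi> ` disc_boundary n) X A"
proof -
  let ?C = "subtopology X (\<phi> ` disc_set n)" and ?B = "\<phi> ` disc_boundary n"
  let ?E = "subtopology X (\<phi> ` disc_interior n)" and ?K = "collar (1/2)"
  interpret C: cell_attachment ?C ?B n \<phi>
    by (rule cell_attachment_cell)
  have sub: "disc_interior n \<subseteq> disc_set n"
    by (auto simp: disc_interior_eq)
  have EC: "subtopology ?C (\<phi> ` disc_interior n) = ?E"
    using sub by (simp add: subtopology_subtopology inf.absorb2 image_mono)
  have KB: "?K - ?B = ?K - A"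
    using phi_in_A_iff boundary_subset by (auto simp: collar_def)
  have contE: "continuous_map ?E ?C id"
    using sub by (auto simp: continuous_map_sub)
  have contC: "continuous_map ?C X id"
    by (simp add: continuous_map_from_subtopology)
  have 1: "inclusion_iso p ?E (?K - A) ?C (?B \<union> ?K)"
    using C.relative_homology_excision_iso[of "1/2" p] by (simp add: EC C.collar_def KB flip: collar_def)
  have 2: "inclusion_iso p ?C ?B ?C (?B \<union> ?K)"
    using C.relative_homology_collar_iso[of "1/2" p] by (simp add: C.collar_def flip: collar_def)
  \<comment> \<open>The excision isomorphism of \<open>X\<close> factors through the excision
    isomorphism of the closed cell, so the remaining factor is an isomorphism.\<close>
  have 3: "inclusion_iso p ?C (?B \<union> ?K) X (A \<union> ?K)"
  proof (rule iso_cancel_right[OF 1 hom_induced_hom])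
    have "(\<lambda>x. hom_induced p ?C (?B \<union> ?K) X (A \<union> ?K) id (hom_induced p ?E (?K - A) ?C (?B \<union> ?K) id x))
        = hom_induced p ?E (?K - A) X (A \<union> ?K) id"
      using boundary_subset by (intro ext hom_induced_id_compose contE contC) auto
    then show "(\<lambda>x. hom_induced p ?C (?B \<union> ?K) X (A \<union> ?K) id (hom_induced p ?E (?K - A) ?C (?B \<union> ?K) id x))
        \<in> iso (relative_homology_group p ?E (?K - A)) (relative_homology_group p X (A \<union> ?K))"
      using relative_homology_excision_iso[of "1/2" p] by simp
  qed
  show ?thesis
  proof (rule iso_cancel_left[OF hom_induced_hom relative_homology_collar_iso[of "1/2"]])
    have "hom_induced p X A X (A \<union> ?K) id (hom_induced p ?C ?B X A id x)
        = hom_induced p ?C (?B \<union> ?K) X (A \<union> ?K) id (hom_induced p ?C ?B ?C (?B \<union> ?K) id x)" for x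
      using boundary_subset contC by (subst (1 2) hom_induced_id_compose) auto
    then show "(\<lambda>x. hom_induced p X A X (A \<union> ?K) id (hom_induced p ?C ?B X A id x))
        \<in> iso (relative_homology_group p ?C ?B) (relative_homology_group p X (A \<union> ?K))"
      using iso_set_trans[OF 2 3] by (simp add: o_def)
  qed auto
qed

theorem relative_homology_cell:
  shows "relative_homology_group (int n) X A \<cong> integer_group"
    and "p \<noteq> int n \<Longrightarrow> trivial_group (relative_homology_group p X A)"
proof -
  have "homeomorphic_map (disc n) (subtopology X (\<phi> ` disc_set n)) \<phi>"
    using embedding by (simp add: embedding_map_def)
  then have "hom_induced p (disc n) (disc_boundary n) (subtopology X (\<phi> ` disc_set n)) (\<phi> ` disc_boundary n) \<phi>
    \<in> iso (relative_homology_group p (disc n) (disc_boundary n))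
        (relative_homology_group p (subtopology X (\<phi> ` disc_set n)) (\<phi> ` disc_boundary n))" for p
    by (rule homeomorphic_map_relative_homology_iso) (auto simp: disc_boundary_eq)
  then have iso: "relative_homology_group p (disc n) (disc_boundary n) \<cong> relative_homology_group p X A" for p
    by (rule iso_trans[OF is_isoI is_isoI[OF relative_homology_cell_iso]])
  show "relative_homology_group (int n) X A \<cong> integer_group"
    by (rule iso_trans[OF group.iso_sym[OF group_relative_homology_group iso] disc_homology(1)])
  show "trivial_group (relative_homology_group p X A)" if "p \<noteq> int n"
    using disc_homology(2)[OF that] isomorphic_group_triviality[OF iso] by simp
qed

end

section \<open>The basis of cells\<close>

text \<open>The map factors through the pair of \<open>T\<close> with itself, whose homology is
  trivial. Arguments outside the carrier are covered by the default value of
  \<open>hom_induced\<close>.\<close>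

lemma hom_induced_into_subspace:
  assumes "continuous_map T Z f" "f \<in> topspace T \<rightarrow> A"
  shows "hom_induced p T U Z A f w = \<one>\<^bsub>relative_homology_group p Z A\<^esub>"
proof (cases "w \<in> carrier (relative_homology_group p T U)")
  case True
  have "hom_induced p T U Z A f w = hom_induced p T (topspace T \<inter> U) Z (topspace Z \<inter> A) f w"
    by (metis hom_induced_restrict)
  also have "\<dots> = hom_induced p T (topspace T) Z (topspace Z \<inter> A) f
      (hom_induced p T (topspace T \<inter> U) T (topspace T) id w)"
    using hom_induced_compose'[of T T id "topspace T \<inter> U" "topspace T" Z f "topspace Z \<inter> A" p w]
      assms continuous_map_funspace[OF assms(1)] by auto
  also have "hom_induced p T (topspace T \<inter> U) T (topspace T) id w
      = \<one>\<^bsub>relative_homology_group p T (topspace T)\<^esub>"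
    using trivial_relative_homology_group_topspace[of p T]
      hom_induced_carrier[of p T "topspace T \<inter> U" T "topspace T" id w]
    by (auto simp: trivial_group_def)
  also have "hom_induced p T (topspace T) Z (topspace Z \<inter> A) f \<dots>
      = \<one>\<^bsub>relative_homology_group p Z (topspace Z \<inter> A)\<^esub>"
    by (intro hom_one[OF hom_induced_hom]) auto
  finally show ?thesis by simp
next
  case False
  then show ?thesis
    by (intro hom_induced_default) auto
qed

definition characteristic_map :: "'a cw \<Rightarrow> 'a set \<Rightarrow> ((nat \<Rightarrow> real) \<Rightarrow> 'a) \<Rightarrow> bool" where
  "characteristic_map X e \<phi> \<longleftrightarrow>
     embedding_map (disc (cell_dim X e)) (cw_space X) \<phi> \<and>
     \<phi> ` disc_interior (cell_dim X e) = e \<and>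
     \<phi> ` disc_boundary (cell_dim X e) \<subseteq> skeleton X (int (cell_dim X e) - 1)"

lemma continuous_characteristic_map:
  assumes "characteristic_map X e \<phi>"
  shows "continuous_map (disc (cell_dim X e)) (cw_space X) \<phi>"
proof -
  have "continuous_map (disc (cell_dim X e)) (subtopology (cw_space X) (\<phi> ` topspace (disc (cell_dim X e)))) \<phi>"
    using assms unfolding characteristic_map_def embedding_map_def
    by (intro homeomorphic_imp_continuous_map) simp
  then show ?thesis
    by (simp add: continuous_map_in_subtopology)
qed

abbreviation cell_top :: "'a cw \<Rightarrow> 'a set \<Rightarrow> 'a topology" where
  "cell_top X e \<equiv> subtopology (cw_space X) (closed_cell X e)"

section \<open>Closed cells and skeleta of a regular complex\<close>

locale regular_complex =
  fixes X :: "'a cw"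
  assumes finite_regular: "finite_regular_cw X"
begin

lemma Hausdorff: "Hausdorff_space (cw_space X)"
  and finite_cells: "finite (cells X)"
  and disjoint_cells: "pairwise disjnt (cells X)"
  and Union_cells: "\<Union> (cells X) = topspace (cw_space X)"
  and characteristic_map_exists: "e \<in> cells X \<Longrightarrow> \<exists>\<phi>. characteristic_map X e \<phi>"
  using finite_regular by (auto simp: finite_regular_cw_def characteristic_map_def)

lemma finite_cells_of_dim: "finite (cells_of_dim X n)"
  using finite_cells by (simp add: cells_of_dim_def)

lemma cell_subset_topspace: "e \<in> cells X \<Longrightarrow> e \<subseteq> topspace (cw_space X)"
  using Union_cells by blast

lemma cell_eqI: "\<lbrakk>e \<in> cells X; e' \<in> cells X; x \<in> e; x \<in> e'\<rbrakk> \<Longrightarrow> e = e'"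
  using disjoint_cells by (meson disjnt_iff pairwiseD)

lemma skeleton_subset_topspace: "skeleton X p \<subseteq> topspace (cw_space X)"
  using Union_cells by (auto simp: skeleton_def)

lemma skeleton_mono: "p \<le> q \<Longrightarrow> skeleton X p \<subseteq> skeleton X q"
  by (auto simp: skeleton_def)

lemma cell_subset_skeleton: "e \<in> cells X \<Longrightarrow> e \<subseteq> skeleton X (int (cell_dim X e))"
  by (auto simp: skeleton_def)

lemma cell_disjoint_skeleton: "e \<in> cells X \<Longrightarrow> p < int (cell_dim X e) \<Longrightarrow> e \<inter> skeleton X p = {}"
  using cell_eqI by (fastforce simp: skeleton_def)

text \<open>The image of the closed disc is compact, hence closed, hence contains the closure of
  \<open>e\<close>. Conversely every point of the image is the end of a radial path that stays in
  \<open>e\<close> before its end.\<close>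

lemma closed_cell_eq:
  assumes e: "e \<in> cells X" and \<phi>: "characteristic_map X e \<phi>"
  shows "closed_cell X e = \<phi> ` disc_set (cell_dim X e)"
    and "closed_cell X e - e = \<phi> ` disc_boundary (cell_dim X e)"
proof -
  let ?n = "cell_dim X e"
  have emb: "embedding_map (disc ?n) (cw_space X) \<phi>" and int: "\<phi> ` disc_interior ?n = e"
    using \<phi> by (auto simp: characteristic_map_def)
  have cont: "continuous_map (disc ?n) (cw_space X) \<phi>"
    using \<phi> by (rule continuous_characteristic_map)
  have inj: "inj_on \<phi> (disc_set ?n)"
    using emb homeomorphic_imp_injective_map unfolding embedding_map_def by fastforce
  have "compactin (cw_space X) (\<phi> ` disc_set ?n)"
    using image_compactin[OF _ cont, of "topspace (disc ?n)"] compact_space_disc[of ?n]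
    by (simp add: compact_space_def)
  then have clo: "closedin (cw_space X) (\<phi> ` disc_set ?n)"
    using Hausdorff compactin_imp_closedin by blast
  have "e \<subseteq> \<phi> ` disc_set ?n"
    using int disc_interior_Un_boundary[of ?n] by blast
  then have 1: "closed_cell X e \<subseteq> \<phi> ` disc_set ?n"
    unfolding closed_cell_def using clo by (simp add: closure_of_minimal)
  have "\<phi> x \<in> closed_cell X e" if x: "x \<in> disc_set ?n" for x
  proof -
    \<comment> \<open>The radial path to the image of \<open>x\<close>. The times at which it lies
      in the closed cell form a closed set containing all times before 1, hence also 1.\<close>
    define \<gamma> where "\<gamma> = (\<lambda>t::real. \<phi> (\<lambda>i. t * x i))"
    have Nt: "t * L2_set x {..<?n} \<le> t" if "0 \<le> t" for t
      using that x by (simp add: disc_set_def mult_left_le)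
    have tx: "(\<lambda>i. t * x i) \<in> disc_set ?n" if "0 \<le> t" "t \<le> 1" for t
      by (rule scale_in_disc_set[OF x that(1)]) (use Nt[OF that(1)] that in linarith)
    have "continuous_on {0..1} (\<lambda>t i. t * x i)"
      by (intro continuous_intros)
    then have "continuous_map (top_of_set {0..1}) (disc ?n) (\<lambda>t i. t * x i)"
      using tx by (auto simp: disc_eq)
    then have "continuous_map (top_of_set {0..1}) (cw_space X) \<gamma>"
      using continuous_map_compose[OF _ cont] by (auto simp: \<gamma>_def o_def)
    then have "closedin (top_of_set {0..1}) {t \<in> topspace (top_of_set {0..1}). \<gamma> t \<in> closed_cell X e}"
      unfolding closed_cell_def by (rule closedin_continuous_map_preimage) simp
    then have "closed {t \<in> {0..1}. \<gamma> t \<in> closed_cell X e}"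
      using closedin_closed_trans[OF _ closed_atLeastAtMost] by simp
    moreover have "{0..<1} \<subseteq> {t \<in> {0..1}. \<gamma> t \<in> closed_cell X e}"
    proof
      fix t :: real assume t: "t \<in> {0..<1}"
      then have "(\<lambda>i. t * x i) \<in> disc_interior ?n"
        using tx[of t] Nt[of t] by (auto simp: disc_interior_eq L2_set_scale)
      then have "\<gamma> t \<in> e"
        using int by (auto simp: \<gamma>_def)
      then show "t \<in> {t \<in> {0..1}. \<gamma> t \<in> closed_cell X e}"
        using t closure_of_subset[OF cell_subset_topspace[OF e]] by (auto simp: closed_cell_def)
    qed
    ultimately have "closure {0..<1} \<subseteq> {t \<in> {0..1}. \<gamma> t \<in> closed_cell X e}"
      by (rule closure_minimal[rotated])
    moreover have "(1::real) \<in> closure {0..<1}"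
      by simp
    ultimately have "\<gamma> 1 \<in> closed_cell X e"
      by blast
    then show ?thesis
      by (simp add: \<gamma>_def)
  qed
  with 1 show eq: "closed_cell X e = \<phi> ` disc_set ?n"
    by blast
  have "\<phi> ` disc_set ?n - \<phi> ` disc_interior ?n = \<phi> ` (disc_set ?n - disc_interior ?n)"
    using inj by (subst inj_on_image_set_diff[of \<phi> "disc_set ?n"]) (auto simp: disc_interior_eq)
  also have "disc_set ?n - disc_interior ?n = disc_boundary ?n"
    using disc_interior_Un_boundary[of ?n] disc_interior_Int_boundary[of ?n] by blast
  finally show "closed_cell X e - e = \<phi> ` disc_boundary ?n"
    unfolding eq using int by simp
qed

lemma cell_subset_closed_cell: "e \<in> cells X \<Longrightarrow> e \<subseteq> closed_cell X e"
  by (simp add: closed_cell_def closure_of_subset cell_subset_topspace)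

lemma closed_cell_subset_topspace: "closed_cell X e \<subseteq> topspace (cw_space X)"
  unfolding closed_cell_def by (rule closure_of_subset_topspace)

lemma closedin_closed_cell: "closedin (cw_space X) (closed_cell X e)"
  unfolding closed_cell_def by simp

lemma boundary_subset_skeleton:
  assumes "e \<in> cells X"
  shows "closed_cell X e - e \<subseteq> skeleton X (int (cell_dim X e) - 1)"
proof -
  obtain \<phi> where "characteristic_map X e \<phi>"
    using characteristic_map_exists assms by blast
  then show ?thesis
    using closed_cell_eq(2)[OF assms, of \<phi>] by (simp add: characteristic_map_def)
qed

lemma closed_cell_subset_skeleton:
  assumes "e \<in> cells X"
  shows "closed_cell X e \<subseteq> skeleton X (int (cell_dim X e))"
  using boundary_subset_skeleton[OF assms] cell_subset_skeleton[OF assms]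
    skeleton_mono[of "int (cell_dim X e) - 1" "int (cell_dim X e)"] by fastforce

lemma cell_nonempty:
  assumes "e \<in> cells X"
  shows "e \<noteq> {}"
  using characteristic_map_exists[OF assms] zero_in_disc_interior
  by (auto simp: characteristic_map_def)

lemma compactin_closed_cell:
  assumes "e \<in> cells X"
  shows "compactin (cw_space X) (closed_cell X e)"
proof -
  obtain \<phi> where \<phi>: "characteristic_map X e \<phi>"
    using characteristic_map_exists assms by blast
  then have "continuous_map (disc (cell_dim X e)) (cw_space X) \<phi>"
    by (rule continuous_characteristic_map)
  from image_compactin[OF _ this, of "topspace (disc (cell_dim X e))"] show ?thesis
    using compact_space_disc closed_cell_eq(1)[OF assms \<phi>] by (simp add: compact_space_def)
qed

lemma closedin_Union_cells:
  assumes "E \<subseteq> cells X" "\<And>e. e \<in> E \<Longrightarrow> closed_cell X e \<subseteq> \<Union>E"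
  shows "closedin (cw_space X) (\<Union>E)"
proof -
  have "\<Union>E = \<Union> (closed_cell X ` E)"
    using assms cell_subset_closed_cell by blast
  moreover have "closedin (cw_space X) (\<Union> (closed_cell X ` E))"
    using finite_subset[OF assms(1) finite_cells] closedin_closed_cell
    by (intro closedin_Union) auto
  ultimately show ?thesis by simp
qed

text \<open>The boundary of an \<open>n\<close>-cell lies in the skeleton below, so every selection
  of \<open>n\<close>-cells is closed together with that skeleton. This makes the partial stages,
  and any order of attaching, available.\<close>

lemma closedin_skeleton_Un:
  assumes "E \<subseteq> cells_of_dim X n"
  shows "closedin (cw_space X) (skeleton X (int n - 1) \<union> \<Union>E)"
proof -
  let ?F = "{e \<in> cells X. int (cell_dim X e) \<le> int n - 1} \<union> E"
  have eq: "skeleton X (int n - 1) \<union> \<Union>E = \<Union>?F"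
    by (auto simp: skeleton_def)
  have "closed_cell X e \<subseteq> \<Union>?F" if "e \<in> ?F" for e
  proof -
    have e: "e \<in> cells X" "int (cell_dim X e) \<le> int n"
      using that assms by (auto simp: cells_of_dim_def)
    have "closed_cell X e - e \<subseteq> skeleton X (int n - 1)"
      using boundary_subset_skeleton[OF e(1)] skeleton_mono[of "int (cell_dim X e) - 1" "int n - 1"] e(2)
      by fastforce
    moreover have "e \<subseteq> \<Union>?F"
      using that by blast
    ultimately show ?thesis
      unfolding eq[symmetric] by blast
  qed
  then show ?thesis
    unfolding eq using assms by (intro closedin_Union_cells) (auto simp: cells_of_dim_def)
qed

lemma skeleton_eq_Un_cells: "skeleton X (int n) = skeleton X (int n - 1) \<union> \<Union> (cells_of_dim X n)"
proof -
  have "{e \<in> cells X. int (cell_dim X e) \<le> int n}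
      = {e \<in> cells X. int (cell_dim X e) \<le> int n - 1} \<union> cells_of_dim X n"
    by (auto simp: cells_of_dim_def)
  then show ?thesis
    by (simp add: skeleton_def)
qed

lemma closedin_skeleton: "closedin (cw_space X) (skeleton X (int n))"
  using closedin_skeleton_Un[of "cells_of_dim X n" n] skeleton_eq_Un_cells by simp

lemma cell_attachment_skeleton:
  assumes E: "E \<subseteq> cells_of_dim X n" and e: "e \<in> cells_of_dim X n" "e \<notin> E"
    and \<phi>: "characteristic_map X e \<phi>"
  shows "cell_attachment (subtopology (cw_space X) (skeleton X (int n - 1) \<union> \<Union>(insert e E)))
    (skeleton X (int n - 1) \<union> \<Union>E) n \<phi>"
proof -
  let ?S = "skeleton X (int n - 1)"
  have dim: "e \<in> cells X" "cell_dim X e = n"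
    using e by (auto simp: cells_of_dim_def)
  note cc = closed_cell_eq[OF dim(1) \<phi>, unfolded dim(2)]
  have sub: "?S \<union> \<Union>(insert e E) \<subseteq> topspace (cw_space X)"
    using skeleton_subset_topspace[of "int n - 1"] Union_cells E e(1) by (auto simp: cells_of_dim_def)
  have bd: "\<phi> ` disc_boundary n \<subseteq> ?S"
    using \<phi> dim by (simp add: characteristic_map_def)
  have int: "\<phi> ` disc_interior n = e"
    using \<phi> dim by (simp add: characteristic_map_def)
  have "disc_set n = disc_interior n \<union> disc_boundary n"
    by (simp add: disc_interior_Un_boundary)
  then have img: "\<phi> ` disc_set n = e \<union> \<phi> ` disc_boundary n"
    using int by auto
  show ?thesis
  proof
    show "Hausdorff_space (subtopology (cw_space X) (?S \<union> \<Union>(insert e E)))"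
      using Hausdorff Hausdorff_space_subtopology by blast
    show "closedin (subtopology (cw_space X) (?S \<union> \<Union>(insert e E))) (?S \<union> \<Union>E)"
      using closedin_skeleton_Un[OF E] by (rule closedin_subset_topspace) auto
    show "embedding_map (disc n) (subtopology (cw_space X) (?S \<union> \<Union>(insert e E))) \<phi>"
      using \<phi> dim bd img by (auto simp: embedding_map_in_subtopology characteristic_map_def)
    show "topspace (subtopology (cw_space X) (?S \<union> \<Union>(insert e E))) = ?S \<union> \<Union>E \<union> \<phi> ` disc_set n"
      using sub bd img by auto
    have "e \<inter> \<Union>E = {}"
      using cell_eqI[OF dim(1)] E e(2) by (fastforce simp: cells_of_dim_def)
    then show "\<phi> ` disc_interior n \<inter> (?S \<union> \<Union>E) = {}"
      using int cell_disjoint_skeleton[OF dim(1), of "int n - 1"] dim(2) by auto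
  qed (use bd in auto)
qed

section \<open>The classes of the cells as a basis\<close>

abbreviation cell_homology_group :: "int \<Rightarrow> 'a set \<Rightarrow> 'a chain set monoid" where
  "cell_homology_group p e \<equiv>
     relative_homology_group p (cell_top X e) (closed_cell X e - e)"

text \<open>\<open>orientation\<close> is an indefinite choice, so the existence of a generator has
  to be proved. It comes from attaching \<open>e\<close> alone to the skeleton below it.\<close>

lemma infinite_generator_orientation:
  assumes "e \<in> cells X"
  shows "infinite_generator (cell_homology_group (int (cell_dim X e)) e) (orientation X e)"
proof -
  let ?n = "cell_dim X e" and ?G = "cell_homology_group (int (cell_dim X e)) e"
  obtain \<phi> where \<phi>: "characteristic_map X e \<phi>"
    using characteristic_map_exists assms by blast
  interpret cell_attachment "subtopology (cw_space X) (skeleton X (int ?n - 1) \<union> \<Union>(insert e {}))"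
    "skeleton X (int ?n - 1) \<union> \<Union>{}" ?n \<phi>
    by (rule cell_attachment_skeleton) (use assms \<phi> in \<open>auto simp: cells_of_dim_def\<close>)
  interpret C: cell_attachment
    "subtopology (subtopology (cw_space X) (skeleton X (int ?n - 1) \<union> \<Union>(insert e {}))) (\<phi> ` disc_set ?n)"
    "\<phi> ` disc_boundary ?n" ?n \<phi>
    by (rule cell_attachment_cell)
  have "\<phi> ` disc_set ?n \<subseteq> skeleton X (int ?n - 1) \<union> e"
    using closed_cell_eq[OF assms \<phi>] boundary_subset_skeleton[OF assms] by blast
  then have "subtopology (subtopology (cw_space X) (skeleton X (int ?n - 1) \<union> \<Union>(insert e {}))) (\<phi> ` disc_set ?n)
      = cell_top X e"
    using closed_cell_eq[OF assms \<phi>] by (simp add: subtopology_subtopology inf.absorb2)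
  then have iso: "?G \<cong> integer_group"
    using C.relative_homology_cell(1) closed_cell_eq[OF assms \<phi>] by simp
  have "\<exists>g. g \<in> carrier ?G \<and> carrier (subgroup_generated ?G {g}) = carrier ?G"
    using infinite_generator_exists[OF iso group_relative_homology_group] by metis
  then have "orientation X e \<in> carrier ?G \<and> carrier (subgroup_generated ?G {orientation X e}) = carrier ?G"
    unfolding orientation_def Let_def by (rule someI_ex)
  then show ?thesis
    using infinite_generatorI[OF iso group_relative_homology_group] by blast
qed

text \<open>The class of the cell when only the cells in \<open>E\<close> have been attached; once
  \<open>E\<close> is the set of all \<open>n\<close>-cells it becomes
  \<open>cell_class\<close>.\<close>

definition stage_class :: "nat \<Rightarrow> 'a set set \<Rightarrow> 'a set \<Rightarrow> 'a chain set" where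
  "stage_class n E e = hom_induced (int n) (cell_top X e) (closed_cell X e - e)
     (subtopology (cw_space X) (skeleton X (int n - 1) \<union> \<Union>E)) (skeleton X (int n - 1)) id (orientation X e)"

lemma closed_cell_subset_Un:
  assumes "e \<in> cells_of_dim X n"
  shows "closed_cell X e \<subseteq> skeleton X (int n - 1) \<union> e" "closed_cell X e - e \<subseteq> skeleton X (int n - 1)"
  using boundary_subset_skeleton[of e] assms by (auto simp: cells_of_dim_def)

text \<open>Modulo the previous stage only the new cell remains, and the inclusion of its closed
  cell is an isomorphism of pairs on homology. Its orientation therefore becomes the generator of
  the quotient that \<open>free_basis_extend\<close> asks for.\<close>

lemma stage_basis_step:
  fixes n :: nat
  defines "S \<equiv> skeleton X (int n - 1)"
  assumes E: "E \<subseteq> cells_of_dim X n" and e: "e \<in> cells_of_dim X n" "e \<notin> E"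
  defines "Z \<equiv> subtopology (cw_space X) (S \<union> \<Union>(insert e E))" and "A \<equiv> S \<union> \<Union>E"
  shows "infinite_generator (relative_homology_group (int n) Z A)
      (hom_induced (int n) Z S Z A id (stage_class n (insert e E) e))"
    and "p \<noteq> int n \<Longrightarrow> trivial_group (relative_homology_group p Z A)"
proof -
  have dim: "e \<in> cells X" "cell_dim X e = n"
    using e by (auto simp: cells_of_dim_def)
  obtain \<phi> where \<phi>: "characteristic_map X e \<phi>"
    using characteristic_map_exists dim by blast
  interpret cell_attachment Z A n \<phi>
    unfolding Z_def A_def S_def using cell_attachment_skeleton[OF E e \<phi>] by simp
  show "p \<noteq> int n \<Longrightarrow> trivial_group (relative_homology_group p Z A)"
    by (rule relative_homology_cell)
  have cc: "closed_cell X e = \<phi> ` disc_set n" "closed_cell X e - e = \<phi> ` disc_boundary n"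
    using closed_cell_eq[OF dim(1) \<phi>] dim by auto
  have sub: "closed_cell X e \<subseteq> S \<union> \<Union>(insert e E)" "closed_cell X e - e \<subseteq> S"
    using closed_cell_subset_Un[OF e(1)] by (auto simp: S_def)
  have top: "subtopology Z (closed_cell X e) = cell_top X e"
    using sub(1) by (simp add: Z_def subtopology_subtopology inf.absorb2)
  have "hom_induced (int n) (cell_top X e) (closed_cell X e - e) Z A id
     \<in> iso (cell_homology_group (int n) e) (relative_homology_group (int n) Z A)"
    using relative_homology_cell_iso[of "int n"] unfolding cc[symmetric] top .
  from infinite_generator_iso[OF infinite_generator_orientation[OF dim(1), unfolded dim(2)] this
      group_relative_homology_group group_relative_homology_group]
  have "infinite_generator (relative_homology_group (int n) Z A)
      (hom_induced (int n) (cell_top X e) (closed_cell X e - e) Z A id (orientation X e))" .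
  moreover have "hom_induced (int n) Z S Z A id (stage_class n (insert e E) e)
      = hom_induced (int n) (cell_top X e) (closed_cell X e - e) Z A id (orientation X e)"
    unfolding stage_class_def Z_def[symmetric] S_def[symmetric]
    using sub by (intro hom_induced_id_compose)
      (auto simp: A_def Z_def continuous_map_sub)
  ultimately show "infinite_generator (relative_homology_group (int n) Z A)
      (hom_induced (int n) Z S Z A id (stage_class n (insert e E) e))"
    by simp
qed

text \<open>
  The \<open>n\<close>-cells are attached one at a time; each step is a short exact sequence with infinite
  cyclic quotient, cut out of the exact sequence of a triple.
\<close>

lemma stage_basis:
  fixes n :: nat
  defines "S \<equiv> skeleton X (int n - 1)"
  assumes "finite E" "E \<subseteq> cells_of_dim X n"
  shows "free_basis (relative_homology_group (int n) (subtopology (cw_space X) (S \<union> \<Union>E)) S) (stage_class n E) E \<and>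
    (\<forall>p. p \<noteq> int n \<longrightarrow> trivial_group (relative_homology_group p (subtopology (cw_space X) (S \<union> \<Union>E)) S))"
  using assms(2,3)
proof (induction E rule: finite_induct)
  case empty
  have "topspace (subtopology (cw_space X) S) = S"
    unfolding S_def using skeleton_subset_topspace by auto
  then have "trivial_group (relative_homology_group p (subtopology (cw_space X) S) S)" for p
    using trivial_relative_homology_group_topspace[of p "subtopology (cw_space X) S"] by simp
  then show ?case
    by (simp add: free_basis_trivial)
next
  case (insert e E)
  define Z where "Z = subtopology (cw_space X) (S \<union> \<Union>(insert e E))"
  define A where "A = S \<union> \<Union>E"
  have E: "E \<subseteq> cells_of_dim X n" and e: "e \<in> cells_of_dim X n" "e \<notin> E"
    using insert by auto
  have ZA: "subtopology Z A = subtopology (cw_space X) A"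
    by (auto simp: Z_def A_def subtopology_subtopology intro!: arg_cong[where f = "subtopology (cw_space X)"])
  have SA: "S \<subseteq> A" by (simp add: A_def)
  note IH = insert.IH[OF E, folded A_def]
  note step = stage_basis_step[OF E e, folded S_def, folded A_def Z_def]
  let ?i = "\<lambda>p. hom_induced p (subtopology (cw_space X) A) S Z S id"
  let ?j = "\<lambda>p. hom_induced p Z S Z A id"
  have ker: "kernel (relative_homology_group p Z S) (relative_homology_group p Z A) (?j p)
      = ?i p ` carrier (relative_homology_group p (subtopology (cw_space X) A) S)" for p
    using homology_exactness_triple_3[OF SA, of p Z] by (simp add: ZA)
  have "trivial_group (relative_homology_group p Z S)" if "p \<noteq> int n" for p
  proof -
    let ?G = "relative_homology_group p Z S"
    have "carrier (relative_homology_group p Z A) = {\<one>\<^bsub>relative_homology_group p Z A\<^esub>}"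
      using step(2)[OF that] by (simp add: trivial_group_def)
    then have "kernel ?G (relative_homology_group p Z A) (?j p) = carrier ?G"
      using hom_induced_carrier[of p Z S Z A id] by (auto simp: kernel_def)
    moreover have "carrier (relative_homology_group p (subtopology (cw_space X) A) S)
        = {\<one>\<^bsub>relative_homology_group p (subtopology (cw_space X) A) S\<^esub>}"
      using IH that by (simp add: trivial_group_def)
    moreover have "?i p \<one>\<^bsub>relative_homology_group p (subtopology (cw_space X) A) S\<^esub> = \<one>\<^bsub>?G\<^esub>"
      by (intro hom_one[OF hom_induced_hom]) auto
    ultimately have "carrier ?G = {\<one>\<^bsub>?G\<^esub>}"
      using ker[of p] by simp
    then show ?thesis
      by (simp add: trivial_group_def)
  qed
  moreover have "free_basis (relative_homology_group (int n) Z S) (stage_class n (insert e E)) (insert e E)"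
  proof (rule free_basis_extend[where i = "?i (int n)" and j = "?j (int n)" and a = "stage_class n E"])
    show "free_basis (relative_homology_group (int n) (subtopology (cw_space X) A) S) (stage_class n E) E"
      using IH by simp
    \<comment> \<open>The kernel is the image of the connecting map from degree \<open>n + 1\<close>
      of the attached cell, where the homology is trivial.\<close>
    show "inj_on (?i (int n)) (carrier (relative_homology_group (int n) (subtopology (cw_space X) A) S))"
    proof -
      let ?H = "relative_homology_group (int n) (subtopology (cw_space X) A) S"
      let ?K = "relative_homology_group (int n + 1) Z A"
      let ?r = "hom_relboundary (int n + 1) Z A S"
      have "kernel ?H (relative_homology_group (int n) Z S) (?i (int n)) = ?r ` carrier ?K"
        using homology_exactness_triple_2[OF SA, of "int n + 1" Z] by (simp add: ZA)
      moreover have "carrier ?K = {\<one>\<^bsub>?K\<^esub>}"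
        using step(2)[of "int n + 1"] by (simp add: trivial_group_def)
      moreover have "?r \<in> hom ?K ?H"
        using group_homomorphism_hom_relboundary[of "int n + 1" Z A S] by (simp add: ZA)
      then have "?r \<one>\<^bsub>?K\<^esub> = \<one>\<^bsub>?H\<^esub>"
        by (rule hom_one) auto
      moreover have "group_hom ?H (relative_homology_group (int n) Z S) (?i (int n))"
        by (simp add: group_hom_def group_hom_axioms_def hom_induced_hom)
      ultimately show ?thesis
        by (simp add: group_hom.inj_iff_trivial_ker)
    qed
    show "?i (int n) \<in> hom (relative_homology_group (int n) (subtopology (cw_space X) A) S)
        (relative_homology_group (int n) Z S)"
      by (rule hom_induced_hom)
    show "?j (int n) \<in> hom (relative_homology_group (int n) Z S) (relative_homology_group (int n) Z A)"
      by (rule hom_induced_hom)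
    show "stage_class n (insert e E) e \<in> carrier (relative_homology_group (int n) Z S)"
      unfolding stage_class_def S_def[symmetric] Z_def[symmetric] by (rule hom_induced_carrier)
    show "stage_class n (insert e E) x = ?i (int n) (stage_class n E x)" if "x \<in> E" for x
    proof -
      have "x \<in> cells_of_dim X n" using that E by blast
      from closed_cell_subset_Un[OF this]
      show ?thesis
        unfolding stage_class_def S_def[symmetric] Z_def[symmetric] A_def[symmetric] using that
        by (intro hom_induced_id_compose[symmetric])
          (auto simp: S_def A_def Z_def continuous_map_sub)
    qed
  qed (use ker step e in auto)
  ultimately show ?case
    unfolding Z_def by blast
qed

lemma stage_class_all:
  assumes "e \<in> cells_of_dim X n"
  shows "stage_class n (cells_of_dim X n) e = cell_class X e"
  using assms by (simp add: stage_class_def cell_class_def cells_of_dim_def Let_def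
      skeleton_eq_Un_cells[of n, unfolded cells_of_dim_def])

text \<open>This gives the definite description in \<open>cell_coords\<close> its meaning.\<close>

theorem cell_basis: "free_basis (cell_group X n) (cell_class X) (cells_of_dim X n)"
proof -
  have "free_basis (cell_group X n) (stage_class n (cells_of_dim X n)) (cells_of_dim X n)"
    using stage_basis[OF finite_cells_of_dim order_refl, of n]
    by (simp add: cell_group_def flip: skeleton_eq_Un_cells)
  then show ?thesis
    by (rule free_basis_cong) (rule stage_class_all)
qed

lemma cell_coords_eq: "cell_coords X n = int_coords (cell_group X n) (cell_class X) (cells_of_dim X n)"
  unfolding cell_coords_def int_coords_def int_comb_def by (rule refl)

lemma cell_class_carrier: "e \<in> cells_of_dim X n \<Longrightarrow> cell_class X e \<in> carrier (cell_group X n)"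
  using free_basisD(3)[OF cell_basis] by blast

end

section \<open>Matrices of the cellular maps\<close>

text \<open>With the distinguished point at the centre of the disc, missing that point becomes a
  lower bound on norms, which is what \<open>collar\<close> measures.\<close>

lemma (in regular_complex) characteristic_map_centred:
  assumes "e \<in> cells X" "x \<in> e"
  obtains \<phi> where "characteristic_map X e \<phi>" "\<phi> (\<lambda>i. 0) = x"
proof -
  let ?n = "cell_dim X e"
  obtain \<phi> where \<phi>: "characteristic_map X e \<phi>"
    using characteristic_map_exists assms by blast
  then obtain q where q: "q \<in> disc_interior ?n" "x = \<phi> q"
    using assms(2) unfolding characteristic_map_def by blast
  obtain T where T: "homeomorphic_map (disc ?n) (disc ?n) T" "T (\<lambda>i. 0) = q"
    "T ` disc_interior ?n = disc_interior ?n" "T ` disc_boundary ?n = disc_boundary ?n"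
    using disc_recentre[OF q(1)] by metis
  have "embedding_map (disc ?n) (disc ?n) T"
    using T(1) surjective_embedding_map by blast
  then have "embedding_map (disc ?n) (cw_space X) (\<phi> \<circ> T)"
    by (rule embedding_map_compose) (use \<phi> in \<open>simp add: characteristic_map_def\<close>)
  then have "characteristic_map X e (\<phi> \<circ> T)"
    using \<phi> unfolding characteristic_map_def image_comp[symmetric] T(3,4) by blast
  then show ?thesis
    using that T(2) q(2) by simp
qed

text \<open>A class carried by a compact set that misses a point of the cell \<open>e'\<close> can be pushed off \<open>e'\<close>.\<close>

lemma (in regular_complex) cell_coords_compact_image:
  assumes e': "e' \<in> cells_of_dim X n" and x: "x \<in> e'"
    and T: "compact_space T"
    and f: "continuous_map T (skel X (int n)) f" "f \<in> U \<rightarrow> skeleton X (int n - 1)" "x \<notin> f ` topspace T"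
  shows "cell_coords X n (hom_induced (int n) T U (skel X (int n)) (skeleton X (int n - 1)) f w) e' = 0"
proof -
  define S where "S = skeleton X (int n - 1)"
  \<comment> \<open>All \<open>n\<close>-cells except \<open>e'\<close>, so that \<open>A\<close> is
    the \<open>n\<close>-skeleton without \<open>e'\<close> and modulo \<open>A\<close> only the
    coefficient at \<open>e'\<close> survives.\<close>
  define E where "E = cells_of_dim X n - {e'}"
  define Z where "Z = skel X (int n)"
  define A where "A = S \<union> \<Union>E"
  have E: "E \<subseteq> cells_of_dim X n" "e' \<notin> E" "insert e' E = cells_of_dim X n"
    using e' by (auto simp: E_def)
  have dim: "e' \<in> cells X" "cell_dim X e' = n"
    using e' by (auto simp: cells_of_dim_def)
  have Z: "Z = subtopology (cw_space X) (S \<union> \<Union>(insert e' E))"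
    unfolding Z_def S_def E(3) skeleton_eq_Un_cells[symmetric] by (rule refl)
  obtain \<phi> where \<phi>: "characteristic_map X e' \<phi>" "\<phi> (\<lambda>i. 0) = x"
    using characteristic_map_centred[OF dim(1) x] by metis
  interpret cell_attachment Z A n \<phi>
    unfolding Z A_def S_def using cell_attachment_skeleton[OF E(1) e' E(2) \<phi>(1)] .
  define K where "K = {y \<in> topspace (disc n). \<phi> y \<in> f ` topspace T}"
  have "compactin Z (f ` topspace T)"
    using image_compactin[OF _ f(1), of "topspace T"] T by (simp add: compact_space_def Z_def)
  then have "closedin Z (f ` topspace T)"
    using Hausdorff compactin_imp_closedin by blast
  then have "closedin (disc n) K"
    unfolding K_def by (rule closedin_continuous_map_preimage[OF continuous_phi])
  then have "compactin (disc n) K"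
    using compact_space_disc closedin_compact_space by blast
  then have compact_K: "compact K"
    by (simp add: disc_eq compactin_subtopology)
  \<comment> \<open>The norm attains its minimum on the compact set \<open>K\<close>, and the
    minimum is positive because the centre is missed. Comparison with \<open>1/2\<close> below keeps
    \<open>\<delta>\<close> less than 1.\<close>
  have "\<exists>\<delta>>0. \<delta> < 1 \<and> (\<forall>y\<in>K. \<delta> \<le> L2_set y {..<n})"
  proof (cases "K = {}")
    case True
    then show ?thesis by (intro exI[of _ "1/2"]) auto
  next
    case False
    have "continuous_on K (\<lambda>y. L2_set y {..<n})"
      by (intro continuous_on_L2_set continuous_on_subset[OF continuous_on_product_coordinates]) simp
    then obtain y0 where y0: "y0 \<in> K" "\<And>y. y \<in> K \<Longrightarrow> L2_set y0 {..<n} \<le> L2_set y {..<n}"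
      using continuous_attains_inf[OF compact_K False] by blast
    have "L2_set y0 {..<n} \<noteq> 0"
    proof
      assume "L2_set y0 {..<n} = 0"
      then have "y0 i = 0" if "i < n" for i
        using that by (simp add: L2_set_eq_0_iff)
      moreover have "y0 i = 0" if "i \<ge> n" for i
        using y0(1) that by (simp add: K_def disc_set_def)
      ultimately have "y0 = (\<lambda>i. 0)"
        by (metis linorder_not_le)
      then show False
        using y0(1) \<phi>(2) f(3) by (simp add: K_def)
    qed
    then have "0 < L2_set y0 {..<n}"
      using L2_set_nonneg[of y0 "{..<n}"] by linarith
    then show ?thesis
      using y0(2) by (intro exI[of _ "min (L2_set y0 {..<n}) (1/2)"]) (auto simp: min_le_iff_disj)
  qed
  then obtain \<delta> where \<delta>: "0 < \<delta>" "\<delta> < 1" "\<And>y. y \<in> K \<Longrightarrow> \<delta> \<le> L2_set y {..<n}"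
    by blast
  have img: "f \<in> topspace T \<rightarrow> A \<union> collar \<delta>"
  proof
    fix t assume t: "t \<in> topspace T"
    then have "f t \<in> A \<union> \<phi> ` disc_set n"
      using continuous_map_funspace[OF f(1)] covers unfolding Z_def by blast
    then show "f t \<in> A \<union> collar \<delta>"
    proof
      assume "f t \<in> \<phi> ` disc_set n"
      then obtain y where y: "y \<in> disc_set n" "f t = \<phi> y" by blast
      then have "y \<in> K"
        using t by (simp add: K_def y(2)[symmetric])
      then show ?thesis
        using \<delta>(3) y by (auto simp: collar_def)
    qed simp
  qed
  let ?G = "relative_homology_group (int n) Z S" and ?H = "relative_homology_group (int n) Z A"
  let ?L = "relative_homology_group (int n) Z (A \<union> collar \<delta>)"
  let ?j = "hom_induced (int n) Z S Z A id" and ?k = "hom_induced (int n) Z A Z (A \<union> collar \<delta>) id"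
  have G: "?G = cell_group X n"
    by (simp add: cell_group_def Z_def S_def)
  define z where "z = hom_induced (int n) T U Z S f w"
  have zG: "z \<in> carrier ?G"
    unfolding z_def by (rule hom_induced_carrier)
  \<comment> \<open>The image of \<open>f\<close> lies in \<open>A\<close> together with the collar,
    so the class dies there; the collar isomorphism then shows that it is already trivial modulo
    \<open>A\<close>.\<close>
  have "?k (?j z) = hom_induced (int n) Z S Z (A \<union> collar \<delta>) id z"
    by (rule hom_induced_id_compose) (auto simp: A_def)
  also have "\<dots> = hom_induced (int n) T U Z (A \<union> collar \<delta>) (id \<circ> f) w"
    unfolding z_def by (rule hom_induced_compose') (use f in \<open>auto simp: Z_def S_def A_def\<close>)
  also have "\<dots> = \<one>\<^bsub>?L\<^esub>"
    using f(1) img by (intro hom_induced_into_subspace) (auto simp: Z_def)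
  finally have "?k (?j z) = \<one>\<^bsub>?L\<^esub>" .
  moreover have "?k \<one>\<^bsub>?H\<^esub> = \<one>\<^bsub>?L\<^esub>"
    by (intro hom_one[OF hom_induced_hom]) auto
  moreover have "inj_on ?k (carrier ?H)"
    using relative_homology_collar_iso[of \<delta> "int n"] \<delta>(1,2) by (simp add: iso_def bij_betw_def)
  moreover have "?j z \<in> carrier ?H"
    by (rule hom_induced_carrier)
  moreover have one: "\<one>\<^bsub>?H\<^esub> \<in> carrier ?H"
    by (rule monoid.one_closed[OF group.is_monoid[OF group_relative_homology_group]])
  ultimately have jz: "?j z = \<one>\<^bsub>?H\<^esub>"
    by (metis inj_onD)
  define c where "c = cell_coords X n z"
  have "z = int_comb ?G (cell_class X) (cells_of_dim X n) c"
    unfolding c_def cell_coords_eq G using int_coords(2)[OF cell_basis zG[unfolded G]] .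
  then have "?j z = ?j (int_comb ?G (cell_class X) (cells_of_dim X n) c)"
    by (rule arg_cong)
  also have "\<dots> = int_comb ?H (\<lambda>e. ?j (cell_class X e)) (cells_of_dim X n) c"
    by (intro int_comb_hom hom_induced_hom) (auto simp: G free_basisD(1)[OF cell_basis] intro: cell_class_carrier)
  also have "\<dots> = ?j (cell_class X e') [^]\<^bsub>?H\<^esub> c e'"
  proof (rule int_comb_single)
    show "?j (cell_class X e) = \<one>\<^bsub>?H\<^esub>" if "e \<in> cells_of_dim X n" "e \<noteq> e'" for e
    proof -
      have e: "e \<in> cells X" "cell_dim X e = n"
        using that by (auto simp: cells_of_dim_def)
      have sub: "closed_cell X e \<subseteq> S \<union> e" "closed_cell X e - e \<subseteq> S"
        using closed_cell_subset_Un[OF that(1)] by (auto simp: S_def)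
      have eA: "e \<subseteq> A"
        using that by (auto simp: A_def E_def)
      have cont: "continuous_map (cell_top X e) Z id"
        using closed_cell_subset_skeleton[OF e(1)] e(2)
        by (auto simp: Z_def continuous_map_sub)
      have "?j (cell_class X e) = hom_induced (int n) (cell_top X e)
          (closed_cell X e - e) Z A id (orientation X e)"
        unfolding cell_class_def Let_def e(2) Z_def[symmetric] S_def[symmetric]
        using cont sub by (intro hom_induced_id_compose) (auto simp: A_def)
      also have "\<dots> = \<one>\<^bsub>?H\<^esub>"
      proof (rule hom_induced_into_subspace[OF cont])
        have "closed_cell X e \<subseteq> A"
          using sub(1) eA by (auto simp: A_def)
        then show "id \<in> topspace (cell_top X e) \<rightarrow> A"
          by auto
      qed
      finally show ?thesis .
    qed
  qed (use e' finite_cells_of_dim hom_induced_carrier in auto)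
  finally have "?j (cell_class X e') [^]\<^bsub>?H\<^esub> c e' = \<one>\<^bsub>?H\<^esub>"
    using jz by simp
  \<comment> \<open>Modulo \<open>A\<close> the class of \<open>e'\<close> has infinite order, so a
    trivial power of it has exponent 0.\<close>
  moreover have "infinite_generator ?H (?j (cell_class X e'))"
    using stage_basis_step(1)[OF E(1) e' E(2), folded S_def, folded A_def Z]
    unfolding E(3) stage_class_all[OF e'] .
  moreover have "?j (cell_class X e') [^]\<^bsub>?H\<^esub> (0::int) = \<one>\<^bsub>?H\<^esub>"
    by (simp add: int_pow_def)
  ultimately have "c e' = 0"
    unfolding infinite_generator_def using one by metis
  then show ?thesis
    by (simp add: c_def z_def Z_def S_def)
qed

section \<open>Homomorphisms behind the coefficients\<close>

definition boundary_hom :: "'a cw \<Rightarrow> nat \<Rightarrow> 'a chain set \<Rightarrow> 'a chain set" where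
  "boundary_hom X n = hom_relboundary (int n + 1) (skel X (int n + 1)) (skeleton X (int n)) (skeleton X (int n - 1))"

definition map_hom :: "'a cw \<Rightarrow> 'b cw \<Rightarrow> ('a \<Rightarrow> 'b) \<Rightarrow> nat \<Rightarrow> 'a chain set \<Rightarrow> 'b chain set" where
  "map_hom X Y f n = hom_induced (int n) (skel X (int n)) (skeleton X (int n - 1))
     (skel Y (int n)) (skeleton Y (int n - 1)) f"

lemma skel_skel:
  "p \<le> q \<Longrightarrow> subtopology (skel X q) (skeleton X p) = skel X p"
proof -
  assume "p \<le> q"
  then have "skeleton X p \<subseteq> skeleton X q"
    by (auto simp: skeleton_def)
  then show ?thesis
    by (simp add: subtopology_subtopology inf.absorb2)
qed

lemma boundary_hom: "boundary_hom X n \<in> hom (cell_group X (Suc n)) (cell_group X n)"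
  using group_homomorphism_hom_relboundary[of "int n + 1" "skel X (int n + 1)" "skeleton X (int n)" "skeleton X (int n - 1)"]
  by (simp add: boundary_hom_def cell_group_def skel_skel add.commute)

lemma map_hom: "map_hom X Y f n \<in> hom (cell_group X n) (cell_group Y n)"
  unfolding map_hom_def cell_group_def by (rule hom_induced_hom)

lemma incidence_eq: "incidence X n e e' = cell_coords X n (boundary_hom X n (cell_class X e)) e'"
  by (simp add: incidence_def boundary_hom_def)

lemma map_coeff_eq: "map_coeff X Y f n e e' = cell_coords Y n (map_hom X Y f n (cell_class X e)) e'"
  by (simp add: map_coeff_def map_hom_def)

lemma group_cell_group [simp]: "group (cell_group X n)"
  by (simp add: cell_group_def)

text \<open>The composite contains two consecutive maps of the long exact sequence of the pair of
  the skeleta of index \<open>n + 1\<close> and \<open>n\<close>, whose composite is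
  trivial.\<close>

lemma boundary_hom_boundary_hom:
  assumes "z \<in> carrier (cell_group X (Suc (Suc n)))"
  shows "boundary_hom X n (boundary_hom X (Suc n) z) = \<one>\<^bsub>cell_group X n\<^esub>"
proof -
  let ?A = "skel X (int n + 1)" and ?B = "skel X (int n)" and ?C = "skel X (int n + 2)"
  let ?S = "skeleton X (int n)" and ?S' = "skeleton X (int n - 1)" and ?U = "skeleton X (int n + 1)"
  define y where "y = hom_boundary (int n + 2) ?C ?U z"
  have CU: "subtopology ?C ?U = ?A" and AS: "subtopology ?A ?S = ?B"
    by (simp_all add: skel_skel)
  have idx: "int n + 2 - 1 = int n + 1" "int (Suc n) = int n + 1" "int n + 1 + 1 = int n + 2"
    "int n + 1 - 1 = int n"
    by simp_all
  have y: "y \<in> carrier (homology_group (int n + 1) ?A)"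
    using hom_boundary_carrier[of "int n + 2" ?C ?U z] unfolding y_def idx CU .
  have 1: "boundary_hom X (Suc n) z = hom_induced (int n + 1) ?A {} ?A ?S id y"
    by (simp only: boundary_hom_def hom_relboundary_def y_def idx CU o_apply)
  have 2: "boundary_hom X n w = hom_induced (int n) ?B {} ?B ?S' id (hom_boundary (int n + 1) ?A ?S w)" for w
    by (simp add: boundary_hom_def hom_relboundary_def AS)
  have "hom_induced (int n + 1) ?A {} ?A ?S id y
      \<in> kernel (relative_homology_group (int n + 1) ?A ?S) (homology_group (int n) ?B) (hom_boundary (int n + 1) ?A ?S)"
    using homology_exactness_axiom_1[of "int n + 1" ?A ?S] y by (simp add: AS)
  then have "hom_boundary (int n + 1) ?A ?S (hom_induced (int n + 1) ?A {} ?A ?S id y) = \<one>\<^bsub>homology_group (int n) ?B\<^esub>"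
    by (simp add: kernel_def)
  moreover have "hom_induced (int n) ?B {} ?B ?S' id \<one>\<^bsub>homology_group (int n) ?B\<^esub> = \<one>\<^bsub>cell_group X n\<^esub>"
    unfolding cell_group_def by (intro hom_one[OF hom_induced_hom]) auto
  ultimately show ?thesis
    by (simp only: 1 2)
qed

lemma cellular_mapD:
  assumes "cellular_map X Y f"
  shows "continuous_map (cw_space X) (cw_space Y) f" "f \<in> skeleton X p \<rightarrow> skeleton Y p"
    "continuous_map (skel X p) (skel Y p) f"
  using assms by (auto simp: cellular_map_def continuous_map_sub)

lemma boundary_hom_map_hom:
  assumes "cellular_map X Y f"
  shows "boundary_hom Y n (map_hom X Y f (Suc n) z) = map_hom X Y f n (boundary_hom X n z)"
  using fun_cong[OF naturality_hom_induced_relboundary[OF cellular_mapD(3)[OF assms] cellular_mapD(2)[OF assms] cellular_mapD(2)[OF assms],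
        of "int n + 1" "int n + 1" "int n" "int n - 1"], of z]
  by (simp add: boundary_hom_def map_hom_def skel_skel o_def add.commute)

lemma map_hom_compose:
  assumes "cellular_map X Y f" "cellular_map Y Z g"
  shows "map_hom Y Z g n (map_hom X Y f n z) = map_hom X Z (g \<circ> f) n z"
  unfolding map_hom_def
  by (intro hom_induced_compose' cellular_mapD assms)

lemma map_hom_cong:
  assumes "\<And>x. x \<in> topspace (cw_space X) \<Longrightarrow> f x = g x"
  shows "map_hom X Y f n = map_hom X Y g n"
  unfolding map_hom_def by (rule hom_induced_eq) (use assms in auto)

lemma map_hom_id:
  assumes "z \<in> carrier (cell_group X n)"
  shows "map_hom X X id n z = z"
  using assms unfolding map_hom_def cell_group_def by (rule hom_induced_id)

section \<open>Matrix identities and locality of the coefficients\<close>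

context regular_complex
begin

lemma cell_coords_hom_image:
  assumes "regular_complex Y" "h \<in> hom (cell_group X n) (cell_group Y m)" "z \<in> carrier (cell_group X n)"
  shows "cell_coords Y m (h z) y
    = (\<Sum>e\<in>cells_of_dim X n. cell_coords X n z e * cell_coords Y m (h (cell_class X e)) y)"
proof -
  interpret Y: regular_complex Y by fact
  show ?thesis
    unfolding cell_coords_eq Y.cell_coords_eq
    by (rule int_coords_hom_image[OF cell_basis Y.cell_basis assms(2,3)])
qed

lemma cell_coords_cell_class:
  assumes "e \<in> cells_of_dim X n"
  shows "cell_coords X n (cell_class X e) = (\<lambda>e'. if e' = e then 1 else 0)"
  unfolding cell_coords_eq by (rule int_coords_basis[OF cell_basis assms])

lemma cell_coords_outside:
  assumes "z \<in> carrier (cell_group X n)" "e \<notin> cells_of_dim X n"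
  shows "cell_coords X n z e = 0"
  unfolding cell_coords_eq by (rule int_coords(1)[OF cell_basis assms])

lemma incidence_incidence:
  assumes "e \<in> cells_of_dim X (Suc (Suc n))"
  shows "(\<Sum>e'\<in>cells_of_dim X (Suc n). incidence X (Suc n) e e' * incidence X n e' e'') = 0"
proof -
  have car: "boundary_hom X (Suc n) (cell_class X e) \<in> carrier (cell_group X (Suc n))"
    using boundary_hom[of X "Suc n"] cell_class_carrier[OF assms] by (auto simp: hom_def)
  have "(\<Sum>e'\<in>cells_of_dim X (Suc n). incidence X (Suc n) e e' * incidence X n e' e'')
      = cell_coords X n (boundary_hom X n (boundary_hom X (Suc n) (cell_class X e))) e''"
    unfolding incidence_eq
    by (rule cell_coords_hom_image[OF regular_complex_axioms boundary_hom car, symmetric])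
  also have "\<dots> = cell_coords X n \<one>\<^bsub>cell_group X n\<^esub> e''"
    using boundary_hom_boundary_hom[OF cell_class_carrier[OF assms]] by simp
  also have "\<dots> = 0"
    using hom_one[OF int_coords_hom[OF cell_basis], of n e''] by (simp add: cell_coords_eq)
  finally show ?thesis .
qed

lemma map_coeff_incidence:
  assumes "regular_complex Y" "cellular_map X Y f" "e \<in> cells_of_dim X (Suc n)"
  shows "(\<Sum>e'\<in>cells_of_dim X n. incidence X n e e' * map_coeff X Y f n e' y)
    = (\<Sum>y'\<in>cells_of_dim Y (Suc n). map_coeff X Y f (Suc n) e y' * incidence Y n y' y)"
proof -
  interpret Y: regular_complex Y by fact
  have car: "boundary_hom X n (cell_class X e) \<in> carrier (cell_group X n)"
    "map_hom X Y f (Suc n) (cell_class X e) \<in> carrier (cell_group Y (Suc n))"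
    using boundary_hom[of X n] map_hom[of X Y f "Suc n"] cell_class_carrier[OF assms(3)] by (auto simp: hom_def)
  show ?thesis
    unfolding incidence_eq map_coeff_eq
    unfolding cell_coords_hom_image[OF assms(1) map_hom car(1), symmetric]
      Y.cell_coords_hom_image[OF Y.regular_complex_axioms boundary_hom car(2), symmetric]
      boundary_hom_map_hom[OF assms(2)] by (rule refl)
qed

lemma map_coeff_compose:
  assumes "regular_complex Y" "regular_complex Z" "cellular_map X Y f" "cellular_map Y Z g"
    "e \<in> cells_of_dim X n"
  shows "map_coeff X Z (g \<circ> f) n e z
    = (\<Sum>y\<in>cells_of_dim Y n. map_coeff X Y f n e y * map_coeff Y Z g n y z)"
proof -
  interpret Y: regular_complex Y by fact
  have car: "map_hom X Y f n (cell_class X e) \<in> carrier (cell_group Y n)"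
    using map_hom[of X Y f n] cell_class_carrier[OF assms(5)] by (auto simp: hom_def)
  show ?thesis
    unfolding map_coeff_eq Y.cell_coords_hom_image[OF assms(2) map_hom car, symmetric]
      map_hom_compose[OF assms(3,4)] by (rule refl)
qed

lemma map_coeff_id:
  assumes "e \<in> cells_of_dim X n" "\<And>x. x \<in> topspace (cw_space X) \<Longrightarrow> f x = x"
  shows "map_coeff X X f n e e' = (if e' = e then 1 else 0)"
proof -
  have "map_hom X X f n = map_hom X X id n"
    by (rule map_hom_cong) (use assms(2) in simp)
  then show ?thesis
    using assms(1) by (simp add: map_coeff_eq map_hom_id cell_class_carrier cell_coords_cell_class)
qed

lemma incidence_outside:
  assumes "e \<in> cells_of_dim X (Suc n)" "e' \<notin> cells_of_dim X n"
  shows "incidence X n e e' = 0"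
  using boundary_hom[of X n] cell_class_carrier[OF assms(1)] assms(2)
  by (auto simp: incidence_eq hom_def intro: cell_coords_outside)

lemma map_coeff_outside:
  assumes "regular_complex Y" "e \<in> cells_of_dim X n" "y \<notin> cells_of_dim Y n"
  shows "map_coeff X Y f n e y = 0"
  using map_hom[of X Y f n] cell_class_carrier[OF assms(2)] assms(3)
  by (auto simp: map_coeff_eq hom_def intro: regular_complex.cell_coords_outside[OF assms(1)])

text \<open>By naturality the boundary class comes from the boundary of the closed cell, which is
  compact. A point of \<open>e'\<close> outside the closed cell is missed by it, and then
  \<open>cell_coords_compact_image\<close> makes the coefficient 0.\<close>

lemma incidence_local:
  assumes e: "e \<in> cells_of_dim X (Suc n)" and nz: "incidence X n e e' \<noteq> 0"
  shows "e' \<subseteq> closed_cell X e"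
proof
  fix x assume x: "x \<in> e'"
  show "x \<in> closed_cell X e"
  proof (rule ccontr)
    assume nx: "x \<notin> closed_cell X e"
    have dim: "e \<in> cells X" "cell_dim X e = Suc n"
      using e by (auto simp: cells_of_dim_def)
    have e': "e' \<in> cells_of_dim X n"
      using incidence_outside[OF e] nz by blast
    let ?C = "cell_top X e" and ?B = "closed_cell X e - e"
    have bd: "?B \<subseteq> skeleton X (int n)"
      using closed_cell_subset_Un(2)[OF e] by simp
    have sk: "closed_cell X e \<subseteq> skeleton X (int n + 1)"
      using closed_cell_subset_skeleton[OF dim(1)] dim(2) by (simp add: add.commute)
    have cont: "continuous_map ?C (skel X (int n + 1)) id"
      using sk by (auto simp: continuous_map_sub)
    \<comment> \<open>The third space of the triple is empty on the side of the closed cell, so the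
      class comes from the absolute homology of the boundary of the cell.\<close>
    have "boundary_hom X n (cell_class X e) = (hom_relboundary (int n + 1) (skel X (int n + 1)) (skeleton X (int n)) (skeleton X (int n - 1))
        \<circ> hom_induced (int n + 1) ?C ?B (skel X (int n + 1)) (skeleton X (int n)) id) (orientation X e)"
      by (simp add: boundary_hom_def cell_class_def Let_def dim(2) add.commute)
    also have "\<dots> = (hom_induced (int n + 1 - 1) (subtopology ?C ?B) {} (subtopology (skel X (int n + 1)) (skeleton X (int n)))
        (skeleton X (int n - 1)) id \<circ> hom_relboundary (int n + 1) ?C ?B {}) (orientation X e)"
      by (subst naturality_hom_induced_relboundary[OF cont]) (use bd in auto)
    also have "\<dots> = hom_induced (int n) (subtopology ?C ?B) {} (skel X (int n)) (skeleton X (int n - 1)) id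
        (hom_relboundary (int n + 1) ?C ?B {} (orientation X e))"
      by (simp add: skel_skel)
    finally have eq: "boundary_hom X n (cell_class X e) = \<dots>" .
    have "closedin ?C (closed_cell X e \<inter> skeleton X (int n))"
      using closedin_skeleton[of n] by (simp add: closedin_subtopology_Int_closed)
    moreover have "closed_cell X e \<inter> skeleton X (int n) = ?B"
      using bd cell_disjoint_skeleton[OF dim(1), of "int n"] dim(2) by auto
    ultimately have "closedin ?C ?B" by simp
    moreover have "compact_space ?C"
      using compactin_closed_cell[OF dim(1)] by (simp add: compactin_subspace)
    ultimately have "compact_space (subtopology ?C ?B)"
      using closedin_compact_space compactin_subspace by blast
    moreover have "continuous_map (subtopology ?C ?B) (skel X (int n)) id"
      using bd by (auto simp: continuous_map_sub)
    ultimately have "cell_coords X n (boundary_hom X n (cell_class X e)) e' = 0"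
      unfolding eq using nx by (intro cell_coords_compact_image[OF e' x]) auto
    then show False
      using nz by (simp add: incidence_eq)
  qed
qed

text \<open>The image class is carried by the compact image of the closed cell, which continuity
  places inside the closure of the image of \<open>e\<close>.\<close>

lemma map_coeff_local:
  assumes "regular_complex Y" "cellular_map X Y f" and e: "e \<in> cells_of_dim X n"
    and nz: "map_coeff X Y f n e y \<noteq> 0"
  shows "y \<subseteq> cw_space Y closure_of (f ` e)"
proof
  interpret Y: regular_complex Y by fact
  fix x assume x: "x \<in> y"
  show "x \<in> cw_space Y closure_of (f ` e)"
  proof (rule ccontr)
    assume nx: "x \<notin> cw_space Y closure_of (f ` e)"
    have dim: "e \<in> cells X" "cell_dim X e = n"
      using e by (auto simp: cells_of_dim_def)
    have y: "y \<in> cells_of_dim Y n"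
      using map_coeff_outside[OF assms(1) e] nz by blast
    let ?C = "cell_top X e" and ?B = "closed_cell X e - e"
    have bd: "?B \<subseteq> skeleton X (int n - 1)"
      using closed_cell_subset_Un(2)[OF e] by simp
    have sk: "closed_cell X e \<subseteq> skeleton X (int n)"
      using closed_cell_subset_skeleton[OF dim(1)] dim(2) by simp
    have cont: "continuous_map ?C (skel X (int n)) id"
      using sk by (auto simp: continuous_map_sub)
    have eq: "map_hom X Y f n (cell_class X e)
        = hom_induced (int n) ?C ?B (skel Y (int n)) (skeleton Y (int n - 1)) (f \<circ> id) (orientation X e)"
      unfolding map_hom_def cell_class_def Let_def dim(2)
      using cont bd by (intro hom_induced_compose' cellular_mapD[OF assms(2)]) auto
    have "compact_space ?C"
      using compactin_closed_cell[OF dim(1)] by (simp add: compactin_subspace)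
    moreover have "continuous_map ?C (skel Y (int n)) (f \<circ> id)"
      using cont cellular_mapD(3)[OF assms(2)] by (rule continuous_map_compose)
    moreover have "f \<circ> id \<in> ?B \<rightarrow> skeleton Y (int n - 1)"
      using bd cellular_mapD(2)[OF assms(2), of "int n - 1"] by auto
    moreover have "f ` closed_cell X e \<subseteq> cw_space Y closure_of (f ` e)"
      unfolding closed_cell_def using cellular_mapD(1)[OF assms(2)] continuous_map_image_closure_subset by blast
    then have "x \<notin> (f \<circ> id) ` topspace ?C"
      using nx by auto
    ultimately have "cell_coords Y n (map_hom X Y f n (cell_class X e)) y = 0"
      unfolding eq by (intro Y.cell_coords_compact_image[OF y x])
    then show False
      using nz by (simp add: map_coeff_eq)
  qed
qed

end

section \<open>Subcomplexes\<close>

lemma sub_cw_simps [simp]: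
  "cw_space (sub_cw X A) = subtopology (cw_space X) A"
  "cells (sub_cw X A) = cells_in X A"
  "cell_dim (sub_cw X A) = cell_dim X"
  by (simp_all add: sub_cw_def)

lemma cells_of_dim_sub_cw: "cells_of_dim (sub_cw X A) n = {e \<in> cells_of_dim X n. e \<subseteq> A}"
  by (auto simp: cells_of_dim_def cells_in_def)

locale regular_subcomplex = regular_complex +
  fixes A :: "'a set"
  assumes subcomplex: "subcomplex X A"
begin

lemma A_closed: "closedin (cw_space X) A"
  using subcomplex by (simp add: subcomplex_def)

lemma Union_cells_in: "\<Union>(cells_in X A) = A"
  using subcomplex by (auto simp: subcomplex_def cells_in_def)

lemma skeleton_sub_cw: "skeleton (sub_cw X A) p = A \<inter> skeleton X p"
proof
  show "A \<inter> skeleton X p \<subseteq> skeleton (sub_cw X A) p"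
  proof
    fix x assume x: "x \<in> A \<inter> skeleton X p"
    then obtain e where e: "e \<in> cells X" "int (cell_dim X e) \<le> p" "x \<in> e"
      by (auto simp: skeleton_def)
    obtain e' where e': "e' \<in> cells_in X A" "x \<in> e'"
      using x Union_cells_in by blast
    then have "e = e'"
      using e cell_eqI by (auto simp: cells_in_def)
    then show "x \<in> skeleton (sub_cw X A) p"
      using e e' by (auto simp: skeleton_def)
  qed
qed (auto simp: skeleton_def cells_in_def)

lemma closed_cell_subset:
  assumes "e \<subseteq> A"
  shows "closed_cell X e \<subseteq> A"
  unfolding closed_cell_def using assms A_closed by (rule closure_of_minimal)

lemma closed_cell_sub_cw:
  assumes "e \<subseteq> A"
  shows "closed_cell (sub_cw X A) e = closed_cell X e"
  using closed_cell_subset[OF assms] assms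
  by (simp add: closed_cell_def closure_of_subtopology inf.absorb2)

lemma topspace_sub_cw: "topspace (subtopology (cw_space X) A) = A"
  using closedin_subset[OF A_closed] by (simp add: inf.absorb2)

lemma regular_complex_sub_cw: "regular_complex (sub_cw X A)"
proof
  have "\<exists>\<phi>. characteristic_map (sub_cw X A) e \<phi>" if e: "e \<in> cells_in X A" for e
  proof -
    have eX: "e \<in> cells X" "e \<subseteq> A"
      using e by (auto simp: cells_in_def)
    obtain \<phi> where \<phi>: "characteristic_map X e \<phi>"
      using characteristic_map_exists[OF eX(1)] by blast
    have "\<phi> ` disc_set (cell_dim X e) \<subseteq> A"
      using closed_cell_eq(1)[OF eX(1) \<phi>] closed_cell_subset[OF eX(2)] by simp
    moreover have "disc_boundary (cell_dim X e) \<subseteq> disc_set (cell_dim X e)"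
      by (auto simp: disc_boundary_eq)
    ultimately show ?thesis
      using \<phi> unfolding characteristic_map_def
      by (intro exI[of _ \<phi>]) (auto simp: skeleton_sub_cw embedding_map_in_subtopology)
  qed
  moreover have "pairwise disjnt (cells_in X A)"
    using disjoint_cells by (rule pairwise_subset) (auto simp: cells_in_def)
  moreover have "finite (cells_in X A)"
    using finite_cells by (simp add: cells_in_def)
  ultimately show "finite_regular_cw (sub_cw X A)"
    unfolding finite_regular_cw_def characteristic_map_def[symmetric]
    using Hausdorff Union_cells_in topspace_sub_cw
    by (simp add: Hausdorff_space_subtopology del: topspace_subtopology)
qed

lemma cellular_map_inclusion: "cellular_map (sub_cw X A) X id"
  by (auto simp: cellular_map_def skeleton_sub_cw continuous_map_from_subtopology)

text \<open>The choice of an orientation refers only to the closed cell and its boundary as a pair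
  of spaces. This pair is the same in the subcomplex, so both choices are literally equal.\<close>

lemma orientation_sub_cw:
  assumes "e \<subseteq> A"
  shows "orientation (sub_cw X A) e = orientation X e"
proof -
  have "subtopology (subtopology (cw_space X) A) (closed_cell X e) = cell_top X e"
    using closed_cell_subset[OF assms] by (simp add: subtopology_subtopology inf.absorb2)
  then show ?thesis
    by (simp add: orientation_def closed_cell_sub_cw[OF assms])
qed

lemma map_hom_inclusion:
  assumes "e \<in> cells_of_dim (sub_cw X A) n"
  shows "map_hom (sub_cw X A) X id n (cell_class (sub_cw X A) e) = cell_class X e"
proof -
  interpret S: regular_complex "sub_cw X A" by (rule regular_complex_sub_cw)
  have eA: "e \<subseteq> A" and eS: "e \<in> cells (sub_cw X A)" and dim: "cell_dim X e = n"
    using assms by (auto simp: cells_of_dim_def cells_in_def)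
  let ?C = "cell_top X e"
  have top: "subtopology (subtopology (cw_space X) A) (closed_cell X e) = ?C"
    using closed_cell_subset[OF eA] by (simp add: subtopology_subtopology inf.absorb2)
  have cls: "cell_class (sub_cw X A) e = hom_induced (int n) ?C (closed_cell X e - e)
      (skel (sub_cw X A) (int n)) (skeleton (sub_cw X A) (int n - 1)) id (orientation X e)"
    by (simp add: cell_class_def Let_def closed_cell_sub_cw[OF eA] orientation_sub_cw[OF eA] dim top)
  have cont: "continuous_map ?C (skel (sub_cw X A) (int n)) id"
    using S.closed_cell_subset_skeleton[OF eS] closed_cell_subset[OF eA] dim
    by (auto simp: closed_cell_sub_cw[OF eA] continuous_map_sub)
  have sub: "closed_cell X e - e \<subseteq> skeleton (sub_cw X A) (int n - 1)"
    using S.boundary_subset_skeleton[OF eS] dim by (simp add: closed_cell_sub_cw[OF eA])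
  have "map_hom (sub_cw X A) X id n (cell_class (sub_cw X A) e)
      = hom_induced (int n) ?C (closed_cell X e - e) (skel X (int n)) (skeleton X (int n - 1)) id (orientation X e)"
    unfolding map_hom_def cls
    by (rule hom_induced_id_compose[OF cont sub])
      (use cellular_mapD[OF cellular_map_inclusion] in \<open>auto simp: skeleton_sub_cw\<close>)
  then show ?thesis
    by (simp add: cell_class_def Let_def dim)
qed

lemma map_coeff_inclusion:
  assumes "e \<in> cells_of_dim (sub_cw X A) n"
  shows "map_coeff (sub_cw X A) X id n e y = (if y = e then 1 else 0)"
  unfolding map_coeff_eq map_hom_inclusion[OF assms]
  using cell_coords_cell_class[of e n] assms by (simp add: cells_of_dim_sub_cw)

text \<open>The inclusion is cellular and, with equal orientations, has the identity as its matrix;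
  commuting with the boundary then identifies the coefficients.\<close>

lemma incidence_sub_cw:
  assumes e: "e \<in> cells_of_dim (sub_cw X A) (Suc n)"
  shows "incidence (sub_cw X A) n e y = incidence X n e y"
proof -
  interpret S: regular_complex "sub_cw X A" by (rule regular_complex_sub_cw)
  have eX: "e \<in> cells_of_dim X (Suc n)"
    using e by (simp add: cells_of_dim_sub_cw)
  have "(\<Sum>e'\<in>cells_of_dim (sub_cw X A) n. incidence (sub_cw X A) n e e' * map_coeff (sub_cw X A) X id n e' y)
      = (\<Sum>e'\<in>cells_of_dim (sub_cw X A) n. if e' = y then incidence (sub_cw X A) n e e' else 0)"
    by (rule sum.cong) (auto simp: map_coeff_inclusion)
  also have "\<dots> = incidence (sub_cw X A) n e y"
    using S.incidence_outside[OF e, of y] S.finite_cells_of_dim by (simp add: sum.delta)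
  finally have "incidence (sub_cw X A) n e y
      = (\<Sum>y'\<in>cells_of_dim X (Suc n). map_coeff (sub_cw X A) X id (Suc n) e y' * incidence X n y' y)"
    using S.map_coeff_incidence[OF regular_complex_axioms cellular_map_inclusion e, of y] by simp
  also have "\<dots> = (\<Sum>y'\<in>cells_of_dim X (Suc n). if y' = e then incidence X n y' y else 0)"
    by (rule sum.cong) (auto simp: map_coeff_inclusion[OF e])
  also have "\<dots> = incidence X n e y"
    using eX finite_cells_of_dim by (simp add: sum.delta)
  finally show ?thesis .
qed

text \<open>A cell of least dimension works: in positive dimension its boundary sphere is nonempty
  and lies in cells of smaller dimension of the same subcomplex.\<close>

lemma vertex_exists:
  assumes "A \<noteq> {}"
  obtains e where "e \<in> cells_of_dim X 0" "e \<subseteq> A"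
proof -
  interpret S: regular_complex "sub_cw X A" by (rule regular_complex_sub_cw)
  have "\<exists>e. e \<in> cells_in X A"
    using assms Union_cells_in by auto
  then obtain e where e: "e \<in> cells_in X A" "\<And>e'. e' \<in> cells_in X A \<Longrightarrow> cell_dim X e \<le> cell_dim X e'"
    using ex_has_least_nat[of "\<lambda>e. e \<in> cells_in X A" _ "cell_dim X"] by blast
  have "cell_dim X e = 0"
  proof (rule ccontr)
    assume "cell_dim X e \<noteq> 0"
    then obtain m where m: "cell_dim X e = Suc m"
      using not0_implies_Suc by blast
    obtain \<phi> where \<phi>: "characteristic_map (sub_cw X A) e \<phi>"
      using S.characteristic_map_exists[of e] e(1) by auto
    have "disc_boundary (Suc m) \<noteq> {}"
    proof -
      have "topspace (nsphere m) \<noteq> {}"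
        using in_topspace_nsphere by blast
      then show ?thesis
        by (metis disc_boundary_nsphere inf_bot_right topspace_subtopology)
    qed
    then obtain x where x: "x \<in> disc_boundary (Suc m)"
      by blast
    then have "\<phi> x \<in> skeleton (sub_cw X A) (int m)"
      using \<phi> m unfolding characteristic_map_def by auto
    then obtain e' where "e' \<in> cells_in X A" "cell_dim X e' \<le> m"
      by (auto simp: skeleton_def)
    then show False
      using e(2) m by fastforce
  qed
  then show ?thesis
    using that e(1) by (auto simp: cells_in_def cells_of_dim_def)
qed

end

section \<open>Augmentation\<close>

abbreviation point_space :: "unit topology" where
  "point_space \<equiv> discrete_topology {()}"

text \<open>One isomorphism is fixed for all complexes, so that augmentations of different complexes
  can be compared.\<close>

definition point_iso :: "unit chain set \<Rightarrow> int" where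
  "point_iso = (SOME f. f \<in> iso (homology_group 0 point_space) integer_group)"

abbreviation to_point :: "'a topology \<Rightarrow> 'a chain set \<Rightarrow> unit chain set" where
  "to_point X \<equiv> hom_induced 0 X {} point_space {} (\<lambda>x. ())"

text \<open>The sign of a vertex compares its orientation with a fixed generator of the homology of a point.\<close>

definition augmentation_hom :: "'a cw \<Rightarrow> 'a chain set \<Rightarrow> int" where
  "augmentation_hom X z = point_iso (to_point (skel X 0) z)"

definition vertex_sign :: "'a cw \<Rightarrow> 'a set \<Rightarrow> int" where
  "vertex_sign X e = augmentation_hom X (cell_class X e)"

lemma point_iso: "point_iso \<in> iso (homology_group 0 point_space) integer_group"
proof -
  have "homology_group 0 point_space \<cong> integer_group"
    by (rule homology_coefficients) simp
  then have "\<exists>f. f \<in> iso (homology_group 0 point_space) integer_group"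
    unfolding is_iso_def by blast
  then show ?thesis
    unfolding point_iso_def by (rule someI_ex)
qed

lemma point_iso_hom: "point_iso \<in> hom (homology_group 0 point_space) integer_group"
  using point_iso by (simp add: iso_def)

lemma skeleton_empty: "skeleton X (-1) = {}"
  by (auto simp: skeleton_def)

lemma cell_group_0: "cell_group X 0 = homology_group 0 (skel X 0)"
  by (simp add: cell_group_def skeleton_empty)

lemma augmentation_hom: "augmentation_hom X \<in> hom (cell_group X 0) integer_group"
proof -
  have "point_iso \<circ> to_point (skel X 0)
      \<in> hom (cell_group X 0) integer_group"
    unfolding cell_group_0 by (rule hom_compose[OF hom_induced_hom point_iso_hom])
  moreover have "augmentation_hom X = point_iso \<circ> to_point (skel X 0)"
    by (auto simp: augmentation_hom_def)
  ultimately show ?thesis by simp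
qed

lemma augmentation_hom_map_hom:
  assumes "cellular_map X Y f"
  shows "augmentation_hom Y (map_hom X Y f 0 z) = augmentation_hom X z"
proof -
  have "to_point (skel Y 0) (hom_induced 0 (skel X 0) {} (skel Y 0) {} f z)
      = hom_induced 0 (skel X 0) {} point_space {} ((\<lambda>x. ()) \<circ> f) z"
    by (rule hom_induced_compose') (use cellular_mapD(3)[OF assms, of 0] in auto)
  then show ?thesis
    by (simp add: augmentation_hom_def map_hom_def skeleton_empty o_def)
qed

text \<open>The map to a point extends over the 1-skeleton, and there a boundary is trivial by
  exactness.\<close>

lemma augmentation_hom_boundary_hom:
  assumes "z \<in> carrier (cell_group X (Suc 0))"
  shows "augmentation_hom X (boundary_hom X 0 z) = 0"
proof -
  let ?A = "skel X 1" and ?B = "skel X 0" and ?P = "point_space"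
  define y where "y = hom_boundary 1 ?A (skeleton X 0) z"
  have AB: "subtopology ?A (skeleton X 0) = ?B"
    by (simp add: skel_skel)
  have yB: "y \<in> carrier (homology_group 0 ?B)"
    using hom_boundary_carrier[of 1 ?A "skeleton X 0" z] by (simp add: y_def AB)
  have "boundary_hom X 0 z = hom_induced 0 ?B {} ?B {} id y"
    by (simp add: boundary_hom_def hom_relboundary_def skeleton_empty y_def AB)
  then have bd: "boundary_hom X 0 z = y"
    using yB by (simp add: hom_induced_id)
  have "z \<in> carrier (relative_homology_group 1 ?A (skeleton X 0))"
    using assms by (simp add: cell_group_def)
  then have "y \<in> kernel (homology_group 0 ?B) (homology_group 0 ?A) (hom_induced 0 ?B {} ?A {} id)"
    using homology_exactness_axiom_2[of 1 ?A "skeleton X 0"] by (simp add: AB y_def)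
  then have "hom_induced 0 ?B {} ?A {} id y = \<one>\<^bsub>homology_group 0 ?A\<^esub>"
    by (simp add: kernel_def)
  moreover have "to_point ?A (hom_induced 0 ?B {} ?A {} id y)
      = hom_induced 0 ?B {} ?P {} ((\<lambda>x. ()) \<circ> id) y"
    by (rule hom_induced_compose')
      (auto simp: skeleton_def continuous_map_sub)
  moreover have "to_point ?A \<one>\<^bsub>homology_group 0 ?A\<^esub> = \<one>\<^bsub>homology_group 0 ?P\<^esub>"
    by (rule hom_one[OF hom_induced_hom]) auto
  ultimately have "to_point ?B y = \<one>\<^bsub>homology_group 0 ?P\<^esub>"
    by (simp add: o_def)
  then show ?thesis
    using hom_one[OF point_iso_hom] by (simp add: augmentation_hom_def bd)
qed

context regular_complex
begin

text \<open>A closed 0-cell is a single point, so its orientation is sent to a generator of the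
  integers, that is, to a divisor of 1.\<close>

lemma abs_vertex_sign:
  assumes "e \<in> cells_of_dim X 0"
  shows "\<bar>vertex_sign X e\<bar> = 1"
proof -
  let ?P = "point_space" and ?C = "cell_top X e"
  have e: "e \<in> cells X" "cell_dim X e = 0"
    using assms by (auto simp: cells_of_dim_def)
  obtain \<phi> where \<phi>: "characteristic_map X e \<phi>"
    using characteristic_map_exists e by blast
  have cc: "closed_cell X e = {\<phi> (\<lambda>i. 0)}" "closed_cell X e - e = {}"
    using closed_cell_eq[OF e(1) \<phi>] e(2) by (simp_all add: disc_set_0 disc_boundary_0)
  have top: "topspace ?C = {\<phi> (\<lambda>i. 0)}"
    using closed_cell_subset_topspace[of e] cc(1) by auto
  have "compact_space ?C"
    using compactin_closed_cell[OF e(1)] by (simp add: compactin_subspace)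
  then have "homeomorphic_map ?C ?P (\<lambda>x. ())"
    by (rule continuous_imp_homeomorphic_map[rotated])
      (simp_all only: top, simp_all add: Hausdorff_space_discrete_topology)
  then have "to_point ?C \<in> iso (homology_group 0 ?C) (homology_group 0 ?P)"
    by (rule homeomorphic_map_homology_iso)
  then have iso: "point_iso \<circ> to_point ?C \<in> iso (homology_group 0 ?C) integer_group"
    using point_iso by (rule iso_set_trans)
  have "infinite_generator (homology_group 0 ?C) (orientation X e)"
    using infinite_generator_orientation[OF e(1)] unfolding e(2) cc(2) by simp
  then have gen: "infinite_generator integer_group ((point_iso \<circ> to_point ?C) (orientation X e))"
    using iso by (rule infinite_generator_iso) auto
  have cont: "continuous_map ?C (skel X 0) id"
    using closed_cell_subset_skeleton[OF e(1)] e(2)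
    by (auto simp: continuous_map_sub)
  have "to_point (skel X 0) (hom_induced 0 ?C {} (skel X 0) {} id (orientation X e))
      = hom_induced 0 ?C {} ?P {} ((\<lambda>x. ()) \<circ> id) (orientation X e)"
    by (rule hom_induced_compose') (use cont in auto)
  moreover have "cell_class X e = hom_induced 0 ?C {} (skel X 0) {} id (orientation X e)"
    unfolding cell_class_def Let_def e(2) cc(2) by (simp add: skeleton_empty)
  ultimately have "(point_iso \<circ> to_point ?C) (orientation X e) = vertex_sign X e"
    by (simp add: vertex_sign_def augmentation_hom_def o_def)
  with gen have "\<forall>x \<in> carrier integer_group. \<exists>!k::int. x = vertex_sign X e [^]\<^bsub>integer_group\<^esub> k"
    unfolding infinite_generator_def by metis
  then have "\<exists>!k::int. 1 = vertex_sign X e [^]\<^bsub>integer_group\<^esub> k"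
    by (rule bspec) simp
  then obtain k :: int where "1 = vertex_sign X e [^]\<^bsub>integer_group\<^esub> k"
    by (rule ex1E)
  then have "1 = vertex_sign X e * k"
    by (simp only: group_int_pow_integer_group mult.commute)
  then have "vertex_sign X e dvd 1"
    by (rule dvdI)
  then show ?thesis
    by (simp only: zdvd1_eq)
qed

lemma sum_incidence_vertex_sign:
  assumes "e \<in> cells_of_dim X (Suc 0)"
  shows "(\<Sum>e'\<in>cells_of_dim X 0. incidence X 0 e e' * vertex_sign X e') = 0"
proof -
  have car: "boundary_hom X 0 (cell_class X e) \<in> carrier (cell_group X 0)"
    using boundary_hom[of X 0] cell_class_carrier[OF assms] by (auto simp: hom_def)
  have "augmentation_hom X (boundary_hom X 0 (cell_class X e))
      = (\<Sum>e'\<in>cells_of_dim X 0. incidence X 0 e e' * vertex_sign X e')"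
    unfolding incidence_eq vertex_sign_def cell_coords_eq
    by (rule hom_integer_group_coords[OF cell_basis augmentation_hom car])
  then show ?thesis
    using augmentation_hom_boundary_hom[OF cell_class_carrier[OF assms]] by simp
qed

lemma sum_map_coeff_vertex_sign:
  assumes "regular_complex Y" "cellular_map X Y f" "e \<in> cells_of_dim X 0"
  shows "(\<Sum>y\<in>cells_of_dim Y 0. map_coeff X Y f 0 e y * vertex_sign Y y) = vertex_sign X e"
proof -
  interpret Y: regular_complex Y by fact
  have car: "map_hom X Y f 0 (cell_class X e) \<in> carrier (cell_group Y 0)"
    using map_hom[of X Y f 0] cell_class_carrier[OF assms(3)] by (auto simp: hom_def)
  have "augmentation_hom Y (map_hom X Y f 0 (cell_class X e))
      = (\<Sum>y\<in>cells_of_dim Y 0. map_coeff X Y f 0 e y * vertex_sign Y y)"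
    unfolding map_coeff_eq vertex_sign_def Y.cell_coords_eq
    by (rule hom_integer_group_coords[OF Y.cell_basis augmentation_hom car])
  then show ?thesis
    by (simp add: augmentation_hom_map_hom[OF assms(2)] vertex_sign_def)
qed

end

section \<open>Chains with field coefficients\<close>

text \<open>The row \<open>m s\<close> is the image of the generator \<open>s\<close>. The type of
  the columns is arbitrary, so that the augmentation is the instance with a single column.\<close>

definition mat_app :: "'s set \<Rightarrow> ('s \<Rightarrow> 't \<Rightarrow> 'k::field) \<Rightarrow> ('s \<Rightarrow> 'k) \<Rightarrow> 't \<Rightarrow> 'k" where
  "mat_app S m c = (\<lambda>t. \<Sum>s\<in>S. c s * m s t)"

abbreviation cell_app :: "'a cw \<Rightarrow> nat \<Rightarrow> ('a set \<Rightarrow> 't \<Rightarrow> 'k::field) \<Rightarrow> ('a set \<Rightarrow> 'k) \<Rightarrow> 't \<Rightarrow> 'k" where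
  "cell_app X n \<equiv> mat_app (cells_of_dim X n)"

lemma mat_app_add: "mat_app S m (\<lambda>e. c e + d e) = (\<lambda>t. mat_app S m c t + mat_app S m d t)"
  by (simp add: mat_app_def algebra_simps sum.distrib)

lemma mat_app_diff: "mat_app S m (\<lambda>e. c e - d e) = (\<lambda>t. mat_app S m c t - mat_app S m d t)"
  by (simp add: mat_app_def algebra_simps sum_subtractf)

lemma mat_app_scale: "mat_app S m (\<lambda>e. a * c e) = (\<lambda>t. a * mat_app S m c t)"
  by (simp add: mat_app_def algebra_simps sum_distrib_left)

lemma mat_app_zero: "mat_app S m (\<lambda>e. 0) = (\<lambda>t. 0)"
  by (simp add: mat_app_def)

lemma mat_app_unit: "finite S \<Longrightarrow> e \<in> S \<Longrightarrow> mat_app S m (\<lambda>x. if x = e then 1 else 0) = m e"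
  by (simp add: mat_app_def if_distrib[of "\<lambda>x. x * _"] cong: if_cong)

lemma mat_app_mat_app:
  "mat_app T m' (mat_app S m c) = mat_app S (\<lambda>s. mat_app T m' (m s)) c"
  unfolding mat_app_def sum_distrib_left sum_distrib_right
  by (subst sum.swap) (simp add: mult.assoc)

lemma mat_app_row_diff: "mat_app S (\<lambda>s t. m s t - m' s t) c = (\<lambda>t. mat_app S m c t - mat_app S m' c t)"
  by (simp add: mat_app_def algebra_simps sum_subtractf)

lemma mat_app_cong: "(\<And>s. s \<in> S \<Longrightarrow> c s \<noteq> 0 \<Longrightarrow> m s = m' s) \<Longrightarrow> mat_app S m c = mat_app S m' c"
  unfolding mat_app_def by (intro ext sum.cong refl) (metis mult_zero_left)

lemma mat_app_nonzeroE:
  assumes "mat_app S m c t \<noteq> 0"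
  obtains s where "s \<in> S" "c s \<noteq> 0" "m s t \<noteq> 0"
  using assms unfolding mat_app_def by (metis (no_types, lifting) mult_eq_0_iff sum.neutral)

definition bd_row :: "'a cw \<Rightarrow> nat \<Rightarrow> 'a set \<Rightarrow> 'a set \<Rightarrow> 'k::field" where
  "bd_row X n e e' = of_int (incidence X n e e')"

definition map_row :: "'a cw \<Rightarrow> 'b cw \<Rightarrow> ('a \<Rightarrow> 'b) \<Rightarrow> nat \<Rightarrow> 'a set \<Rightarrow> 'b set \<Rightarrow> 'k::field" where
  "map_row X Y f n e e' = of_int (map_coeff X Y f n e e')"

lemma cell_boundary_eq: "cell_boundary X n = cell_app X (Suc n) (bd_row X n)"
  by (auto simp: cell_boundary_def mat_app_def bd_row_def)

lemma induced_chain_map_eq: "induced_chain_map X Y f n = cell_app X n (map_row X Y f n)"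
  by (auto simp: induced_chain_map_def mat_app_def map_row_def)

definition augment :: "'a cw \<Rightarrow> ('a set \<Rightarrow> 'k::field) \<Rightarrow> 'k" where
  "augment X c = (\<Sum>e\<in>cells_of_dim X 0. c e * of_int (vertex_sign X e))"

lemma augment_eq_mat_app: "augment X c = cell_app X 0 (\<lambda>e u. of_int (vertex_sign X e)) c ()"
  by (simp add: augment_def mat_app_def)

lemma augment_mat_app: "augment Y (mat_app S m c) = (\<Sum>s\<in>S. c s * augment Y (m s))"
  unfolding augment_eq_mat_app mat_app_mat_app by (simp add: mat_app_def)

lemma augment_diff: "augment X (\<lambda>e. c e - d e) = augment X c - augment X d"
  by (simp add: augment_eq_mat_app mat_app_diff)

lemma augment_scale: "augment X (\<lambda>e. a * c e) = a * augment X c"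
  by (simp add: augment_eq_mat_app mat_app_scale)

definition chains_in :: "'a cw \<Rightarrow> 'a set \<Rightarrow> nat \<Rightarrow> ('a set \<Rightarrow> 'k::field) set" where
  "chains_in X A n = {c. \<forall>e. c e \<noteq> 0 \<longrightarrow> e \<in> cells_of_dim X n \<and> e \<subseteq> A}"

lemma chains_in_mono: "A \<subseteq> B \<Longrightarrow> chains_in X A n \<subseteq> chains_in X B n"
  by (auto simp: chains_in_def)

lemma chains_in_diff:
  assumes "c \<in> chains_in X A n" "d \<in> chains_in X A n"
  shows "(\<lambda>e. c e - d e) \<in> chains_in X A n"
proof -
  have "c e \<noteq> 0 \<or> d e \<noteq> 0" if "c e - d e \<noteq> 0" for e
    using that by auto
  then show ?thesis
    using assms unfolding chains_in_def by blast
qed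

lemma chains_in_mat_app:
  assumes "\<And>s. \<lbrakk>s \<in> S; c s \<noteq> 0\<rbrakk> \<Longrightarrow> m s \<in> chains_in Y A n"
  shows "mat_app S m c \<in> chains_in Y A n"
  using assms by (auto simp: chains_in_def elim!: mat_app_nonzeroE)

lemma chains_in_unit: "e \<in> cells_of_dim X n \<Longrightarrow> e \<subseteq> A \<Longrightarrow> (\<lambda>x. if x = e then a else 0) \<in> chains_in X A n"
  by (simp add: chains_in_def)

lemma carrier_cell_chains: "c \<in> carrier (cell_chains X n) \<longleftrightarrow> (\<forall>e. e \<notin> cells_of_dim X n \<longrightarrow> c e = 0)"
  by (simp add: cell_chains_def)

context regular_complex
begin

lemma bd_row_local: "e \<in> cells_of_dim X (Suc n) \<Longrightarrow> bd_row X n e e' \<noteq> 0 \<Longrightarrow> e' \<subseteq> closed_cell X e"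
  by (rule incidence_local) (auto simp: bd_row_def)

lemma bd_row_bd_row:
  assumes "e \<in> cells_of_dim X (Suc (Suc n))"
  shows "cell_app X (Suc n) (bd_row X n) (bd_row X (Suc n) e) = (\<lambda>e. 0 :: 'k::field)"
proof
  fix y
  have "cell_app X (Suc n) (bd_row X n) (bd_row X (Suc n) e) y
      = of_int (\<Sum>e'\<in>cells_of_dim X (Suc n). incidence X (Suc n) e e' * incidence X n e' y)"
    by (simp add: mat_app_def bd_row_def)
  then show "cell_app X (Suc n) (bd_row X n) (bd_row X (Suc n) e) y = (0 :: 'k)"
    using incidence_incidence[OF assms] by simp
qed

lemma augment_bd_row:
  assumes "e \<in> cells_of_dim X (Suc 0)"
  shows "augment X (bd_row X 0 e) = (0 :: 'k::field)"
proof -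
  have "augment X (bd_row X 0 e) = (of_int (\<Sum>e'\<in>cells_of_dim X 0. incidence X 0 e e' * vertex_sign X e') :: 'k)"
    by (simp add: augment_def bd_row_def)
  then show ?thesis
    using sum_incidence_vertex_sign[OF assms] by simp
qed

lemma augment_cell_boundary: "augment X (cell_boundary X 0 c) = 0"
  unfolding cell_boundary_eq augment_mat_app by (simp add: augment_bd_row)

end

subsection \<open>Chain maps as matrices\<close>

text \<open>An augmentation-preserving chain map, given by its rows. Conditions are imposed on the
  rows of cells only, since \<open>cell_app\<close> reads no others.\<close>

definition chain_matrix :: "'a cw \<Rightarrow> 'b cw \<Rightarrow> (nat \<Rightarrow> 'a set \<Rightarrow> 'b set \<Rightarrow> 'k::field) \<Rightarrow> bool" where
  "chain_matrix X Y w \<longleftrightarrow>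
     (\<forall>n. \<forall>e\<in>cells_of_dim X n. \<forall>y. w n e y \<noteq> 0 \<longrightarrow> y \<in> cells_of_dim Y n) \<and>
     (\<forall>e\<in>cells_of_dim X 0. augment Y (w 0 e) = of_int (vertex_sign X e)) \<and>
     (\<forall>n. \<forall>e\<in>cells_of_dim X (Suc n).
        cell_boundary Y n (w (Suc n) e) = cell_app X n (w n) (bd_row X n e))"

definition carried :: "'a cw \<Rightarrow> ('a, 'b) carr \<Rightarrow> (nat \<Rightarrow> 'a set \<Rightarrow> 'b set \<Rightarrow> 'k::field) \<Rightarrow> bool" where
  "carried X F w \<longleftrightarrow> (\<forall>n. \<forall>e\<in>cells_of_dim X n. \<forall>y. w n e y \<noteq> 0 \<longrightarrow> y \<subseteq> F e)"

lemma chain_matrix_chains_in: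
  "\<lbrakk>chain_matrix X Y w; carried X F w; e \<in> cells_of_dim X n\<rbrakk> \<Longrightarrow> w n e \<in> chains_in Y (F e) n"
  by (auto simp: chain_matrix_def carried_def chains_in_def)

lemma chain_matrix_augment:
  assumes "chain_matrix X Y w"
  shows "augment Y (cell_app X 0 (w 0) c) = augment X c"
  using assms by (simp add: augment_mat_app augment_def[of X c] chain_matrix_def)

lemma chain_matrix_boundary:
  assumes "chain_matrix X Y w"
  shows "cell_boundary Y n (cell_app X (Suc n) (w (Suc n)) c)
    = cell_app X n (w n) (cell_boundary X n c)"
proof -
  have "cell_app X (Suc n) (\<lambda>e. cell_app Y (Suc n) (bd_row Y n) (w (Suc n) e)) c
      = cell_app X (Suc n) (\<lambda>e. cell_app X n (w n) (bd_row X n e)) c"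
    by (rule mat_app_cong) (use assms in \<open>auto simp: chain_matrix_def cell_boundary_eq\<close>)
  then show ?thesis
    by (simp add: cell_boundary_eq mat_app_mat_app)
qed

lemma chain_matrix_compose:
  assumes "chain_matrix X Y w" "chain_matrix Y Z v"
  shows "chain_matrix X Z (\<lambda>n e. cell_app Y n (v n) (w n e))"
  unfolding chain_matrix_def
proof (intro conjI allI ballI impI)
  fix n e y assume "e \<in> cells_of_dim X n" "cell_app Y n (v n) (w n e) y \<noteq> 0"
  then show "y \<in> cells_of_dim Z n"
    using assms(2) by (auto simp: chain_matrix_def elim!: mat_app_nonzeroE)
next
  fix e assume "e \<in> cells_of_dim X 0"
  then show "augment Z (cell_app Y 0 (v 0) (w 0 e)) = of_int (vertex_sign X e)"
    using assms(1) chain_matrix_augment[OF assms(2)] by (simp add: chain_matrix_def)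
next
  fix n e assume e: "e \<in> cells_of_dim X (Suc n)"
  have "cell_boundary Z n (cell_app Y (Suc n) (v (Suc n)) (w (Suc n) e))
      = cell_app Y n (v n) (cell_app X n (w n) (bd_row X n e))"
    using e assms(1) by (simp add: chain_matrix_boundary[OF assms(2)] chain_matrix_def)
  then show "cell_boundary Z n (cell_app Y (Suc n) (v (Suc n)) (w (Suc n) e))
      = cell_app X n (\<lambda>e. cell_app Y n (v n) (w n e)) (bd_row X n e)"
    by (simp add: mat_app_mat_app)
qed

lemma chain_matrix_map_row:
  assumes "regular_complex X" "regular_complex Y" "cellular_map X Y f"
  shows "chain_matrix X Y (map_row X Y f :: nat \<Rightarrow> 'a set \<Rightarrow> 'b set \<Rightarrow> 'k::field)"
  unfolding chain_matrix_def
proof (intro conjI allI ballI impI)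
  interpret X: regular_complex X by fact
  interpret Y: regular_complex Y by fact
  fix n e y assume "e \<in> cells_of_dim X n" "map_row X Y f n e y \<noteq> (0 :: 'k)"
  then show "y \<in> cells_of_dim Y n"
    using X.map_coeff_outside[OF assms(2)] by (fastforce simp: map_row_def)
next
  interpret X: regular_complex X by fact
  fix e assume e: "e \<in> cells_of_dim X 0"
  have "augment Y (map_row X Y f 0 e) = (of_int (\<Sum>y\<in>cells_of_dim Y 0. map_coeff X Y f 0 e y * vertex_sign Y y) :: 'k)"
    by (simp add: augment_def map_row_def)
  then show "augment Y (map_row X Y f 0 e) = (of_int (vertex_sign X e) :: 'k)"
    by (simp add: X.sum_map_coeff_vertex_sign[OF assms(2,3) e])
next
  interpret X: regular_complex X by fact
  fix n e assume e: "e \<in> cells_of_dim X (Suc n)"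
  show "cell_boundary Y n (map_row X Y f (Suc n) e) = (cell_app X n (map_row X Y f n) (bd_row X n e) :: 'b set \<Rightarrow> 'k)"
  proof
    fix y
    have "cell_boundary Y n (map_row X Y f (Suc n) e) y
        = (of_int (\<Sum>y'\<in>cells_of_dim Y (Suc n). map_coeff X Y f (Suc n) e y' * incidence Y n y' y) :: 'k)"
      by (simp add: cell_boundary_def map_row_def)
    also have "\<dots> = of_int (\<Sum>e'\<in>cells_of_dim X n. incidence X n e e' * map_coeff X Y f n e' y)"
      using X.map_coeff_incidence[OF assms(2,3) e] by simp
    also have "\<dots> = cell_app X n (map_row X Y f n) (bd_row X n e) y"
      by (simp add: mat_app_def map_row_def bd_row_def)
    finally show "cell_boundary Y n (map_row X Y f (Suc n) e) y
        = (cell_app X n (map_row X Y f n) (bd_row X n e) y :: 'k)" .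
  qed
qed

subsection \<open>Homology as a quotient\<close>

abbreviation hclass :: "'a cw \<Rightarrow> nat \<Rightarrow> ('a set \<Rightarrow> 'k::field) \<Rightarrow> ('a set \<Rightarrow> 'k) set" where
  "hclass X n z \<equiv> cell_boundaries X n +>\<^bsub>cell_chains X n\<^esub> z"

lemma hclass_eq: "hclass X n z = {\<lambda>e. b e + z e | b. b \<in> cell_boundaries X n}"
  by (auto simp: a_r_coset_def r_coset_def cell_chains_def)

lemma boundaries_zero: "(\<lambda>e. 0) \<in> (cell_boundaries X n :: ('a set \<Rightarrow> 'k::field) set)"
proof -
  have "cell_boundary X n (\<lambda>e. 0) = (\<lambda>e. 0 :: 'k)"
    by (simp add: cell_boundary_eq mat_app_zero)
  then show ?thesis
    unfolding cell_boundaries_def by (intro image_eqI[of _ _ "\<lambda>e. 0"]) (auto simp: carrier_cell_chains)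
qed

lemma boundaries_add:
  assumes "b \<in> cell_boundaries X n" "b' \<in> cell_boundaries X n"
  shows "(\<lambda>e. b e + b' e) \<in> cell_boundaries X n"
proof -
  obtain c c' where "c \<in> carrier (cell_chains X (Suc n))" "c' \<in> carrier (cell_chains X (Suc n))"
    "b = cell_boundary X n c" "b' = cell_boundary X n c'"
    using assms by (auto simp: cell_boundaries_def)
  then show ?thesis
    unfolding cell_boundaries_def
    by (intro image_eqI[of _ _ "\<lambda>e. c e + c' e"]) (auto simp: carrier_cell_chains cell_boundary_eq mat_app_add)
qed

lemma boundaries_scale:
  assumes "b \<in> cell_boundaries X n"
  shows "(\<lambda>e. a * b e) \<in> cell_boundaries X n"
proof -
  obtain c where "c \<in> carrier (cell_chains X (Suc n))" "b = cell_boundary X n c"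
    using assms by (auto simp: cell_boundaries_def)
  then show ?thesis
    unfolding cell_boundaries_def
    by (intro image_eqI[of _ _ "\<lambda>e. a * c e"]) (auto simp: carrier_cell_chains cell_boundary_eq mat_app_scale)
qed

lemma boundaries_diff:
  assumes "b \<in> cell_boundaries X n" "b' \<in> cell_boundaries X n"
  shows "(\<lambda>e. b e - b' e) \<in> cell_boundaries X n"
  using boundaries_add[OF assms(1) boundaries_scale[OF assms(2), of "-1"]] by simp

lemma in_hclass: "y \<in> hclass X n z \<longleftrightarrow> (\<lambda>e. y e - z e) \<in> cell_boundaries X n"
proof
  assume "y \<in> hclass X n z"
  then obtain b where "b \<in> cell_boundaries X n" "y = (\<lambda>e. b e + z e)"
    by (auto simp: hclass_eq)
  then show "(\<lambda>e. y e - z e) \<in> cell_boundaries X n" by simp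
next
  assume "(\<lambda>e. y e - z e) \<in> cell_boundaries X n"
  then show "y \<in> hclass X n z"
    unfolding hclass_eq by (intro CollectI exI[of _ "\<lambda>e. y e - z e"]) auto
qed

lemma hclass_self: "z \<in> hclass X n z"
  by (simp add: in_hclass boundaries_zero)

lemma hclass_eq_iff: "hclass X n y = hclass X n z \<longleftrightarrow> (\<lambda>e. y e - z e) \<in> cell_boundaries X n"
proof
  assume "hclass X n y = hclass X n z"
  then show "(\<lambda>e. y e - z e) \<in> cell_boundaries X n"
    using hclass_self[of y X n] by (simp add: in_hclass)
next
  assume yz: "(\<lambda>e. y e - z e) \<in> cell_boundaries X n"
  show "hclass X n y = hclass X n z"
  proof (rule Set.set_eqI)
    fix x
    have "(\<lambda>e. x e - z e) = (\<lambda>e. (x e - y e) + (y e - z e))"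
      "(\<lambda>e. x e - y e) = (\<lambda>e. (x e - z e) - (y e - z e))"
      by auto
    then show "x \<in> hclass X n y \<longleftrightarrow> x \<in> hclass X n z"
      using boundaries_add[OF _ yz] boundaries_diff[OF _ yz] unfolding in_hclass by metis
  qed
qed

lemma carrier_cell_homology: "carrier (cell_homology X n) = hclass X n ` cell_cycles X n"
  by (auto simp: cell_homology_def Let_def)

lemma zero_cell_homology: "\<zero>\<^bsub>cell_homology X n\<^esub> = hclass X n (\<lambda>e. 0)"
  by (simp add: cell_homology_def Let_def hclass_eq)

lemma add_cell_homology: "hclass X n y \<oplus>\<^bsub>cell_homology X n\<^esub> hclass X n z = hclass X n (\<lambda>e. y e + z e)"
proof -
  have "hclass X n y \<oplus>\<^bsub>cell_homology X n\<^esub> hclass X n z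
      = {\<lambda>e. s e + t e | s t. s \<in> hclass X n y \<and> t \<in> hclass X n z}"
    by (auto simp: cell_homology_def Let_def set_add_def set_mult_def cell_chains_def)
  also have "\<dots> = hclass X n (\<lambda>e. y e + z e)"
  proof (intro Set.set_eqI iffI)
    fix x assume "x \<in> {\<lambda>e. s e + t e | s t. s \<in> hclass X n y \<and> t \<in> hclass X n z}"
    then obtain s t where st: "x = (\<lambda>e. s e + t e)" "(\<lambda>e. s e - y e) \<in> cell_boundaries X n"
      "(\<lambda>e. t e - z e) \<in> cell_boundaries X n"
      unfolding in_hclass by blast
    then show "x \<in> hclass X n (\<lambda>e. y e + z e)"
      using boundaries_add[OF st(2,3)] by (simp add: in_hclass algebra_simps)
  next
    fix x assume "x \<in> hclass X n (\<lambda>e. y e + z e)"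
    then have "(\<lambda>e. x e - z e) \<in> hclass X n y"
      by (simp add: in_hclass algebra_simps)
    then show "x \<in> {\<lambda>e. s e + t e | s t. s \<in> hclass X n y \<and> t \<in> hclass X n z}"
      using hclass_self[of z X n]
      by (intro CollectI exI[of _ "\<lambda>e. x e - z e"] exI[of _ z]) auto
  qed
  finally show ?thesis .
qed

text \<open>Scaling is defined as a union over representatives, all of which give the same coset
  because boundaries are closed under scaling.\<close>

lemma smult_cell_homology: "a \<odot>\<^bsub>cell_homology X n\<^esub> hclass X n z = hclass X n (\<lambda>e. a * z e)"
proof -
  have "hclass X n (\<lambda>e. a * x e) = hclass X n (\<lambda>e. a * z e)" if "x \<in> hclass X n z" for x
    using boundaries_scale[OF that[unfolded in_hclass], of a]
    unfolding hclass_eq_iff right_diff_distrib .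
  then have "(\<Union>x\<in>hclass X n z. hclass X n (\<lambda>e. a * x e)) = hclass X n (\<lambda>e. a * z e)"
    using hclass_self[of z X n] by blast
  then show ?thesis
    by (simp add: cell_homology_def Let_def cell_chains_def)
qed

lemma cycles_add: "y \<in> cell_cycles X n \<Longrightarrow> z \<in> cell_cycles X n \<Longrightarrow> (\<lambda>e. y e + z e) \<in> cell_cycles X n"
  by (cases n) (auto simp: carrier_cell_chains cell_boundary_eq mat_app_add)

lemma cycles_scale: "z \<in> cell_cycles X n \<Longrightarrow> (\<lambda>e. a * z e) \<in> cell_cycles X n"
  by (cases n) (auto simp: carrier_cell_chains cell_boundary_eq mat_app_scale)

lemma cycles_zero: "(\<lambda>e. 0) \<in> cell_cycles X n"
  by (cases n) (auto simp: carrier_cell_chains cell_boundary_eq mat_app_zero)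

lemma cring_coeff_field: "cring (coeff_field :: ('k::field, 'k) module)"
proof (rule cringI)
  let ?K = "coeff_field :: ('k, 'k) module"
  show "abelian_group ?K"
  proof (rule abelian_groupI)
    show "\<exists>y\<in>carrier ?K. y \<oplus>\<^bsub>?K\<^esub> x = \<zero>\<^bsub>?K\<^esub>" for x
      by (rule bexI[of _ "- x"]) (simp_all add: coeff_field_def)
  qed (simp_all add: coeff_field_def algebra_simps)
  show "Group.comm_monoid ?K"
    by (rule comm_monoidI) (simp_all add: coeff_field_def algebra_simps)
qed (simp add: coeff_field_def algebra_simps)

lemma module_cell_homology: "module coeff_field (cell_homology X n :: ('k::field, ('a set \<Rightarrow> 'k) set) module)"
proof (rule moduleI)
  let ?H = "cell_homology X n :: ('k, ('a set \<Rightarrow> 'k) set) module"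
  show "cring (coeff_field :: ('k, 'k) module)"
    by (rule cring_coeff_field)
  show "abelian_group ?H"
  proof (rule abelian_groupI)
    show "\<exists>y\<in>carrier ?H. y \<oplus>\<^bsub>?H\<^esub> x = \<zero>\<^bsub>?H\<^esub>" if x: "x \<in> carrier ?H" for x
    proof -
      obtain z :: "'a set \<Rightarrow> 'k" where z: "z \<in> cell_cycles X n" "x = hclass X n z"
        using x unfolding carrier_cell_homology by blast
      then show ?thesis
        using cycles_scale[OF z(1), of "-1"]
        by (intro bexI[of _ "hclass X n (\<lambda>e. -1 * z e)"])
          (auto simp: carrier_cell_homology zero_cell_homology add_cell_homology)
    qed
  qed (auto simp: carrier_cell_homology zero_cell_homology add_cell_homology cycles_add cycles_zero algebra_simps)
qed (auto simp: carrier_cell_homology add_cell_homology smult_cell_homology cycles_scale coeff_field_def algebra_simps)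

text \<open>The construction of \<open>homology_map\<close> for an arbitrary matrix, so that
  structure maps and chain maps obtained from carriers are treated alike.\<close>

definition matrix_homology ::
  "'a cw \<Rightarrow> 'b cw \<Rightarrow> (nat \<Rightarrow> 'a set \<Rightarrow> 'b set \<Rightarrow> 'k::field) \<Rightarrow> nat \<Rightarrow> ('a set \<Rightarrow> 'k) set \<Rightarrow> ('b set \<Rightarrow> 'k) set" where
  "matrix_homology X Y w n S = (\<Union>z\<in>S. hclass Y n (cell_app X n (w n) z))"

lemma homology_map_eq: "homology_map X Y f n = matrix_homology X Y (map_row X Y f) n"
  by (auto simp: homology_map_def matrix_homology_def induced_chain_map_eq)

lemma chain_matrix_chain:
  assumes "chain_matrix X Y w"
  shows "cell_app X n (w n) c \<in> carrier (cell_chains Y n)"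
  using assms by (auto simp: carrier_cell_chains chain_matrix_def elim!: mat_app_nonzeroE)
    (metis mat_app_nonzeroE)

lemma chain_matrix_boundaries:
  assumes "chain_matrix X Y w" "b \<in> cell_boundaries X n"
  shows "cell_app X n (w n) b \<in> cell_boundaries Y n"
proof -
  obtain c where c: "b = cell_boundary X n c"
    using assms(2) by (auto simp: cell_boundaries_def)
  show ?thesis
    unfolding cell_boundaries_def c chain_matrix_boundary[OF assms(1), symmetric]
    by (rule imageI) (rule chain_matrix_chain[OF assms(1)])
qed

lemma chain_matrix_cycles:
  assumes "chain_matrix X Y w" "z \<in> cell_cycles X n"
  shows "cell_app X n (w n) z \<in> cell_cycles Y n"
proof (cases n)
  case 0
  then show ?thesis
    using chain_matrix_chain[OF assms(1), of 0] by simp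
next
  case (Suc m)
  then have "cell_boundary X m z = (\<lambda>e. 0)"
    using assms(2) by simp
  then show ?thesis
    using chain_matrix_chain[OF assms(1), of n] chain_matrix_boundary[OF assms(1), of m z]
    by (simp add: Suc mat_app_zero)
qed

text \<open>Chain maps preserve boundaries, so the union over representatives collapses to one
  coset.\<close>

lemma matrix_homology_hclass:
  assumes "chain_matrix X Y w"
  shows "matrix_homology X Y w n (hclass X n z) = hclass Y n (cell_app X n (w n) z)"
proof -
  have "hclass Y n (cell_app X n (w n) y) = hclass Y n (cell_app X n (w n) z)"
    if "y \<in> hclass X n z" for y
    using chain_matrix_boundaries[OF assms that[unfolded in_hclass]]
    unfolding hclass_eq_iff mat_app_diff .
  then show ?thesis
    unfolding matrix_homology_def using hclass_self[of z X n] by blast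
qed

lemma linear_hom_matrix_homology:
  assumes "chain_matrix X Y w"
  shows "linear_hom (cell_homology X n) (cell_homology Y n) (matrix_homology X Y w n)"
  unfolding linear_hom_def hom_def
  using chain_matrix_cycles[OF assms]
  by (auto simp: carrier_cell_homology add_cell_homology smult_cell_homology
      matrix_homology_hclass[OF assms] mat_app_add mat_app_scale)

lemma matrix_homology_compose:
  assumes "chain_matrix X Y w" "chain_matrix Y Z v" "x \<in> carrier (cell_homology X n)"
  shows "matrix_homology Y Z v n (matrix_homology X Y w n x)
    = matrix_homology X Z (\<lambda>n e. cell_app Y n (v n) (w n e)) n x"
proof -
  obtain z where z: "x = hclass X n z"
    using assms(3) by (auto simp: carrier_cell_homology)
  show ?thesis
    unfolding z matrix_homology_hclass[OF assms(1)] matrix_homology_hclass[OF assms(2)]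
      matrix_homology_hclass[OF chain_matrix_compose[OF assms(1,2)]] mat_app_mat_app by (rule refl)
qed

section \<open>Acyclic carriers\<close>

context regular_subcomplex
begin

lemma carrier_chains_sub_cw: "carrier (cell_chains (sub_cw X A) n) = (chains_in X A n :: ('a set \<Rightarrow> 'k::field) set)"
  by (rule Set.set_eqI) (simp add: carrier_cell_chains chains_in_def cells_of_dim_sub_cw, blast)

lemma cell_boundary_sub_cw:
  assumes "c \<in> chains_in X A (Suc n)"
  shows "cell_boundary (sub_cw X A) n c = (cell_boundary X n c :: 'a set \<Rightarrow> 'k::field)"
proof
  fix y
  have "(\<Sum>e\<in>cells_of_dim (sub_cw X A) (Suc n). c e * of_int (incidence (sub_cw X A) n e y))
      = (\<Sum>e\<in>cells_of_dim (sub_cw X A) (Suc n). c e * of_int (incidence X n e y))"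
    by (rule sum.cong) (simp_all add: incidence_sub_cw)
  also have "\<dots> = (\<Sum>e\<in>cells_of_dim X (Suc n). c e * of_int (incidence X n e y))"
    using assms finite_cells_of_dim
    by (intro sum.mono_neutral_left) (auto simp: cells_of_dim_sub_cw chains_in_def)
  finally show "cell_boundary (sub_cw X A) n c y = cell_boundary X n c y"
    by (simp add: cell_boundary_def)
qed

lemma boundaries_sub_cw:
  assumes "b \<in> cell_boundaries (sub_cw X A) n"
  obtains c where "c \<in> chains_in X A (Suc n)" "cell_boundary X n c = (b :: 'a set \<Rightarrow> 'k::field)"
proof -
  obtain c where c: "c \<in> carrier (cell_chains (sub_cw X A) (Suc n))" "b = cell_boundary (sub_cw X A) n c"
    using assms unfolding cell_boundaries_def by blast
  then have "c \<in> chains_in X A (Suc n)"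
    by (simp add: carrier_chains_sub_cw)
  then show ?thesis
    by (rule that) (simp add: c(2) cell_boundary_sub_cw[OF \<open>c \<in> chains_in X A (Suc n)\<close>])
qed

text \<open>Chains and boundaries of the subcomplex agree with those of \<open>X\<close>, so
  vanishing homology of the subcomplex yields a filling in \<open>X\<close> supported in
  \<open>A\<close>.\<close>

lemma acyclic_filling_Suc:
  fixes K :: "'k::field itself"
  assumes "acyclic_sub K X A" "z \<in> chains_in X A (Suc n)"
    "cell_boundary X n z = (\<lambda>e. 0 :: 'k)"
  obtains c where "c \<in> chains_in X A (Suc (Suc n))" "cell_boundary X (Suc n) c = z"
proof -
  let ?H = "cell_homology (sub_cw X A) (Suc n) :: ('k, ('a set \<Rightarrow> 'k) set) module"
  have "carrier ?H = {\<zero>\<^bsub>?H\<^esub>}"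
    using assms(1) unfolding acyclic_sub_def by blast
  moreover have "z \<in> cell_cycles (sub_cw X A) (Suc n)"
    using assms(2,3) by (simp add: carrier_chains_sub_cw cell_boundary_sub_cw)
  then have "hclass (sub_cw X A) (Suc n) z \<in> carrier ?H"
    unfolding carrier_cell_homology by (rule imageI)
  ultimately have "hclass (sub_cw X A) (Suc n) z = hclass (sub_cw X A) (Suc n) (\<lambda>e. 0)"
    unfolding zero_cell_homology by blast
  then have "(\<lambda>e. z e - 0) \<in> cell_boundaries (sub_cw X A) (Suc n)"
    unfolding hclass_eq_iff .
  then show ?thesis
    using boundaries_sub_cw[of "\<lambda>e. z e - 0" "Suc n"] that by auto
qed

lemma augment_vertex:
  assumes "v \<in> cells_of_dim X 0"
  shows "augment X (\<lambda>e. if e = v then a else 0) = a * of_int (vertex_sign X v)"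
proof -
  have "augment X (\<lambda>e. if e = v then a else 0)
      = (\<Sum>e\<in>cells_of_dim X 0. if e = v then a * of_int (vertex_sign X v) else 0)"
    unfolding augment_def by (rule sum.cong) auto
  then show ?thesis
    using assms finite_cells_of_dim by simp
qed

lemma vertex_sign_square:
  assumes "v \<in> cells_of_dim X 0"
  shows "of_int (vertex_sign X v) * of_int (vertex_sign X v) = (1 :: 'k::field)"
  using abs_vertex_sign[OF assms] by (auto simp: abs_if split: if_splits)

lemma augment_boundaries_sub_cw:
  assumes "b \<in> cell_boundaries (sub_cw X A) 0"
  shows "augment X b = (0 :: 'k::field)"
  using boundaries_sub_cw[OF assms] augment_cell_boundary by metis

text \<open>
  The homology in degree 0 is one-dimensional and the augmentation does not vanish on vertices,
  so the augmentation is injective on it.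
\<close>

lemma acyclic_filling_0:
  fixes K :: "'k::field itself"
  assumes "acyclic_sub K X A" "A \<noteq> {}" "z \<in> chains_in X A 0" "augment X z = (0 :: 'k)"
  obtains c where "c \<in> chains_in X A (Suc 0)" "cell_boundary X 0 c = z"
proof -
  let ?S = "sub_cw X A"
  let ?H = "cell_homology ?S 0 :: ('k, ('a set \<Rightarrow> 'k) set) module"
  obtain v where v: "v \<in> cells_of_dim X 0" "v \<subseteq> A"
    using vertex_exists[OF assms(2)] by metis
  define \<delta> :: "'a set \<Rightarrow> 'k" where "\<delta> = (\<lambda>e. if e = v then 1 else 0)"
  have aug\<delta>: "augment X \<delta> \<noteq> 0"
    using vertex_sign_square[OF v(1), where 'k = 'k] augment_vertex[OF v(1), of "1 :: 'k"] by (auto simp: \<delta>_def)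
  have cyc: "\<delta> \<in> cell_cycles ?S 0" "z \<in> cell_cycles ?S 0"
    using assms(3) chains_in_unit[OF v, of 1] by (simp_all add: carrier_chains_sub_cw \<delta>_def)
  obtain h :: "'k \<Rightarrow> ('a set \<Rightarrow> 'k) set"
    where h: "linear_hom coeff_field ?H h" "bij_betw h UNIV (carrier ?H)"
    using assms(1) unfolding acyclic_sub_def by blast
  have smult: "h (r * s) = r \<odot>\<^bsub>?H\<^esub> h s" for r s
    using h(1) by (simp add: linear_hom_def coeff_field_def)
  have "hclass ?S 0 \<delta> \<in> carrier ?H" "hclass ?S 0 z \<in> carrier ?H"
    using cyc unfolding carrier_cell_homology by blast+
  then obtain a b where a: "h a = hclass ?S 0 \<delta>" and b: "h b = hclass ?S 0 z"
    using h(2) unfolding bij_betw_def by (metis imageE)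
  \<comment> \<open>Otherwise the vertex \<open>v\<close> would be a boundary and its augmentation,
    a sign, would vanish.\<close>
  have "a \<noteq> 0"
  proof
    assume "a = 0"
    then have "hclass ?S 0 \<delta> = hclass ?S 0 (\<lambda>e. 0 * \<delta> e)"
      using smult[of 0 a] a smult_cell_homology[of ?S 0 0 \<delta>] by simp
    then have "(\<lambda>e. \<delta> e - 0 * \<delta> e) \<in> cell_boundaries ?S 0"
      unfolding hclass_eq_iff .
    then show False
      using augment_boundaries_sub_cw aug\<delta> by fastforce
  qed
  \<comment> \<open>In dimension one every class is a multiple of the class of \<open>v\<close>;
    comparing augmentations afterwards shows that the factor for \<open>z\<close> is 0.\<close>
  then have "h b = (b / a) \<odot>\<^bsub>?H\<^esub> h a"
    using smult[of "b / a" a] by simp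
  then have "hclass ?S 0 z = hclass ?S 0 (\<lambda>e. b / a * \<delta> e)"
    unfolding a b smult_cell_homology .
  then have diff: "(\<lambda>e. z e - b / a * \<delta> e) \<in> cell_boundaries ?S 0"
    unfolding hclass_eq_iff .
  have "b / a * augment X \<delta> = 0"
    using augment_boundaries_sub_cw[OF diff] unfolding augment_diff augment_scale assms(4) by simp
  then have "b / a = 0"
    using aug\<delta> by simp
  then have "z \<in> cell_boundaries ?S 0"
    using diff unfolding \<open>b / a = 0\<close> by simp
  then obtain c where "c \<in> chains_in X A (Suc 0)" "cell_boundary X 0 c = z"
    by (rule boundaries_sub_cw)
  then show ?thesis
    by (rule that)
qed

end

text \<open>Cycles of the augmented complex: in degree 0 the augmentation takes the place of the
  boundary, so that filling has one statement for all degrees.\<close>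

definition reduced_cycle :: "'a cw \<Rightarrow> nat \<Rightarrow> ('a set \<Rightarrow> 'k::field) \<Rightarrow> bool" where
  "reduced_cycle X n z \<longleftrightarrow> (case n of 0 \<Rightarrow> augment X z = 0 | Suc m \<Rightarrow> cell_boundary X m z = (\<lambda>e. 0))"

section \<open>The acyclic carrier theorem\<close>

locale acyclic_carrier_between =
  X: regular_complex X + Y: regular_complex Y
  for X :: "'a cw" and Y :: "'b cw" +
  fixes K :: "'k::field itself" and F :: "('a, 'b) carr"
  assumes carrier: "acyclic_carrier K X Y F"
begin

lemma carrier_mono:
  assumes "\<sigma> \<in> cells X" "\<tau> \<in> cells X" "\<tau> \<subseteq> closed_cell X \<sigma>"
  shows "F \<tau> \<subseteq> F \<sigma>"
  using carrier assms by (auto simp: acyclic_carrier_def is_carrier_def cells_in_def)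

lemma regular_subcomplex_carrier:
  assumes "\<sigma> \<in> cells X"
  shows "regular_subcomplex Y (F \<sigma>)"
  using carrier assms Y.regular_complex_axioms
  by (simp add: acyclic_carrier_def is_carrier_def regular_subcomplex_def regular_subcomplex_axioms_def)

lemma filling:
  assumes "\<sigma> \<in> cells X" "z \<in> chains_in Y (F \<sigma>) n" "reduced_cycle Y n (z :: 'b set \<Rightarrow> 'k)"
  shows "\<exists>c. c \<in> chains_in Y (F \<sigma>) (Suc n) \<and> cell_boundary Y n c = z"
proof -
  interpret regular_subcomplex Y "F \<sigma>"
    by (rule regular_subcomplex_carrier[OF assms(1)])
  have ac: "acyclic_sub K Y (F \<sigma>)" "F \<sigma> \<noteq> {}"
    using carrier assms(1) by (auto simp: acyclic_carrier_def)
  show ?thesis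
  proof (cases n)
    case 0
    with assms(2,3) have "z \<in> chains_in Y (F \<sigma>) 0" "augment Y z = 0"
      by (simp_all add: reduced_cycle_def)
    from acyclic_filling_0[OF ac this] show ?thesis
      unfolding 0 by metis
  next
    case (Suc m)
    with assms(2,3) have "z \<in> chains_in Y (F \<sigma>) (Suc m)" "cell_boundary Y m z = (\<lambda>e. 0)"
      by (simp_all add: reduced_cycle_def)
    from acyclic_filling_Suc[OF ac(1) this] show ?thesis
      unfolding Suc by metis
  qed
qed

text \<open>By locality of the incidence numbers, the boundary of a cell involves only cells
  contained in its closed cell, and there \<open>F\<close> is monotone.\<close>

lemma carried_boundary:
  fixes w :: "'a set \<Rightarrow> 'b set \<Rightarrow> 'k"
  assumes "\<And>e. e \<in> cells_of_dim X n \<Longrightarrow> w e \<in> chains_in Y (F e) m" "\<sigma> \<in> cells_of_dim X (Suc n)"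
  shows "cell_app X n w (bd_row X n \<sigma>) \<in> chains_in Y (F \<sigma>) m"
proof (rule chains_in_mat_app)
  fix s assume s: "s \<in> cells_of_dim X n" "bd_row X n \<sigma> s \<noteq> (0 :: 'k)"
  have "F s \<subseteq> F \<sigma>"
    using X.bd_row_local[OF assms(2) s(2)] s(1) assms(2)
    by (intro carrier_mono) (auto simp: cells_of_dim_def)
  then show "w s \<in> chains_in Y (F \<sigma>) m"
    using assms(1)[OF s(1)] chains_in_mono by blast
qed

lemma cell_boundary_mat_app:
  "cell_boundary Y n (mat_app S w c) = mat_app S (\<lambda>s. cell_boundary Y n (w s)) c"
  by (simp add: cell_boundary_eq mat_app_mat_app)

lemma mat_app_bd_row_bd_row:
  assumes "e \<in> cells_of_dim X (Suc (Suc n))"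
  shows "cell_app X (Suc n) (\<lambda>s. cell_app X n w (bd_row X n s)) (bd_row X (Suc n) e)
    = (\<lambda>y. 0 :: 'k)"
proof -
  have "cell_app X (Suc n) (\<lambda>s. cell_app X n w (bd_row X n s)) (bd_row X (Suc n) e)
      = cell_app X n w (cell_app X (Suc n) (bd_row X n) (bd_row X (Suc n) e))"
    by (rule mat_app_mat_app[symmetric])
  then show ?thesis
    by (simp add: X.bd_row_bd_row[OF assms] mat_app_zero)
qed

text \<open>Degree by degree, the image of the boundary of a cell is a reduced cycle in the value of
  \<open>F\<close> at that cell, so it can be filled there.\<close>

theorem carried_chain_matrix_exists:
  obtains w :: "nat \<Rightarrow> 'a set \<Rightarrow> 'b set \<Rightarrow> 'k" where "chain_matrix X Y w" "carried X F w"
proof -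
  \<comment> \<open>\<open>P\<close> is the invariant of one degree: its second part provides the
    cycles that the next degree has to fill. \<open>Q\<close> links consecutive degrees in the
    dependent choice.\<close>
  define P where "P = (\<lambda>n (w :: 'a set \<Rightarrow> 'b set \<Rightarrow> 'k).
     (\<forall>e\<in>cells_of_dim X n. w e \<in> chains_in Y (F e) n) \<and>
     (\<forall>e\<in>cells_of_dim X (Suc n). reduced_cycle Y n (cell_app X n w (bd_row X n e))) \<and>
     (n = 0 \<longrightarrow> (\<forall>e\<in>cells_of_dim X 0. augment Y (w e) = of_int (vertex_sign X e))))"
  define Q where "Q = (\<lambda>n (w :: 'a set \<Rightarrow> 'b set \<Rightarrow> 'k) w'.
     \<forall>e\<in>cells_of_dim X (Suc n). cell_boundary Y n (w' e) = cell_app X n w (bd_row X n e))"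
  have "\<exists>w. P 0 w"
  proof -
    have "\<exists>c. c \<in> chains_in Y (F e) 0 \<and> augment Y c = (of_int (vertex_sign X e) :: 'k)"
      if e: "e \<in> cells_of_dim X 0" for e
    proof -
      have eX: "e \<in> cells X"
        using e by (simp add: cells_of_dim_def)
      interpret regular_subcomplex Y "F e"
        by (rule regular_subcomplex_carrier[OF eX])
      have "F e \<noteq> {}"
        using carrier eX by (simp add: acyclic_carrier_def)
      then obtain v where v: "v \<in> cells_of_dim Y 0" "v \<subseteq> F e"
        using vertex_exists by metis
      \<comment> \<open>The sign of \<open>v\<close> is its own inverse, so this multiple of
        \<open>v\<close> has the sign of \<open>e\<close> as its augmentation.\<close>
      let ?a = "of_int (vertex_sign X e) * of_int (vertex_sign Y v) :: 'k"
      have "augment Y (\<lambda>x. if x = v then ?a else 0) = of_int (vertex_sign X e)"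
        unfolding augment_vertex[OF v(1)] using vertex_sign_square[OF v(1), where 'k = 'k]
        by (simp add: mult.assoc)
      then show ?thesis
        using chains_in_unit[OF v, of ?a] by blast
    qed
    then obtain w where w: "\<And>e. e \<in> cells_of_dim X 0 \<Longrightarrow>
        w e \<in> chains_in Y (F e) 0 \<and> augment Y (w e) = (of_int (vertex_sign X e) :: 'k)"
      by metis
    have "augment Y (cell_app X 0 w (bd_row X 0 e)) = 0" if e: "e \<in> cells_of_dim X (Suc 0)" for e
    proof -
      have "augment Y (cell_app X 0 w (bd_row X 0 e)) = augment X (bd_row X 0 e)"
        unfolding augment_mat_app augment_def[of X] by (rule sum.cong) (simp_all add: w)
      then show ?thesis
        using X.augment_bd_row[OF e] by simp
    qed
    then show ?thesis
      using w by (intro exI[of _ w]) (simp add: P_def reduced_cycle_def)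
  qed
  moreover have "\<exists>w'. P (Suc n) w' \<and> Q n w w'" if P: "P n w" for w n
  proof -
    have "\<exists>c. c \<in> chains_in Y (F e) (Suc n) \<and> cell_boundary Y n c = cell_app X n w (bd_row X n e)"
      if e: "e \<in> cells_of_dim X (Suc n)" for e
      using P e carried_boundary[of n w n e] by (intro filling) (auto simp: P_def cells_of_dim_def)
    then obtain w' where w': "\<And>e. e \<in> cells_of_dim X (Suc n) \<Longrightarrow> w' e \<in> chains_in Y (F e) (Suc n) \<and>
        cell_boundary Y n (w' e) = cell_app X n w (bd_row X n e)"
      by metis
    have "cell_boundary Y n (cell_app X (Suc n) w' (bd_row X (Suc n) e)) = (\<lambda>y. 0)"
      if e: "e \<in> cells_of_dim X (Suc (Suc n))" for e
    proof -
      have "cell_app X (Suc n) (\<lambda>s. cell_boundary Y n (w' s)) (bd_row X (Suc n) e)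
          = cell_app X (Suc n) (\<lambda>s. cell_app X n w (bd_row X n s)) (bd_row X (Suc n) e)"
        by (rule mat_app_cong) (simp add: w')
      then show ?thesis
        by (simp add: cell_boundary_mat_app mat_app_bd_row_bd_row[OF e])
    qed
    then show ?thesis
      using w' by (intro exI[of _ w']) (simp add: P_def Q_def reduced_cycle_def)
  qed
  ultimately obtain w where w: "\<And>n. P n (w n)" "\<And>n. Q n (w n) (w (Suc n))"
    using dependent_nat_choice[of P Q] by metis
  have in_F: "w n e \<in> chains_in Y (F e) n" if "e \<in> cells_of_dim X n" for n e
    using w(1)[of n] that by (simp add: P_def)
  have "augment Y (w 0 e) = of_int (vertex_sign X e)" if "e \<in> cells_of_dim X 0" for e
    using w(1)[of 0] that by (simp add: P_def)
  moreover have "cell_boundary Y n (w (Suc n) e) = cell_app X n (w n) (bd_row X n e)"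
    if "e \<in> cells_of_dim X (Suc n)" for n e
    using w(2)[of n] that by (simp add: Q_def)
  moreover have "y \<in> cells_of_dim Y n" "y \<subseteq> F e" if "e \<in> cells_of_dim X n" "w n e y \<noteq> 0" for n e y
    using in_F[OF that(1)] that(2) by (auto simp: chains_in_def)
  ultimately have "chain_matrix X Y w" "carried X F w"
    by (auto simp: chain_matrix_def carried_def)
  then show ?thesis
    by (rule that)
qed

text \<open>The homotopy equation from \<open>u\<close> to \<open>v\<close> on generators. Degree 0
  stands apart because no cellular boundary leaves the vertices.\<close>

definition carried_homotopy where
  "carried_homotopy u v (h :: nat \<Rightarrow> 'a set \<Rightarrow> 'b set \<Rightarrow> 'k) \<longleftrightarrow>
     (\<forall>n. \<forall>e\<in>cells_of_dim X n. h n e \<in> chains_in Y (F e) (Suc n)) \<and>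
     (\<forall>e\<in>cells_of_dim X 0. cell_boundary Y 0 (h 0 e) = (\<lambda>y. v 0 e y - u 0 e y)) \<and>
     (\<forall>n. \<forall>e\<in>cells_of_dim X (Suc n). cell_boundary Y (Suc n) (h (Suc n) e)
       = (\<lambda>y. (v (Suc n) e y - u (Suc n) e y) - cell_app X n (h n) (bd_row X n e) y))"

text \<open>On vertices the difference has augmentation 0 and can be filled. In higher degrees the
  difference corrected by the homotopy of the previous degree is a cycle, again in the value of
  \<open>F\<close> at the cell.\<close>

theorem carried_homotopy_exists:
  assumes u: "chain_matrix X Y u" "carried X F u" and v: "chain_matrix X Y v" "carried X F v"
  obtains h where "carried_homotopy u v h"
proof -
  define D where "D = (\<lambda>n e y. v n e y - u n e y)"
  have D_in: "D n e \<in> chains_in Y (F e) n" if "e \<in> cells_of_dim X n" for n e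
    unfolding D_def by (intro chains_in_diff chain_matrix_chains_in[OF u that] chain_matrix_chains_in[OF v that])
  have D_aug: "augment Y (D 0 e) = 0" if "e \<in> cells_of_dim X 0" for e
    using u(1) v(1) that by (simp add: D_def augment_diff chain_matrix_def)
  have D_bd: "cell_boundary Y n (D (Suc n) e) = cell_app X n (D n) (bd_row X n e)"
    if "e \<in> cells_of_dim X (Suc n)" for n e
  proof -
    have "cell_boundary Y n (D (Suc n) e) = (\<lambda>y. cell_boundary Y n (v (Suc n) e) y - cell_boundary Y n (u (Suc n) e) y)"
      by (simp add: D_def cell_boundary_eq mat_app_diff)
    then show ?thesis
      using u(1) v(1) that unfolding D_def mat_app_row_diff by (simp add: chain_matrix_def)
  qed
  \<comment> \<open>The second part of \<open>P\<close> is the homotopy equation applied to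
    boundaries, where the term with two boundaries drops out. It is exactly what makes the corrected
    difference in the next degree a cycle.\<close>
  define P where "P = (\<lambda>n (h :: 'a set \<Rightarrow> 'b set \<Rightarrow> 'k).
     (\<forall>e\<in>cells_of_dim X n. h e \<in> chains_in Y (F e) (Suc n)) \<and>
     (\<forall>e\<in>cells_of_dim X (Suc n). cell_boundary Y n (cell_app X n h (bd_row X n e))
        = cell_app X n (D n) (bd_row X n e)) \<and>
     (n = 0 \<longrightarrow> (\<forall>e\<in>cells_of_dim X 0. cell_boundary Y 0 (h e) = D 0 e)))"
  define Q where "Q = (\<lambda>n (h :: 'a set \<Rightarrow> 'b set \<Rightarrow> 'k) h'.
     \<forall>e\<in>cells_of_dim X (Suc n). cell_boundary Y (Suc n) (h' e)
       = (\<lambda>y. D (Suc n) e y - cell_app X n h (bd_row X n e) y))"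
  have "\<exists>h. P 0 h"
  proof -
    have "\<exists>c. c \<in> chains_in Y (F e) (Suc 0) \<and> cell_boundary Y 0 c = D 0 e" if "e \<in> cells_of_dim X 0" for e
      using that D_in[OF that] D_aug[OF that]
      by (intro filling) (auto simp: reduced_cycle_def cells_of_dim_def)
    then obtain h where h: "\<And>e. e \<in> cells_of_dim X 0 \<Longrightarrow>
        h e \<in> chains_in Y (F e) (Suc 0) \<and> cell_boundary Y 0 (h e) = D 0 e"
      by metis
    have "cell_boundary Y 0 (cell_app X 0 h c) = cell_app X 0 (D 0) c" for c
      unfolding cell_boundary_mat_app by (rule mat_app_cong) (simp add: h)
    then show ?thesis
      using h by (intro exI[of _ h]) (simp add: P_def)
  qed
  moreover have "\<exists>h'. P (Suc n) h' \<and> Q n h h'" if P: "P n h" for h n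
  proof -
    define z where "z = (\<lambda>e y. D (Suc n) e y - cell_app X n h (bd_row X n e) y)"
    have "\<exists>c. c \<in> chains_in Y (F e) (Suc (Suc n)) \<and> cell_boundary Y (Suc n) c = z e"
      if e: "e \<in> cells_of_dim X (Suc n)" for e
    proof (rule filling)
      show "e \<in> cells X"
        using e by (simp add: cells_of_dim_def)
      show "z e \<in> chains_in Y (F e) (Suc n)"
        unfolding z_def using P e by (intro chains_in_diff D_in carried_boundary) (auto simp: P_def)
      have "cell_boundary Y n (z e) = (\<lambda>y. cell_boundary Y n (D (Suc n) e) y
          - cell_boundary Y n (cell_app X n h (bd_row X n e)) y)"
        by (simp add: z_def cell_boundary_eq mat_app_diff)
      also have "\<dots> = (\<lambda>y. 0)"
        using P e by (simp add: D_bd P_def)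
      finally show "reduced_cycle Y (Suc n) (z e)"
        by (simp add: reduced_cycle_def)
    qed
    then obtain h' where h': "\<And>e. e \<in> cells_of_dim X (Suc n) \<Longrightarrow>
        h' e \<in> chains_in Y (F e) (Suc (Suc n)) \<and> cell_boundary Y (Suc n) (h' e) = z e"
      by metis
    have "cell_boundary Y (Suc n) (cell_app X (Suc n) h' (bd_row X (Suc n) e))
        = cell_app X (Suc n) (D (Suc n)) (bd_row X (Suc n) e)"
      if e: "e \<in> cells_of_dim X (Suc (Suc n))" for e
    proof -
      have "cell_boundary Y (Suc n) (cell_app X (Suc n) h' (bd_row X (Suc n) e))
          = cell_app X (Suc n) z (bd_row X (Suc n) e)"
        unfolding cell_boundary_mat_app by (rule mat_app_cong) (simp add: h')
      also have "\<dots> = (\<lambda>y. cell_app X (Suc n) (D (Suc n)) (bd_row X (Suc n) e) y -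
          cell_app X (Suc n) (\<lambda>s. cell_app X n h (bd_row X n s)) (bd_row X (Suc n) e) y)"
        unfolding z_def by (rule mat_app_row_diff)
      finally show ?thesis
        by (simp add: mat_app_bd_row_bd_row[OF e])
    qed
    then show ?thesis
      using h' by (intro exI[of _ h']) (simp add: P_def Q_def z_def)
  qed
  ultimately obtain h where h: "\<And>n. P n (h n)" "\<And>n. Q n (h n) (h (Suc n))"
    using dependent_nat_choice[of P Q] by metis
  then have "carried_homotopy u v h"
    by (simp add: carried_homotopy_def P_def Q_def D_def)
  then show ?thesis
    by (rule that)
qed

text \<open>On a cycle the homotopy term containing the boundary vanishes, so the homotopy applied
  to the cycle bounds the difference of the images.\<close>

theorem carried_matrix_homology_eq:
  fixes u v :: "nat \<Rightarrow> 'a set \<Rightarrow> 'b set \<Rightarrow> 'k"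
  assumes u: "chain_matrix X Y u" "carried X F u" and v: "chain_matrix X Y v" "carried X F v"
    and x: "x \<in> carrier (cell_homology X n)"
  shows "matrix_homology X Y v n x = matrix_homology X Y u n x"
proof -
  obtain h where "carried_homotopy u v h"
    by (rule carried_homotopy_exists[OF u v])
  note h = this[unfolded carried_homotopy_def]
  obtain z where z: "z \<in> cell_cycles X n" "x = hclass X n z"
    using x unfolding carrier_cell_homology by blast
  let ?c = "cell_app X n (h n) z"
  have "cell_boundary Y n ?c = (\<lambda>y. cell_app X n (v n) z y - cell_app X n (u n) z y)"
  proof (cases n)
    case 0
    have "cell_boundary Y 0 (cell_app X 0 (h 0) z)
        = cell_app X 0 (\<lambda>s y. v 0 s y - u 0 s y) z"
      unfolding cell_boundary_mat_app by (rule mat_app_cong) (simp add: h)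
    then show ?thesis
      using 0 by (simp add: mat_app_row_diff)
  next
    case (Suc m)
    have "cell_boundary Y (Suc m) (cell_app X (Suc m) (h (Suc m)) z)
        = cell_app X (Suc m) (\<lambda>s y. (v (Suc m) s y - u (Suc m) s y)
            - cell_app X m (h m) (bd_row X m s) y) z"
      unfolding cell_boundary_mat_app by (rule mat_app_cong) (simp add: h)
    also have "\<dots> = (\<lambda>y. (cell_app X (Suc m) (v (Suc m)) z y - cell_app X (Suc m) (u (Suc m)) z y)
        - cell_app X (Suc m) (\<lambda>s. cell_app X m (h m) (bd_row X m s)) z y)"
      unfolding mat_app_row_diff by (rule refl)
    also have "cell_app X (Suc m) (\<lambda>s. cell_app X m (h m) (bd_row X m s)) z
        = cell_app X m (h m) (cell_boundary X m z)"
      unfolding cell_boundary_eq by (rule mat_app_mat_app[symmetric])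
    also have "cell_boundary X m z = (\<lambda>e. 0)"
      using z(1) Suc by simp
    finally show ?thesis
      using Suc by (simp add: mat_app_zero)
  qed
  moreover have "?c \<in> carrier (cell_chains Y (Suc n))"
    using chains_in_mat_app[of "cells_of_dim X n" z "h n" Y UNIV "Suc n"] h
    by (auto simp: carrier_cell_chains chains_in_def)
  ultimately have "(\<lambda>y. cell_app X n (v n) z y - cell_app X n (u n) z y) \<in> cell_boundaries Y n"
    unfolding cell_boundaries_def by (metis imageI)
  then show ?thesis
    unfolding z(2) matrix_homology_hclass[OF u(1)] matrix_homology_hclass[OF v(1)] hclass_eq_iff .
qed

end

section \<open>Persistent homology\<close>

lemma map_row_local:
  assumes "regular_complex X" "regular_complex Y" "cellular_map X Y f" "e \<in> cells_of_dim X n"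
    "map_row X Y f n e y \<noteq> (0 :: 'k::field)"
  shows "y \<subseteq> cw_space Y closure_of (f ` e)"
proof -
  interpret regular_complex X by fact
  have "map_coeff X Y f n e y \<noteq> 0"
    using assms(5) by (auto simp: map_row_def)
  then show ?thesis
    by (rule map_coeff_local[OF assms(2,3,4)])
qed

section \<open>Homology of a filtered complex as a persistence module\<close>

abbreviation smap_row :: "'a filtered_cw \<Rightarrow> real \<Rightarrow> real \<Rightarrow> nat \<Rightarrow> 'a set \<Rightarrow> 'a set \<Rightarrow> 'k::field" where
  "smap_row X r s \<equiv> map_row (stage X r) (stage X s) (smap X r s)"

lemma regular_complexI: "regularly_filtered X \<Longrightarrow> regular_complex (stage X r)"
  by (simp add: regularly_filtered_def regular_complex_def)

lemma regular_morphism_smap: "regularly_filtered X \<Longrightarrow> r \<le> s \<Longrightarrow> regular_morphism (stage X r) (stage X s) (smap X r s)"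
  by (simp add: regularly_filtered_def)

lemma cellular_map_smap: "regularly_filtered X \<Longrightarrow> r \<le> s \<Longrightarrow> cellular_map (stage X r) (stage X s) (smap X r s)"
  using regular_morphism_smap by (auto simp: regular_morphism_def)

lemma chain_matrix_smap:
  "regularly_filtered X \<Longrightarrow> r \<le> s \<Longrightarrow> chain_matrix (stage X r) (stage X s) (smap_row X r s)"
  by (intro chain_matrix_map_row regular_complexI cellular_map_smap)

lemma (in regular_complex) map_row_id:
  assumes "\<And>x. x \<in> topspace (cw_space X) \<Longrightarrow> f x = x" "z \<in> carrier (cell_chains X n)"
  shows "cell_app X n (map_row X X f n) z = (z :: 'a set \<Rightarrow> 'k::field)"
proof
  fix y
  have "cell_app X n (map_row X X f n) z y = (\<Sum>e\<in>cells_of_dim X n. if e = y then z e else 0)"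
    unfolding mat_app_def map_row_def by (rule sum.cong) (auto simp: map_coeff_id assms(1))
  also have "\<dots> = z y"
    using assms(2) finite_cells_of_dim by (auto simp: carrier_cell_chains)
  finally show "cell_app X n (map_row X X f n) z y = z y" .
qed

lemma (in regular_complex) map_row_compose:
  assumes "regular_complex Y" "regular_complex Z" "cellular_map X Y f" "cellular_map Y Z g" "e \<in> cells_of_dim X n"
    "\<And>x. x \<in> topspace (cw_space X) \<Longrightarrow> k x = g (f x)"
  shows "cell_app Y n (map_row Y Z g n) (map_row X Y f n e) = (map_row X Z k n e :: _ \<Rightarrow> 'k::field)"
proof
  fix z
  have "map_hom X Z k n = map_hom X Z (g \<circ> f) n"
    by (rule map_hom_cong) (simp add: assms(6))
  then have "map_coeff X Z k n e z = (\<Sum>y\<in>cells_of_dim Y n. map_coeff X Y f n e y * map_coeff Y Z g n y z)"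
    using map_coeff_compose[OF assms(1-5)] by (simp add: map_coeff_eq)
  then show "cell_app Y n (map_row Y Z g n) (map_row X Y f n e) z = (map_row X Z k n e z :: 'k)"
    by (simp add: mat_app_def map_row_def)
qed

lemma cell_cycles_subset: "cell_cycles X n \<subseteq> carrier (cell_chains X n)"
  by (cases n) auto

lemma matrix_homology_cong:
  assumes "\<And>e. e \<in> cells_of_dim X n \<Longrightarrow> w n e = w' n e"
  shows "matrix_homology X Y w n x = matrix_homology X Y w' n x"
proof -
  have "cell_app X n (w n) z = cell_app X n (w' n) z" for z
    by (rule mat_app_cong) (rule assms)
  then show ?thesis
    by (simp add: matrix_homology_def)
qed

lemma PH_simps [simp]:
  "pm_at (PH n X) r = cell_homology (stage X r) n"
  "pm_map (PH n X) r s = matrix_homology (stage X r) (stage X s) (smap_row X r s) n"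
  by (simp_all add: PH_def homology_map_eq)

lemma persistence_module_PH:
  fixes X :: "'a filtered_cw"
  assumes X: "regularly_filtered X"
  shows "persistence_module (PH n X :: ('k::field, ('a set \<Rightarrow> 'k) set) pmod)"
  unfolding persistence_module_def PH_simps
proof (intro conjI allI ballI impI)
  fix r :: real
  show "module coeff_field (cell_homology (stage X r) n :: ('k, ('a set \<Rightarrow> 'k) set) module)"
    by (rule module_cell_homology)
next
  fix r s :: real assume "r \<le> s"
  then show "linear_hom (cell_homology (stage X r) n) (cell_homology (stage X s) n)
      (matrix_homology (stage X r) (stage X s) (smap_row X r s) n :: ('a set \<Rightarrow> 'k) set \<Rightarrow> _)"
    by (intro linear_hom_matrix_homology chain_matrix_smap X)
next
  fix r and x :: "('a set \<Rightarrow> 'k) set"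
  assume x: "x \<in> carrier (cell_homology (stage X r) n)"
  interpret regular_complex "stage X r"
    by (rule regular_complexI[OF X])
  obtain z where z: "z \<in> cell_cycles (stage X r) n" "x = hclass (stage X r) n z"
    using x unfolding carrier_cell_homology by blast
  have cm: "chain_matrix (stage X r) (stage X r)
      (smap_row X r r :: nat \<Rightarrow> 'a set \<Rightarrow> 'a set \<Rightarrow> 'k)"
    using chain_matrix_smap[OF X order_refl] .
  have "smap X r r y = y" if "y \<in> topspace (cw_space (stage X r))" for y
    using X that by (simp add: regularly_filtered_def)
  then show "matrix_homology (stage X r) (stage X r) (smap_row X r r) n x = x"
    unfolding z(2) matrix_homology_hclass[OF cm] using z(1) cell_cycles_subset
    by (subst map_row_id) auto
next
  fix r s t and x :: "('a set \<Rightarrow> 'k) set"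
  assume rs: "r \<le> s" and st: "s \<le> t" and x: "x \<in> carrier (cell_homology (stage X r) n)"
  interpret regular_complex "stage X r"
    by (rule regular_complexI[OF X])
  have eq: "smap X r t y = smap X s t (smap X r s y)" if "y \<in> topspace (cw_space (stage X r))" for y
    using X rs st that by (simp add: regularly_filtered_def)
  show "matrix_homology (stage X s) (stage X t) (smap_row X s t) n
      (matrix_homology (stage X r) (stage X s) (smap_row X r s) n x)
    = matrix_homology (stage X r) (stage X t) (smap_row X r t) n x"
    unfolding matrix_homology_compose[OF chain_matrix_smap[OF X rs] chain_matrix_smap[OF X st] x]
    by (rule matrix_homology_cong)
      (rule map_row_compose[OF regular_complexI[OF X] regular_complexI[OF X]
          cellular_map_smap[OF X rs] cellular_map_smap[OF X st] _ eq])
qed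

section \<open>Carriers along regular morphisms and compositions\<close>

lemma (in regular_complex) subcomplex_UN:
  assumes "finite I" "\<And>i. i \<in> I \<Longrightarrow> subcomplex X (f i)"
  shows "subcomplex X (\<Union>i\<in>I. f i)"
proof -
  have "\<forall>i\<in>I. \<exists>E. E \<subseteq> cells X \<and> f i = \<Union>E"
    using assms(2) by (auto simp: subcomplex_def)
  then obtain E where "\<forall>i\<in>I. E i \<subseteq> cells X \<and> f i = \<Union>(E i)"
    by metis
  then have "(\<Union>i\<in>I. f i) = \<Union>(\<Union>i\<in>I. E i)" "(\<Union>i\<in>I. E i) \<subseteq> cells X"
    by auto
  moreover have "closedin (cw_space X) (\<Union>i\<in>I. f i)"
    using assms by (intro closedin_Union) (auto simp: subcomplex_def)
  ultimately show ?thesis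
    unfolding subcomplex_def by metis
qed

text \<open>Monotonicity rests on continuity, which maps closures into closures. Nonemptiness rests
  on regularity: the closure of the image of a cell is a nonempty subcomplex, so it contains a cell
  on which \<open>F\<close> can be evaluated.\<close>

lemma acyclic_carrier_along:
  fixes K :: "'k::field itself"
  assumes X: "regular_complex X" and X': "regular_complex X'" and Y: "regular_complex Y"
    and f: "regular_morphism X X' f" and F: "acyclic_carrier K X' Y F"
    and ac: "\<And>c. c \<in> cells X \<Longrightarrow> acyclic_sub K Y (carr_along X' F f c)"
  shows "acyclic_carrier K X Y (carr_along X' F f)"
proof -
  interpret X: regular_complex X by fact
  interpret X': regular_complex X' by fact
  interpret Y: regular_complex Y by fact
  have cont: "continuous_map (cw_space X) (cw_space X') f"
    using f by (simp add: regular_morphism_def cellular_map_def)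
  have sub: "subcomplex Y (F \<tau>)" if "\<tau> \<in> cells X'" for \<tau>
    using F that by (simp add: acyclic_carrier_def is_carrier_def)
  have "subcomplex Y (carr_along X' F f \<sigma>)" if "\<sigma> \<in> cells X" for \<sigma>
    unfolding carr_along_def carr_on_def
    using X'.finite_cells sub by (intro Y.subcomplex_UN) (auto simp: cells_in_def)
  moreover have "carr_along X' F f \<tau> \<subseteq> carr_along X' F f \<sigma>"
    if "\<sigma> \<in> cells X" "\<tau> \<in> cells_in X (closed_cell X \<sigma>)" for \<sigma> \<tau>
  proof -
    have "f ` \<tau> \<subseteq> f ` closed_cell X \<sigma>"
      using that(2) by (auto simp: cells_in_def)
    also have "\<dots> \<subseteq> cw_space X' closure_of (f ` \<sigma>)"
      unfolding closed_cell_def using cont continuous_map_image_closure_subset by blast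
    finally have "cw_space X' closure_of (f ` \<tau>) \<subseteq> cw_space X' closure_of (f ` \<sigma>)"
      by (simp add: closure_of_minimal)
    then show ?thesis
      by (auto simp: carr_along_def carr_on_def cells_in_def)
  qed
  moreover have "carr_along X' F f \<sigma> \<noteq> {}" if \<sigma>: "\<sigma> \<in> cells X" for \<sigma>
  proof -
    have "\<sigma> \<noteq> {}" "f ` \<sigma> \<subseteq> topspace (cw_space X')"
      using X.cell_nonempty[OF \<sigma>] X.cell_subset_topspace[OF \<sigma>] continuous_map_image_subset_topspace[OF cont]
      by auto
    then have "cw_space X' closure_of (f ` \<sigma>) \<noteq> {}"
      using closure_of_subset by fastforce
    moreover have "subcomplex X' (cw_space X' closure_of (f ` \<sigma>))"
      using f \<sigma> by (simp add: regular_morphism_def)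
    then have "\<Union>(cells_in X' (cw_space X' closure_of (f ` \<sigma>))) = cw_space X' closure_of (f ` \<sigma>)"
      using X' by (intro regular_subcomplex.Union_cells_in)
        (simp add: regular_subcomplex_def regular_subcomplex_axioms_def)
    ultimately obtain \<tau> where \<tau>: "\<tau> \<in> cells_in X' (cw_space X' closure_of (f ` \<sigma>))"
      by blast
    then have "F \<tau> \<noteq> {}"
      using F by (auto simp: acyclic_carrier_def cells_in_def)
    then show ?thesis
      using \<tau> by (auto simp: carr_along_def carr_on_def)
  qed
  ultimately show ?thesis
    using ac by (simp add: acyclic_carrier_def is_carrier_def)
qed

lemma carried_compose:
  assumes "chain_matrix X Y w" "carried X F w" "carried Y G v"
    and "\<And>\<sigma>. \<sigma> \<in> cells X \<Longrightarrow> carr_on Y G (F \<sigma>) \<subseteq> H \<sigma>"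
  shows "carried X H (\<lambda>n e. cell_app Y n (v n) (w n e))"
  unfolding carried_def
proof (intro allI ballI impI)
  fix n e z assume e: "e \<in> cells_of_dim X n" and "cell_app Y n (v n) (w n e) z \<noteq> 0"
  then obtain y where y: "y \<in> cells_of_dim Y n" "w n e y \<noteq> 0" "v n y z \<noteq> 0"
    by (auto elim!: mat_app_nonzeroE)
  then have "y \<subseteq> F e" "z \<subseteq> G y"
    using assms(2,3) e by (auto simp: carried_def)
  then have "z \<subseteq> carr_on Y G (F e)"
    using y(1) by (auto simp: carr_on_def cells_in_def cells_of_dim_def)
  then show "z \<subseteq> H e"
    using assms(4)[of e] e by (auto simp: cells_of_dim_def)
qed

section \<open>From filtered carriers to interleavings\<close>

locale filtered_carrier =
  fixes X :: "'a filtered_cw" and Y :: "'b filtered_cw" and \<epsilon> :: real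
    and K :: "'k::field itself" and F :: "real \<Rightarrow> ('a, 'b) carr"
  assumes X: "regularly_filtered X" and Y: "regularly_filtered Y" and \<epsilon>: "0 \<le> \<epsilon>"
    and F: "eps_acyclic_carrier K \<epsilon> X Y F"
begin

lemma acyclic_carrier_between_stage: "acyclic_carrier_between (stage X a) (stage Y (a + \<epsilon>)) K (F a)"
  using F regular_complexI[OF X] regular_complexI[OF Y]
  by (simp add: eps_acyclic_carrier_def acyclic_carrier_between_def acyclic_carrier_between_axioms_def)

lemma carried_matrices_exist:
  obtains w :: "real \<Rightarrow> nat \<Rightarrow> 'a set \<Rightarrow> 'b set \<Rightarrow> 'k"
  where "\<And>a. chain_matrix (stage X a) (stage Y (a + \<epsilon>)) (w a)" "\<And>a. carried (stage X a) (F a) (w a)"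
proof -
  have "\<exists>w :: nat \<Rightarrow> 'a set \<Rightarrow> 'b set \<Rightarrow> 'k. chain_matrix (stage X a) (stage Y (a + \<epsilon>)) w \<and> carried (stage X a) (F a) w" for a
  proof -
    interpret acyclic_carrier_between "stage X a" "stage Y (a + \<epsilon>)" "K" "F a"
      by (rule acyclic_carrier_between_stage)
    show ?thesis
      using carried_chain_matrix_exists by metis
  qed
  then show ?thesis
    using that by metis
qed

text \<open>The matrices at \<open>a\<close> and \<open>b\<close> are unrelated choices, so the
  square need not commute on chains. Both ways around it are carried by \<open>H\<close>, which is
  an acyclic carrier, and so they agree on homology.\<close>

lemma carried_naturality:
  fixes w :: "real \<Rightarrow> nat \<Rightarrow> 'a set \<Rightarrow> 'b set \<Rightarrow> 'k"
  assumes w: "\<And>a. chain_matrix (stage X a) (stage Y (a + \<epsilon>)) (w a)" "\<And>a. carried (stage X a) (F a) (w a)"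
    and ab: "a \<le> b" and x: "x \<in> carrier (cell_homology (stage X a) n)"
  shows "matrix_homology (stage X b) (stage Y (b + \<epsilon>)) (w b) n
      (matrix_homology (stage X a) (stage X b) (smap_row X a b) n x)
    = matrix_homology (stage Y (a + \<epsilon>)) (stage Y (b + \<epsilon>)) (smap_row Y (a + \<epsilon>) (b + \<epsilon>)) n
      (matrix_homology (stage X a) (stage Y (a + \<epsilon>)) (w a) n x)"
proof -
  define f where "f = smap X a b"
  define g where "g = smap Y (a + \<epsilon>) (b + \<epsilon>)"
  define H where "H = carr_along (stage X b) (F b) f"
  let ?X = "stage X a" and ?X' = "stage X b" and ?Y = "stage Y (a + \<epsilon>)" and ?Y' = "stage Y (b + \<epsilon>)"
  note rX = regular_complexI[OF X] and rY = regular_complexI[OF Y]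
  have ab': "a + \<epsilon> \<le> b + \<epsilon>" using ab by simp
  have f: "regular_morphism ?X ?X' f" "cellular_map ?X ?X' f"
    unfolding f_def using X ab by (auto intro: regular_morphism_smap cellular_map_smap)
  have g: "cellular_map ?Y ?Y' g"
    unfolding g_def using Y ab' by (rule cellular_map_smap)
  have Fb: "acyclic_carrier K ?X' ?Y' (F b)"
    using F by (simp add: eps_acyclic_carrier_def)
  have H: "g ` F a c \<subseteq> H c" "acyclic_sub K ?Y' (H c)" if "c \<in> cells ?X" for c
    using F ab that by (auto simp: eps_acyclic_carrier_def H_def f_def g_def)
  have "acyclic_carrier K ?X ?Y' H"
    using acyclic_carrier_along[OF rX rX rY f(1) Fb] H(2) by (simp add: H_def)
  then interpret acyclic_carrier_between ?X ?Y' K H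
    using rX rY by (simp add: acyclic_carrier_between_def acyclic_carrier_between_axioms_def)
  have mf: "chain_matrix ?X ?X' (map_row ?X ?X' f :: nat \<Rightarrow> 'a set \<Rightarrow> 'a set \<Rightarrow> 'k)"
    and mg: "chain_matrix ?Y ?Y' (map_row ?Y ?Y' g :: nat \<Rightarrow> 'b set \<Rightarrow> 'b set \<Rightarrow> 'k)"
    using chain_matrix_map_row[OF rX rX f(2)] chain_matrix_map_row[OF rY rY g] by auto
  let ?u = "\<lambda>n e. cell_app ?X' n (w b n) (map_row ?X ?X' f n e)"
  let ?v = "\<lambda>n e. cell_app ?Y n (map_row ?Y ?Y' g n) (w a n e)"
  have u: "carried ?X H ?u"
  proof (rule carried_compose[OF mf _ w(2)])
    \<comment> \<open>The closures of the images of the cells serve as a carrier of the chain map of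
      \<open>f\<close>; composing it with \<open>F b\<close> gives \<open>carr_along\<close> by
      definition.\<close>
    show "carried ?X (\<lambda>e. cw_space ?X' closure_of (f ` e)) (map_row ?X ?X' f :: nat \<Rightarrow> 'a set \<Rightarrow> 'a set \<Rightarrow> 'k)"
      unfolding carried_def using map_row_local[OF rX rX f(2)] by blast
  qed (simp add: H_def carr_along_def)
  have v: "carried ?X H ?v"
    unfolding carried_def
  proof (intro allI ballI impI)
    fix m e z assume e: "e \<in> cells_of_dim ?X m" and "?v m e z \<noteq> 0"
    then obtain y where y: "y \<in> cells_of_dim ?Y m" "w a m e y \<noteq> 0" "map_row ?Y ?Y' g m y z \<noteq> (0 :: 'k)"
      by (auto elim!: mat_app_nonzeroE)
    have eX: "e \<in> cells ?X"
      using e by (simp add: cells_of_dim_def)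
    have "y \<subseteq> F a e"
      using w(2)[of a] e y(2) by (auto simp: carried_def)
    then have "g ` y \<subseteq> H e"
      using H(1)[OF eX] by blast
    \<comment> \<open>Being closed, \<open>H e\<close> contains the closure of the image of
      \<open>y\<close>, and with it every cell that occurs in the image of \<open>y\<close>.\<close>
    moreover have "closedin (cw_space ?Y') (H e)"
      using regular_subcomplex.A_closed[OF regular_subcomplex_carrier[OF eX]] .
    ultimately have "cw_space ?Y' closure_of (g ` y) \<subseteq> H e"
      by (rule closure_of_minimal)
    then show "z \<subseteq> H e"
      using map_row_local[OF rY rY g y(1,3)] by blast
  qed
  have "matrix_homology ?X ?Y' ?u n x = matrix_homology ?X ?Y' ?v n x"
    using carried_matrix_homology_eq[OF chain_matrix_compose[OF w(1) mg] v chain_matrix_compose[OF mf w(1)] u x] .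
  then show ?thesis
    unfolding f_def[symmetric] g_def[symmetric]
      matrix_homology_compose[OF mf w(1) x] matrix_homology_compose[OF w(1) mg x] .
qed

lemma shift_morphism_carried:
  fixes w :: "real \<Rightarrow> nat \<Rightarrow> 'a set \<Rightarrow> 'b set \<Rightarrow> 'k"
  assumes w: "\<And>a. chain_matrix (stage X a) (stage Y (a + \<epsilon>)) (w a)" "\<And>a. carried (stage X a) (F a) (w a)"
  shows "shift_morphism \<epsilon> (PH n X :: ('k, ('a set \<Rightarrow> 'k) set) pmod) (PH n Y)
    (\<lambda>a. matrix_homology (stage X a) (stage Y (a + \<epsilon>)) (w a) n)"
  unfolding shift_morphism_def PH_simps
  using linear_hom_matrix_homology[OF w(1)] carried_naturality[OF w] by blast

end

text \<open>The composite of the two chain maps is carried by the composite carrier, hence by the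
  shift carrier \<open>I a\<close>, which also carries the shift. Uniqueness up to homotopy
  identifies the two on homology.\<close>

lemma carried_composite_shift:
  fixes X :: "'a filtered_cw" and Y :: "'b filtered_cw"
    and w :: "real \<Rightarrow> nat \<Rightarrow> 'a set \<Rightarrow> 'b set \<Rightarrow> 'k::field" and v :: "real \<Rightarrow> nat \<Rightarrow> 'b set \<Rightarrow> 'a set \<Rightarrow> 'k"
  assumes X: "regularly_filtered X" and \<epsilon>: "0 \<le> \<epsilon>"
    and w: "\<And>a. chain_matrix (stage X a) (stage Y (a + \<epsilon>)) (w a)" "\<And>a. carried (stage X a) (F a) (w a)"
    and v: "\<And>a. chain_matrix (stage Y a) (stage X (a + \<epsilon>)) (v a)" "\<And>a. carried (stage Y a) (G a) (v a)"
    and I: "shift_carrier TYPE('k) (2 * \<epsilon>) X I"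
    and GF: "\<And>a \<sigma>. \<sigma> \<in> cells (stage X a) \<Longrightarrow> carr_on (stage Y (a + \<epsilon>)) (G (a + \<epsilon>)) (F a \<sigma>) \<subseteq> I a \<sigma>"
    and x: "x \<in> carrier (cell_homology (stage X a) n)"
  shows "matrix_homology (stage Y (a + \<epsilon>)) (stage X (a + \<epsilon> + \<epsilon>)) (v (a + \<epsilon>)) n
      (matrix_homology (stage X a) (stage Y (a + \<epsilon>)) (w a) n x)
    = matrix_homology (stage X a) (stage X (a + 2 * \<epsilon>)) (smap_row X a (a + 2 * \<epsilon>)) n x"
proof -
  let ?X = "stage X a" and ?X' = "stage X (a + 2 * \<epsilon>)" and ?Y = "stage Y (a + \<epsilon>)"
  \<comment> \<open>Two shifts by \<open>\<epsilon>\<close> and one by \<open>2 * \<epsilon>\<close>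
    are equal only after arithmetic, so the stages are identified before the composite is
    formed.\<close>
  have X': "stage X (a + \<epsilon> + \<epsilon>) = ?X'"
    by (simp add: algebra_simps)
  have v': "chain_matrix ?Y ?X' (v (a + \<epsilon>))"
    using v(1)[of "a + \<epsilon>"] by (simp only: X')
  interpret F: filtered_carrier X X "2 * \<epsilon>" "TYPE('k)" I
    using X \<epsilon> I by unfold_locales (auto simp: shift_carrier_def)
  interpret acyclic_carrier_between ?X ?X' "TYPE('k)" "I a"
    by (rule F.acyclic_carrier_between_stage)
  let ?f = "map_row ?X ?X' (smap X a (a + 2 * \<epsilon>)) :: nat \<Rightarrow> 'a set \<Rightarrow> 'a set \<Rightarrow> 'k"
  have f: "chain_matrix ?X ?X' ?f"
    using \<epsilon> by (intro chain_matrix_smap X) simp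
  have "carried ?X (I a) ?f"
    unfolding carried_def
  proof (intro allI ballI impI)
    fix m e y assume e: "e \<in> cells_of_dim ?X m" and nz: "?f m e y \<noteq> 0"
    have "y \<in> cells_of_dim ?X' m"
      using f e nz by (auto simp: chain_matrix_def)
    \<comment> \<open>\<open>carried_by\<close> evaluates a chain map on unit chains, and these
      values are the rows of the matrix.\<close>
    moreover have "induced_chain_map ?X ?X' (smap X a (a + 2 * \<epsilon>)) m (\<lambda>x. if x = e then 1 else 0) = ?f m e"
      unfolding induced_chain_map_eq using X.finite_cells_of_dim e by (rule mat_app_unit)
    ultimately show "y \<subseteq> I a e"
      using I e nz unfolding shift_carrier_def carried_by_def by metis
  qed
  moreover have "carried ?X (I a) (\<lambda>n e. cell_app ?Y n (v (a + \<epsilon>) n) (w a n e))"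
    by (rule carried_compose[OF w(1) w(2) v(2) GF])
  ultimately show ?thesis
    unfolding X' matrix_homology_compose[OF w(1) v' x]
    using carried_matrix_homology_eq[OF f _ chain_matrix_compose[OF w(1) v'] _ x] by blast
qed

theorem lemma4p7:
  fixes X :: "'a filtered_cw" and Y :: "'b filtered_cw" and \<epsilon> :: real
  assumes "regularly_filtered X" and "regularly_filtered Y"
    and "0 \<le> \<epsilon>"
    and "acyclic_equivalent TYPE('k::field) \<epsilon> X Y"
  shows "\<forall>n. interleaving_distance
               (PH n X :: ('k, ('a set \<Rightarrow> 'k) set) pmod)
               (PH n Y :: ('k, ('b set \<Rightarrow> 'k) set) pmod) \<le> ereal \<epsilon>"
proof
  fix n
  obtain F G I J where
    F: "eps_acyclic_carrier TYPE('k) \<epsilon> X Y F" and G: "eps_acyclic_carrier TYPE('k) \<epsilon> Y X G"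
    and I: "shift_carrier TYPE('k) (2 * \<epsilon>) X I" and J: "shift_carrier TYPE('k) (2 * \<epsilon>) Y J"
    and GF: "\<And>a \<sigma>. \<sigma> \<in> cells (stage X a) \<Longrightarrow> carr_on (stage Y (a + \<epsilon>)) (G (a + \<epsilon>)) (F a \<sigma>) \<subseteq> I a \<sigma>"
    and FG: "\<And>a \<sigma>. \<sigma> \<in> cells (stage Y a) \<Longrightarrow> carr_on (stage X (a + \<epsilon>)) (F (a + \<epsilon>)) (G a \<sigma>) \<subseteq> J a \<sigma>"
    using assms(4) unfolding acyclic_equivalent_def by blast
  interpret F: filtered_carrier X Y \<epsilon> "TYPE('k)" F
    by unfold_locales (use assms F in auto)
  interpret G: filtered_carrier Y X \<epsilon> "TYPE('k)" G
    by unfold_locales (use assms G in auto)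
  obtain w :: "real \<Rightarrow> nat \<Rightarrow> 'a set \<Rightarrow> 'b set \<Rightarrow> 'k" where
    w: "\<And>a. chain_matrix (stage X a) (stage Y (a + \<epsilon>)) (w a)" "\<And>a. carried (stage X a) (F a) (w a)"
    by (rule F.carried_matrices_exist) (rule that)
  obtain v :: "real \<Rightarrow> nat \<Rightarrow> 'b set \<Rightarrow> 'a set \<Rightarrow> 'k" where
    v: "\<And>a. chain_matrix (stage Y a) (stage X (a + \<epsilon>)) (v a)" "\<And>a. carried (stage Y a) (G a) (v a)"
    by (rule G.carried_matrices_exist) (rule that)
  have "interleaved \<epsilon> (PH n X :: ('k, ('a set \<Rightarrow> 'k) set) pmod) (PH n Y :: ('k, ('b set \<Rightarrow> 'k) set) pmod)"
    unfolding interleaved_def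
  proof (intro conjI exI allI ballI)
    show "shift_morphism \<epsilon> (PH n X) (PH n Y) (\<lambda>a. matrix_homology (stage X a) (stage Y (a + \<epsilon>)) (w a) n)"
      by (rule F.shift_morphism_carried[OF w])
    show "shift_morphism \<epsilon> (PH n Y) (PH n X) (\<lambda>a. matrix_homology (stage Y a) (stage X (a + \<epsilon>)) (v a) n)"
      by (rule G.shift_morphism_carried[OF v])
  qed (use persistence_module_PH[OF assms(1)] persistence_module_PH[OF assms(2)]
      carried_composite_shift[OF assms(1,3) w v I GF] carried_composite_shift[OF assms(2,3) v w J FG]
      in \<open>simp_all only: PH_simps\<close>)
  then show "interleaving_distance (PH n X :: ('k, ('a set \<Rightarrow> 'k) set) pmod)
      (PH n Y :: ('k, ('b set \<Rightarrow> 'k) set) pmod) \<le> ereal \<epsilon>"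
    \<comment> \<open>\<open>\<epsilon>\<close> itself belongs to the set whose infimum is the
      distance.\<close>
    unfolding interleaving_distance_def using assms(3) by (intro Inf_lower) auto
qed

end
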